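(* If $T\in\mathcal{D}_H'(\mathbb{R}^d)$, then $L_T\in\mathcal{M}(\mathbb{R}^d)$ and $L_T(C^\infty(\mathbb{R}^d))\subset C^\infty(\mathbb{R}^d)$, where $C^\infty(\mathbb{R}^d)$ is regarded as a subspace of $\mathcal{D}'(\mathbb{R}^d)$ via $f\mapsto(\varphi\mapsto\int f\varphi\,dx)$.
   Context: $\mathbb{R}_*=\mathbb{R}\setminus\{0\}$; $\xi y$ is the coordinatewise product. $\mathcal{D}_H'(\mathbb{R}^d)$ is the set of $T\in\mathcal{D}'(\mathbb{R}^d)$ such that for every $\varphi\in\mathcal{D}(\mathbb{R}^d)$ the function $y\mapsto T_\xi\varphi(\xi y)$, $y\in\mathbb{R}_*^d$, is the restriction of a function $M_T\varphi\in\mathcal{D}(\mathbb{R}^d)$; for such $T$, $L_T(S)\varphi=S(M_T\varphi)$ for $S\in\mathcal{D}'(\mathbb{R}^d)$. $\mathcal{M}(\mathbb{R}^d)$ is the set of continuous linear operators on $\mathcal{D}'(\mathbb{R}^d)$ admitting every monomial $x^\alpha$, $\alpha\in\mathbb{N}_0^d$, as eigenvector. *)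

theory Defs
  imports "HOL-Analysis.Analysis"
begin

definition partial :: "'n::finite \<Rightarrow> (real^'n \<Rightarrow> complex) \<Rightarrow> (real^'n \<Rightarrow> complex)" where
  "partial i f = (\<lambda>x. vector_derivative (\<lambda>t. f (x + t *\<^sub>R axis i 1)) (at 0))"

definition iter_partial :: "'n::finite list \<Rightarrow> (real^'n \<Rightarrow> complex) \<Rightarrow> (real^'n \<Rightarrow> complex)" where
  "iter_partial is f = foldr partial is f"

definition smooth :: "(real^'n::finite \<Rightarrow> complex) \<Rightarrow> bool" where
  "smooth f \<longleftrightarrow> (\<forall>is. iter_partial is f differentiable_on UNIV)"

definition test_fun :: "(real^'n::finite \<Rightarrow> complex) \<Rightarrow> bool" where
  "test_fun \<phi> \<longleftrightarrow> smooth \<phi> \<and> compact (closure {x. \<phi> x \<noteq> 0})"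

definition test_null :: "(nat \<Rightarrow> real^'n::finite \<Rightarrow> complex) \<Rightarrow> bool" where
  "test_null \<phi>s \<longleftrightarrow> (\<exists>K. compact K \<and> (\<forall>j. test_fun (\<phi>s j) \<and> {x. \<phi>s j x \<noteq> 0} \<subseteq> K)) \<and>
     (\<forall>is. \<forall>e>0. eventually (\<lambda>j. \<forall>x. norm (iter_partial is (\<phi>s j) x) < e) sequentially)"

text \<open>Distributions: (sequentially) continuous linear functionals on D, normalised to be 0
  on non-test functions so that equality of distributions is equality of functions.\<close>
definition distribution :: "((real^'n::finite \<Rightarrow> complex) \<Rightarrow> complex) \<Rightarrow> bool" where
  "distribution T \<longleftrightarrow>
     (\<forall>\<phi>. \<not> test_fun \<phi> \<longrightarrow> T \<phi> = 0) \<and>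
     (\<forall>\<phi> \<psi> a b. test_fun \<phi> \<longrightarrow> test_fun \<psi> \<longrightarrow> T (\<lambda>x. a * \<phi> x + b * \<psi> x) = a * T \<phi> + b * T \<psi>) \<and>
     (\<forall>\<phi>s. test_null \<phi>s \<longrightarrow> (\<lambda>j. T (\<phi>s j)) \<longlonglongrightarrow> 0)"

definition distributions :: "((real^'n::finite \<Rightarrow> complex) \<Rightarrow> complex) set" where
  "distributions = {T. distribution T}"

definition cmul :: "real^'n::finite \<Rightarrow> real^'n \<Rightarrow> real^'n" where
  "cmul \<xi> y = (\<chi> i. \<xi> $ i * y $ i)"

definition nonzero_coords :: "(real^'n::finite) set" where
  "nonzero_coords = {y. \<forall>i. y $ i \<noteq> 0}"

definition DH :: "((real^'n::finite \<Rightarrow> complex) \<Rightarrow> complex) set" where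
  "DH = {T. distribution T \<and> (\<forall>\<phi>. test_fun \<phi> \<longrightarrow>
            (\<exists>\<psi>. test_fun \<psi> \<and> (\<forall>y\<in>nonzero_coords. T (\<lambda>\<xi>. \<phi> (cmul \<xi> y)) = \<psi> y)))}"

definition M_op :: "((real^'n::finite \<Rightarrow> complex) \<Rightarrow> complex) \<Rightarrow> (real^'n \<Rightarrow> complex) \<Rightarrow> (real^'n \<Rightarrow> complex)" where
  "M_op T \<phi> = (SOME \<psi>. test_fun \<psi> \<and> (\<forall>y\<in>nonzero_coords. T (\<lambda>\<xi>. \<phi> (cmul \<xi> y)) = \<psi> y))"

definition L_op :: "((real^'n::finite \<Rightarrow> complex) \<Rightarrow> complex) \<Rightarrow> ((real^'n \<Rightarrow> complex) \<Rightarrow> complex) \<Rightarrow> ((real^'n \<Rightarrow> complex) \<Rightarrow> complex)" where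
  "L_op T S = (\<lambda>\<phi>. if test_fun \<phi> then S (M_op T \<phi>) else 0)"

definition reg :: "(real^'n::finite \<Rightarrow> complex) \<Rightarrow> ((real^'n \<Rightarrow> complex) \<Rightarrow> complex)" where
  "reg f = (\<lambda>\<phi>. if test_fun \<phi> then (LINT x|lborel. f x * \<phi> x) else 0)"

definition monomial :: "('n::finite \<Rightarrow> nat) \<Rightarrow> ((real^'n \<Rightarrow> complex) \<Rightarrow> complex)" where
  "monomial \<alpha> = reg (\<lambda>x. complex_of_real (\<Prod>i\<in>UNIV. (x $ i) ^ \<alpha> i))"

text \<open>M(R^d): continuous (weak-* topology, i.e. pointwise topology restricted to D') linear
  operators on D' having every monomial as eigenvector.\<close>
definition MM :: "(((real^'n::finite \<Rightarrow> complex) \<Rightarrow> complex) \<Rightarrow> ((real^'n \<Rightarrow> complex) \<Rightarrow> complex)) set" where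
  "MM = {L. L ` distributions \<subseteq> distributions \<and>
           (\<forall>S\<in>distributions. \<forall>S'\<in>distributions. \<forall>a b.
               L (\<lambda>\<phi>. a * S \<phi> + b * S' \<phi>) = (\<lambda>\<phi>. a * L S \<phi> + b * L S' \<phi>)) \<and>
           continuous_on distributions L \<and>
           (\<forall>\<alpha>. \<exists>c. L (monomial \<alpha>) = (\<lambda>\<phi>. c * monomial \<alpha> \<phi>))}"

end

theory Submission
  imports Defs
begin

text \<open>
  Banach--Steinhaus for sequences of distributions (via a gliding hump) is applied to the functionals
  \<open>\<phi> \<mapsto> \<partial>\<^sup>\<alpha>(M\<^sub>T\<phi>)(y)\<close>, which are distributions because they are iterated limits of dilates of \<open>T\<close>. Pointwise
  boundedness is free, since every \<open>M\<^sub>T\<phi>\<close> is a test function; so \<open>M\<^sub>T\<close> maps null sequences to null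
  sequences and \<open>L\<^sub>T\<close> preserves distributions. The same principle bounds the support of \<open>M\<^sub>T\<phi>\<close> in terms
  of that of \<open>\<phi>\<close>, which forces \<open>T\<close> to vanish near the coordinate hyperplanes.

  Cut \<open>T\<close> into dyadic pieces \<open>T\<^sub>k = \<eta>(2\<^sup>-\<^sup>k\<xi>)T\<close>, \<open>k \<in> \<nat>\<^sup>d\<close>, with \<open>\<eta>\<close> supported on a compact set off the
  hyperplanes. Substituting \<open>x = \<xi>y\<close> under \<open>T\<^sub>k\<close> turns \<open>\<integral> f M\<^sub>T\<phi>\<close> into \<open>\<integral> g\<phi>\<close> with
  \<open>g(x) = \<Sum>\<^sub>k (T\<^sub>k)\<^sub>\<xi> f(x/\<xi>) / |\<xi>\<^sub>1 \<cdots> \<xi>\<^sub>d|\<close>. The \<open>k\<close>-th term is \<open>2\<^sup>-\<^sup>k h\<^sub>k(2\<^sup>-\<^sup>kx)\<close> with \<open>h\<^sub>k\<close> bounded on compact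
  sets together with all its derivatives, uniformly in \<open>k\<close>, hence \<open>g\<close> is smooth; and if \<open>f\<close> is a
  monomial, then every term is a multiple of \<open>f\<close>.
\<close>


subsection \<open>Iterated partial derivatives\<close>

text \<open>Membership in \<open>DH\<close> is purely qualitative: it provides a test function for
  each \<phi> but no estimate uniform in \<phi>. Distributions are sequentially continuous by
  definition, so every estimate is extracted from uniform boundedness along null sequences. The
  support of T may be unbounded, and it is not obvious what controls T far out. The control comes
  from \<open>M_op T \<theta>\<close> near 0: rescaled to the fixed shell, the k-th piece is the
  shell cutoff times the dilate of T by \<open>dyad k\<close>, and this dilate takes the value
  \<open>M_op T \<theta> (dyad k)\<close> at \<theta>, bounded in k because a test function is
  bounded. Vanishing near the hyperplanes restricts k to N^d, so only scales going to infinity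
  occur, and the Jacobian of the dilation contributes 2^-(k_1+...+k_d), which is summable over N^d.
  The same factor appears on the other side as the volume, up to a constant, of the box that carries
  the k-th piece of \<open>M_op T \<phi>\<close>; there it justifies exchanging sum and
  integral.\<close>

lemma partial_eq:
  assumes "(f has_derivative D) (at x)"
  shows "partial i f x = D (axis i 1)"
proof -
  have a: "((\<lambda>t::real. x + t *\<^sub>R axis i 1) has_derivative (\<lambda>t. t *\<^sub>R axis i 1)) (at 0)"
    by (auto intro!: derivative_eq_intros)
  have "((\<lambda>t. f (x + t *\<^sub>R axis i 1)) has_derivative (\<lambda>t. D (t *\<^sub>R axis i 1))) (at 0)"
    by (rule has_derivative_compose[OF a, where g = f]) (use assms in simp)
  moreover have "D (t *\<^sub>R axis i 1) = t *\<^sub>R D (axis i 1)" for t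
    using has_derivative_bounded_linear[OF assms]
    by (simp add: linear_simps)
  ultimately have "((\<lambda>t. f (x + t *\<^sub>R axis i 1)) has_vector_derivative D (axis i 1)) (at 0)"
    by (simp add: has_vector_derivative_def)
  then show ?thesis unfolding partial_def by (rule vector_derivative_at)
qed

lemma has_derivative_partial:
  fixes f :: "real^'n::finite \<Rightarrow> complex"
  assumes "f differentiable_on UNIV"
  shows "(f has_derivative (\<lambda>h. \<Sum>i\<in>UNIV. (h $ i) *\<^sub>R partial i f x)) (at x)"
proof -
  obtain D where D: "(f has_derivative D) (at x)"
    using assms by (auto simp: differentiable_on_def differentiable_def)
  have lin: "linear D" using has_derivative_linear[OF D] .
  have "D h = (\<Sum>i\<in>UNIV. (h $ i) *\<^sub>R partial i f x)" for h
  proof -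
    have "D h = D (\<Sum>i\<in>UNIV. (h $ i) *\<^sub>R axis i 1)"
      by (subst basis_expansion[of h, unfolded scalar_mult_eq_scaleR, symmetric]) simp
    also have "\<dots> = (\<Sum>i\<in>UNIV. (h $ i) *\<^sub>R D (axis i 1))"
      by (simp add: linear_sum[OF lin] linear_cmul[OF lin])
    finally show ?thesis by (simp add: partial_eq[OF D])
  qed
  with D show ?thesis by (metis (no_types, lifting) ext)
qed

lemma iter_partial_Nil [simp]: "iter_partial [] f = f"
  by (simp add: iter_partial_def)

lemma iter_partial_Cons: "iter_partial (i # is) f = partial i (iter_partial is f)"
  by (simp add: iter_partial_def)

lemma iter_partial_append: "iter_partial (is @ js) f = iter_partial is (iter_partial js f)"
  by (simp add: iter_partial_def)

lemma smooth_iter_partial: "smooth f \<Longrightarrow> smooth (iter_partial is f)"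
  unfolding smooth_def by (metis iter_partial_append)

lemma smooth_partial: "smooth f \<Longrightarrow> smooth (partial i f)"
  using smooth_iter_partial[of f "[i]"] by (simp add: iter_partial_Cons)

lemma smooth_differentiable: "smooth f \<Longrightarrow> f differentiable_on UNIV"
  unfolding smooth_def by (metis iter_partial_Nil)

lemma smooth_has_derivative:
  "smooth f \<Longrightarrow> (f has_derivative (\<lambda>h. \<Sum>i\<in>UNIV. (h $ i) *\<^sub>R partial i f x)) (at x)"
  by (rule has_derivative_partial) (rule smooth_differentiable)

lemma smooth_continuous: "smooth f \<Longrightarrow> continuous_on S f"
  by (meson smooth_differentiable differentiable_imp_continuous_on continuous_on_subset subset_UNIV)

text \<open>Smoothness is the greatest property that implies differentiability and is inherited by
  partial derivatives. Exhibiting an invariant class of functions thus replaces any formula for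
  higher derivatives.\<close>

lemma smooth_coinduct:
  assumes "P f" and step: "\<And>f. P f \<Longrightarrow> f differentiable_on UNIV \<and> (\<forall>i. P (partial i f))"
  shows "smooth f"
proof -
  have "P (iter_partial is f)" for "is"
    by (induction "is") (use assms in \<open>auto simp: iter_partial_Cons\<close>)
  then show ?thesis unfolding smooth_def using step by blast
qed

inductive fsum :: "((real^'n::finite \<Rightarrow> complex) \<Rightarrow> bool) \<Rightarrow> (real^'n \<Rightarrow> complex) \<Rightarrow> bool"
  for P where
  zero: "fsum P (\<lambda>x. 0)"
| base: "P f \<Longrightarrow> fsum P f"
| add: "fsum P f \<Longrightarrow> fsum P g \<Longrightarrow> fsum P (\<lambda>x. f x + g x)"

lemma fsum_sum: "finite A \<Longrightarrow> (\<And>a. a \<in> A \<Longrightarrow> fsum P (f a)) \<Longrightarrow> fsum P (\<lambda>x. \<Sum>a\<in>A. f a x)"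
  by (induction A rule: finite_induct) (auto intro: fsum.intros)

lemma partial_const [simp]: "partial i (\<lambda>x. c) = (\<lambda>x. 0)"
  by (simp add: partial_def)

lemma partial_add:
  assumes "f differentiable_on UNIV" "g differentiable_on UNIV"
  shows "partial i (\<lambda>x. f x + g x) = (\<lambda>x. partial i f x + partial i g x)"
  using partial_eq[OF has_derivative_add[OF has_derivative_partial[OF assms(1)] has_derivative_partial[OF assms(2)]], of i]
    partial_eq[OF has_derivative_partial[OF assms(1)], of i]
    partial_eq[OF has_derivative_partial[OF assms(2)], of i] by auto

lemma partial_mult:
  assumes "f differentiable_on UNIV" "g differentiable_on UNIV"
  shows "partial i (\<lambda>x. f x * g x) = (\<lambda>x. partial i f x * g x + f x * partial i g x)"
  using partial_eq[OF has_derivative_mult[OF has_derivative_partial[OF assms(1)] has_derivative_partial[OF assms(2)]], of i]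
    partial_eq[OF has_derivative_partial[OF assms(1)], of i]
    partial_eq[OF has_derivative_partial[OF assms(2)], of i] by auto

text \<open>Coinduction up to finite sums: this reduces closure properties of smooth functions to
  differentiating a single product once.\<close>

lemma smooth_coinduct_fsum:
  assumes "P f" and step: "\<And>f. P f \<Longrightarrow> f differentiable_on UNIV \<and> (\<forall>i. fsum P (partial i f))"
  shows "smooth f"
proof (rule smooth_coinduct[of "fsum P"])
  show "fsum P f" using assms(1) by (rule fsum.base)
  fix f assume "fsum P f"
  then show "f differentiable_on UNIV \<and> (\<forall>i. fsum P (partial i f))"
  proof (induction rule: fsum.induct)
    case zero then show ?case by (auto intro: fsum.zero)
  next
    case (base f) then show ?case by (rule step)
  next
    case (add f g) then show ?case by (auto simp: partial_add intro: fsum.add)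
  qed
qed

section \<open>Closure properties of smooth functions\<close>

lemma smooth_const [intro]: "smooth (\<lambda>x. c)"
  by (rule smooth_coinduct[of "\<lambda>f. \<exists>c. f = (\<lambda>x. c)"]) auto

lemma smooth_add [intro]:
  assumes "smooth f" "smooth g" shows "smooth (\<lambda>x. f x + g x)"
proof (rule smooth_coinduct[of "\<lambda>u. \<exists>f g. smooth f \<and> smooth g \<and> u = (\<lambda>x. f x + g x)"])
  fix u :: "(real,'a) vec \<Rightarrow> complex" assume "\<exists>f g. smooth f \<and> smooth g \<and> u = (\<lambda>x. f x + g x)"
  then obtain f g where *: "smooth f" "smooth g" "u = (\<lambda>x. f x + g x)" by blast
  then show "u differentiable_on UNIV \<and> (\<forall>i. \<exists>f g. smooth f \<and> smooth g \<and> partial i u = (\<lambda>x. f x + g x))"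
    using differentiable_on_add[OF *(1,2)[THEN smooth_differentiable]]
      partial_add[OF *(1,2)[THEN smooth_differentiable]] smooth_partial by blast
qed (use assms in blast)

lemma smooth_mult [intro]:
  assumes "smooth f" "smooth g" shows "smooth (\<lambda>x. f x * g x)"
proof (rule smooth_coinduct_fsum[of "\<lambda>u. \<exists>f g. smooth f \<and> smooth g \<and> u = (\<lambda>x. f x * g x)"])
  fix u :: "(real,'a) vec \<Rightarrow> complex" assume "\<exists>f g. smooth f \<and> smooth g \<and> u = (\<lambda>x. f x * g x)"
  then obtain f g where *: "smooth f" "smooth g" "u = (\<lambda>x. f x * g x)" by blast
  have "fsum (\<lambda>u. \<exists>f g. smooth f \<and> smooth g \<and> u = (\<lambda>x. f x * g x)) (partial i u)" for i
    unfolding *(3) partial_mult[OF *(1,2)[THEN smooth_differentiable]]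
    by (rule fsum.add; rule fsum.base) (use * smooth_partial in blast)+
  then show "u differentiable_on UNIV \<and> (\<forall>i. fsum (\<lambda>u. \<exists>f g. smooth f \<and> smooth g \<and> u = (\<lambda>x. f x * g x)) (partial i u))"
    using * differentiable_on_mult[OF *(1,2)[THEN smooth_differentiable]] by blast
qed (use assms in blast)

lemma smooth_diff [intro]:
  assumes "smooth f" "smooth g" shows "smooth (\<lambda>x. f x - g x)"
  using smooth_add[OF assms(1) smooth_mult[OF smooth_const[of "-1"] assms(2)]] by simp

lemma smooth_sum: "(\<And>a. a \<in> A \<Longrightarrow> smooth (f a)) \<Longrightarrow> smooth (\<lambda>x. \<Sum>a\<in>A. f a x)"
  by (induction A rule: infinite_finite_induct) auto

lemma smooth_prod: "(\<And>a. a \<in> A \<Longrightarrow> smooth (f a)) \<Longrightarrow> smooth (\<lambda>x. \<Prod>a\<in>A. f a x)"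
  by (induction A rule: infinite_finite_induct) auto

lemma smooth_power: "smooth f \<Longrightarrow> smooth (\<lambda>x. f x ^ n)"
  by (induction n) auto

lemma partial_coord: "partial i (\<lambda>x. complex_of_real (x $ j)) = (\<lambda>x. if i = j then 1 else 0)"
proof
  fix x :: "real^'a"
  have "((\<lambda>x::real^'a. complex_of_real (x $ j)) has_derivative (\<lambda>h. complex_of_real (h $ j))) (at x)"
    by (intro bounded_linear_imp_has_derivative bounded_linear_compose[OF bounded_linear_of_real bounded_linear_vec_nth])
  from partial_eq[OF this, of i] show "partial i (\<lambda>x. complex_of_real (x $ j)) x = (if i = j then 1 else 0)"
    by (auto simp: axis_def)
qed

lemma smooth_coord [intro]: "smooth (\<lambda>x. complex_of_real (x $ j))"
proof (rule smooth_coinduct[of "\<lambda>u. (\<exists>c. u = (\<lambda>x. c)) \<or> u = (\<lambda>x. complex_of_real (x $ j))"])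
  fix f :: "(real,'a) vec \<Rightarrow> complex"
  have "(\<lambda>x::real^'a. complex_of_real (x $ j)) differentiable_on UNIV"
    by (intro bounded_linear_imp_differentiable_on bounded_linear_compose[OF bounded_linear_of_real bounded_linear_vec_nth])
  moreover assume "(\<exists>c. f = (\<lambda>x. c)) \<or> f = (\<lambda>x. complex_of_real (x $ j))"
  ultimately show "f differentiable_on UNIV \<and>
            (\<forall>i. (\<exists>c. partial i f = (\<lambda>x. c)) \<or> partial i f = (\<lambda>x. complex_of_real (x $ j)))"
    by (auto simp: partial_coord)
qed auto

text \<open>Quotients a / h^k with smooth \<open>a\<close> form an invariant class: the quotient
  rule only raises the exponent, with \<open>d i\<close> as the new numerator.\<close>

lemma smooth_inverse:
  assumes h: "smooth h" and nz: "\<And>x. h x \<noteq> 0" shows "smooth (\<lambda>x. 1 / h x)"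
proof (rule smooth_coinduct[of "\<lambda>u. \<exists>a k. smooth a \<and> u = (\<lambda>x. a x / h x ^ k)"])
  fix u :: "(real,'a) vec \<Rightarrow> complex" assume "\<exists>a k. smooth a \<and> u = (\<lambda>x. a x / h x ^ k)"
  then obtain a k where a: "smooth a" "u = (\<lambda>x. a x / h x ^ k)" by blast
  define d where "d = (\<lambda>i x. partial i a x * h x - of_nat k * a x * partial i h x)"
  have der: "(u has_derivative (\<lambda>v. \<Sum>i\<in>UNIV. (v $ i) *\<^sub>R (d i x / h x ^ (Suc k)))) (at x)" for x
  proof -
    have e: "(\<Sum>i\<in>UNIV. (v $ i) *\<^sub>R (d i x / h x ^ (Suc k))) =
       ((\<Sum>i\<in>UNIV. (v $ i) *\<^sub>R partial i a x) * h x ^ k -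
         a x * (of_nat k * (\<Sum>i\<in>UNIV. (v $ i) *\<^sub>R partial i h x) * h x ^ (k - 1))) / (h x ^ k * h x ^ k)" for v
    proof -
      have "(\<Sum>i\<in>UNIV. (v $ i) *\<^sub>R (d i x / h x ^ (Suc k))) =
        ((\<Sum>i\<in>UNIV. (v $ i) *\<^sub>R partial i a x) * h x - of_nat k * a x * (\<Sum>i\<in>UNIV. (v $ i) *\<^sub>R partial i h x)) / h x ^ (Suc k)"
        unfolding d_def
        by (simp add: sum_distrib_left sum_distrib_right sum_subtractf[symmetric] sum_divide_distrib scaleR_conv_of_real algebra_simps)
      also have "\<dots> = ((\<Sum>i\<in>UNIV. (v $ i) *\<^sub>R partial i a x) * h x ^ k -
         a x * (of_nat k * (\<Sum>i\<in>UNIV. (v $ i) *\<^sub>R partial i h x) * h x ^ (k - 1))) / (h x ^ k * h x ^ k)"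
        using nz[of x] by (cases k) (simp_all add: field_simps)
      finally show ?thesis .
    qed
    show ?thesis unfolding a(2) e
      by (rule has_derivative_divide'[OF smooth_has_derivative[OF a(1)] has_derivative_power[OF smooth_has_derivative[OF h]]])
        (simp add: nz)
  qed
  have "partial i u = (\<lambda>x. d i x / h x ^ (Suc k))" for i
    by (rule ext, subst partial_eq[OF der]) (simp add: axis_def if_distrib[of "\<lambda>c. c *\<^sub>R _"] cong: if_cong)
  moreover have "smooth (d i)" for i unfolding d_def
    using a(1) h by (intro smooth_diff smooth_mult smooth_partial smooth_const) auto
  ultimately have "\<exists>a k. smooth a \<and> partial i u = (\<lambda>x. a x / h x ^ k)" for i by blast
  then show "u differentiable_on UNIV \<and> (\<forall>i. \<exists>a k. smooth a \<and> partial i u = (\<lambda>x. a x / h x ^ k))"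
    using der unfolding differentiable_on_def differentiable_def by auto
next
  show "\<exists>a k. smooth a \<and> (\<lambda>x. 1 / h x) = (\<lambda>x. a x / h x ^ k)"
    by (rule exI[of _ "\<lambda>x. 1"], rule exI[of _ 1]) auto
qed

text \<open>The invariant class (up to sums) consists of products a(x) h(g x) with both
  \<open>a\<close> and \<open>h\<close> varying: the chain rule replaces \<open>h\<close> by its
  partial derivatives and moves the derivatives of \<open>g\<close> into the coefficient.\<close>

lemma smooth_compose:
  fixes h :: "real^'m::finite \<Rightarrow> complex" and g :: "real^'k::finite \<Rightarrow> real^'m"
  assumes h: "smooth h" and g: "\<And>i. smooth (\<lambda>x. complex_of_real (g x $ i))"
  shows "smooth (\<lambda>x. h (g x))"
proof (rule smooth_coinduct_fsum[of "\<lambda>u. \<exists>a h. smooth a \<and> smooth h \<and> u = (\<lambda>x. a x * h (g x))"])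
  fix u :: "real^'k \<Rightarrow> complex" assume "\<exists>a h. smooth a \<and> smooth h \<and> u = (\<lambda>x. a x * h (g x))"
  then obtain a h where *: "smooth a" "smooth h" "u = (\<lambda>x. a x * h (g x))" by blast
  let ?d = "\<lambda>j i x. partial j (\<lambda>x. complex_of_real (g x $ i)) x"
  have re: "(\<Sum>j\<in>UNIV. (v $ j) *\<^sub>R Re (?d j i x)) = Re (\<Sum>j\<in>UNIV. (v $ j) *\<^sub>R ?d j i x)" for v i x
    by (simp add: Re_sum)
  have gi: "((\<lambda>x. g x $ i) has_derivative (\<lambda>v. \<Sum>j\<in>UNIV. (v $ j) *\<^sub>R Re (?d j i x))) (at x)" for i x
    using bounded_linear.has_derivative[OF bounded_linear_Re smooth_has_derivative[OF g[of i]], of x] re by simp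
  have "(g has_derivative (\<lambda>v. \<chi> i. \<Sum>j\<in>UNIV. (v $ j) *\<^sub>R Re (?d j i x))) (at x)" for x
    by (subst has_derivative_componentwise_within) (use gi in \<open>auto simp: Basis_vec_def inner_axis\<close>)
  then have hg: "((\<lambda>x. h (g x)) has_derivative (\<lambda>v. \<Sum>i\<in>UNIV. (\<Sum>j\<in>UNIV. (v $ j) *\<^sub>R Re (?d j i x)) *\<^sub>R partial i h (g x))) (at x)" for x
    using has_derivative_compose[of g _ x UNIV h, OF _ smooth_has_derivative[OF *(2)]] by fastforce
  \<comment> \<open>The chain rule \<open>hg\<close> has the coefficients
    \<open>Re (?d j i x)\<close>. Since coordinates are real, they coincide with the functions
    \<open>?d j i\<close>, whose smoothness is known.\<close>
  have im: "Im (?d j i x) = 0" for j i x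
  proof -
    have "((\<lambda>x. Im (complex_of_real (g x $ i))) has_derivative (\<lambda>v. Im (\<Sum>j\<in>UNIV. (v $ j) *\<^sub>R ?d j i x))) (at x)"
      using bounded_linear.has_derivative[OF bounded_linear_Im smooth_has_derivative[OF g[of i]], of x] by simp
    then have "(\<lambda>v. Im (\<Sum>j\<in>UNIV. (v $ j) *\<^sub>R ?d j i x)) = (\<lambda>v. 0)"
      by (intro has_derivative_unique[of "\<lambda>x. 0" _ x]) (simp_all)
    from fun_cong[OF this, of "axis j 1"] show ?thesis
      by (simp add: Im_sum axis_def if_distrib[of "\<lambda>c. c * _"] cong: if_cong)
  qed
  have hgd: "(\<lambda>x. h (g x)) differentiable_on UNIV"
    using hg unfolding differentiable_on_def differentiable_def by blast
  have "partial j (\<lambda>x. h (g x)) x = (\<Sum>i\<in>UNIV. ?d j i x * partial i h (g x))" for j x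
    by (subst partial_eq[OF hg]) (simp add: im complex_eq_iff axis_def if_distrib[of "\<lambda>c. c * _"] cong: if_cong)
  then have p: "partial j u = (\<lambda>x. partial j a x * h (g x) + (\<Sum>i\<in>UNIV. a x * ?d j i x * partial i h (g x)))" for j
    unfolding *(3) by (subst partial_mult[OF smooth_differentiable[OF *(1)] hgd]) (simp add: sum_distrib_left mult.assoc)
  have "fsum (\<lambda>u. \<exists>a h. smooth a \<and> smooth h \<and> u = (\<lambda>x. a x * h (g x))) (partial j u)" for j
    unfolding p
    apply (intro fsum.add fsum_sum)
      apply (rule fsum.base, rule exI[of _ "partial j a"], rule exI[of _ h], use * smooth_partial[of a j] in blast)
     apply simp
    subgoal for i
      apply (rule fsum.base, rule exI[of _ "\<lambda>x. a x * ?d j i x"], rule exI[of _ "partial i h"])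
      using smooth_mult[OF *(1) smooth_partial[OF g[of i], of j]] smooth_partial[OF *(2), of i] by blast
    done
  then show "u differentiable_on UNIV \<and> (\<forall>i. fsum (\<lambda>u. \<exists>a h. smooth a \<and> smooth h \<and> u = (\<lambda>x. a x * h (g x))) (partial i u))"
    using differentiable_on_mult[OF smooth_differentiable[OF *(1)] hgd] *(3) by blast
next
  show "\<exists>a ha. smooth a \<and> smooth ha \<and> (\<lambda>x. h (g x)) = (\<lambda>x. a x * ha (g x))"
    by (rule exI[of _ "\<lambda>x. 1"], rule exI[of _ h]) (use h in auto)
qed

lemma iter_partial_linear:
  assumes "smooth f" "smooth g"
  shows "iter_partial is (\<lambda>x. a * f x + b * g x) = (\<lambda>x. a * iter_partial is f x + b * iter_partial is g x)"
proof (induction "is")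
  case (Cons i "is")
  have s: "smooth (iter_partial is f)" "smooth (iter_partial is g)" using assms smooth_iter_partial by auto
  have d: "partial i (\<lambda>x. a * iter_partial is f x) = (\<lambda>x. a * partial i (iter_partial is f) x)"
    if "smooth (iter_partial is f)" for f a
    by (subst partial_mult) (use that in \<open>auto intro: smooth_differentiable\<close>)
  show ?case unfolding iter_partial_Cons Cons
    by (subst partial_add) (use s in \<open>auto simp: d intro!: smooth_differentiable\<close>)
qed simp

lemma iter_partial_cmult:
  "smooth f \<Longrightarrow> iter_partial is (\<lambda>x. a * f x) = (\<lambda>x. a * iter_partial is f x)"
  using iter_partial_linear[of f f "is" a 0] by simp

lemma iter_partial_add:
  "smooth f \<Longrightarrow> smooth g \<Longrightarrow> iter_partial is (\<lambda>x. f x + g x) = (\<lambda>x. iter_partial is f x + iter_partial is g x)"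
  using iter_partial_linear[of f g "is" 1 1] by simp

lemma iter_partial_diff:
  "smooth f \<Longrightarrow> smooth g \<Longrightarrow> iter_partial is (\<lambda>x. f x - g x) = (\<lambda>x. iter_partial is f x - iter_partial is g x)"
  using iter_partial_linear[of f g "is" 1 "-1"] by simp

lemma iter_partial_zero [simp]: "iter_partial is (\<lambda>x. 0) = (\<lambda>x. 0)"
  by (induction "is") (auto simp: iter_partial_Cons)

lemma iter_partial_sum:
  "finite A \<Longrightarrow> (\<And>a. a \<in> A \<Longrightarrow> smooth (f a)) \<Longrightarrow>
    iter_partial is (\<lambda>x. \<Sum>a\<in>A. f a x) = (\<lambda>x. \<Sum>a\<in>A. iter_partial is (f a) x)"
  by (induction A rule: finite_induct) (auto simp: iter_partial_add smooth_sum)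

lemma partial_eq_0_open:
  assumes "open U" "\<And>x. x \<in> U \<Longrightarrow> f x = 0" "x \<in> U"
  shows "partial i f x = 0"
proof -
  have "(f has_derivative (\<lambda>h. 0)) (at x)"
    by (rule has_derivative_transform_within_open[of "\<lambda>x. 0" _ _ _ U]) (use assms in auto)
  from partial_eq[OF this] show ?thesis by simp
qed

lemma iter_partial_eq_0_outside:
  assumes "closed K" "\<And>x. x \<notin> K \<Longrightarrow> f x = 0" "x \<notin> K"
  shows "iter_partial is f x = 0"
  using assms(3)
proof (induction "is" arbitrary: x)
  case (Cons i "is")
  then show ?case unfolding iter_partial_Cons
    by (intro partial_eq_0_open[of "- K"]) (use assms(1) in auto)
qed (use assms in auto)

text \<open>All derivative series are handled at once: \<open>S is\<close> is the sum of the series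
  differentiated along \<open>is\<close>, and the functions \<open>S is\<close> form an invariant
  class. Majorants on balls suffice because differentiability is local.\<close>

lemma smooth_series:
  fixes G :: "nat \<Rightarrow> real^'n::finite \<Rightarrow> complex"
  assumes G: "\<And>n. smooth (G n)"
    and bd: "\<And>is R. \<exists>M. summable M \<and> (\<forall>n x. norm x \<le> R \<longrightarrow> norm (iter_partial is (G n) x) \<le> M n)"
  shows "smooth (\<lambda>x. \<Sum>n. G n x)"
    and "iter_partial is (\<lambda>x. \<Sum>n. G n x) = (\<lambda>x. \<Sum>n. iter_partial is (G n) x)"
proof -
  have sm: "summable (\<lambda>n. iter_partial is (G n) x)" for "is" x
  proof -
    obtain M where "summable M" "\<forall>n y. norm y \<le> norm x \<longrightarrow> norm (iter_partial is (G n) y) \<le> M n"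
      using bd[of "norm x" "is"] by blast
    then show ?thesis by (auto intro: summable_comparison_test'[where g = M and N = 0 and f = "\<lambda>n. iter_partial is (G n) x"])
  qed
  define S where "S = (\<lambda>is x. \<Sum>n. iter_partial is (G n) x)"
  have der: "(S is has_derivative (\<lambda>h. \<Sum>i\<in>UNIV. (h $ i) *\<^sub>R S (i # is) x)) (at x)" for "is" and x
  proof -
    define R where "R = norm x + 1"
    let ?f = "\<lambda>n. iter_partial is (G n)"
    let ?f' = "\<lambda>n x h. \<Sum>i\<in>UNIV. (h $ i) *\<^sub>R iter_partial (i # is) (G n) x"
    let ?g' = "\<lambda>x h. \<Sum>i\<in>UNIV. (h $ i) *\<^sub>R S (i # is) x"
    have x: "x \<in> ball 0 R" by (simp add: R_def)
    have "\<exists>g. \<forall>x\<in>ball 0 R. (\<lambda>n. ?f n x) sums g x \<and> (g has_derivative ?g' x) (at x within ball 0 R)"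
    proof (rule has_derivative_series[of "ball 0 R" ?f ?f' ?g' x "S is x"])
      fix n y show "(?f n has_derivative ?f' n y) (at y within ball 0 R)"
        unfolding iter_partial_Cons
        by (rule has_derivative_at_withinI, rule smooth_has_derivative, rule smooth_iter_partial, rule G)
    next
      fix e :: real assume e: "e > 0"
      \<comment> \<open>The derivative is a sum of \<open>CARD('n)\<close> coordinate terms, each of
        which receives an equal share of the error.\<close>
      define e' where "e' = e / real CARD('n)"
      have e': "e' > 0" using e by (simp add: e'_def)
      have "\<forall>\<^sub>F n in sequentially. \<forall>y\<in>ball 0 R. norm ((\<Sum>k<n. iter_partial (i # is) (G k) y) - S (i # is) y) < e'" for i
      proof -
        obtain M where M: "summable M" "\<And>n y. norm y \<le> R \<Longrightarrow> norm (iter_partial (i # is) (G n) y) \<le> M n"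
          using bd[of R "i # is"] by blast
        have "uniform_limit (ball 0 R) (\<lambda>n y. \<Sum>k<n. iter_partial (i # is) (G k) y)
           (\<lambda>y. \<Sum>k. iter_partial (i # is) (G k) y) sequentially"
          by (rule Weierstrass_m_test[OF _ M(1)]) (use M in auto)
        from uniform_limitD[OF this e'] show ?thesis unfolding S_def by (simp add: dist_norm)
      qed
      then have "\<forall>\<^sub>F n in sequentially. \<forall>i. \<forall>y\<in>ball 0 R. norm ((\<Sum>k<n. iter_partial (i # is) (G k) y) - S (i # is) y) < e'"
        by (intro eventually_all_finite) auto
      then show "\<forall>\<^sub>F n in sequentially. \<forall>y\<in>ball 0 R. \<forall>h. norm ((\<Sum>k<n. ?f' k y h) - ?g' y h) \<le> e * norm h"
      proof eventually_elim
        case (elim n)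
        show ?case
        proof (intro ballI allI)
          fix y h :: "real^'n" assume y: "y \<in> ball 0 R"
          have "(\<Sum>k<n. ?f' k y h) - ?g' y h = (\<Sum>i\<in>UNIV. (h $ i) *\<^sub>R ((\<Sum>k<n. iter_partial (i # is) (G k) y) - S (i # is) y))"
            by (subst sum.swap) (simp add: scaleR_sum_right scaleR_diff_right sum_subtractf)
          also have "norm \<dots> \<le> (\<Sum>i\<in>(UNIV::'n set). norm h * e')"
          proof (rule sum_norm_le)
            fix i
            have "norm ((\<Sum>k<n. iter_partial (i # is) (G k) y) - S (i # is) y) \<le> e'"
              using elim y by (simp add: less_imp_le)
            then show "norm ((h $ i) *\<^sub>R ((\<Sum>k<n. iter_partial (i # is) (G k) y) - S (i # is) y)) \<le> norm h * e'"
              unfolding norm_scaleR by (intro mult_mono component_le_norm_cart) auto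
          qed
          also have "\<dots> = e * norm h" by (simp add: e'_def)
          finally show "norm ((\<Sum>k<n. ?f' k y h) - ?g' y h) \<le> e * norm h" .
        qed
      qed
    next
      show "(\<lambda>n. ?f n x) sums S is x" unfolding S_def using sm by (simp add: summable_sums)
    qed (use x in auto)
    then obtain g where g: "\<And>y. y \<in> ball 0 R \<Longrightarrow> (\<lambda>n. ?f n y) sums g y"
      "\<And>y. y \<in> ball 0 R \<Longrightarrow> (g has_derivative ?g' y) (at y within ball 0 R)" by blast
    have gS: "g y = S is y" if "y \<in> ball 0 R" for y
      using g(1)[OF that] by (simp add: S_def sums_iff)
    have "(g has_derivative ?g' x) (at x)" using g(2)[OF x] at_within_open[OF x] by simp
    then show ?thesis
      by (rule has_derivative_transform_within_open[of _ _ _ _ "ball 0 R"]) (use x gS in auto)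
  qed
  have pS: "partial i (S is) = S (i # is)" for i "is"
    by (rule ext, subst partial_eq[OF der]) (simp add: axis_def if_distrib[of "\<lambda>c. c *\<^sub>R _"] cong: if_cong)
  have it: "iter_partial js (S is) = S (js @ is)" for js "is"
    by (induction js) (auto simp: iter_partial_Cons pS)
  have S0: "S [] = (\<lambda>x. \<Sum>n. G n x)" by (simp add: S_def)
  show "iter_partial is (\<lambda>x. \<Sum>n. G n x) = (\<lambda>x. \<Sum>n. iter_partial is (G n) x)"
    using it[of "is" "[]"] unfolding S0 by (simp add: S_def)
  have "smooth (S [])"
    by (rule smooth_coinduct[of "\<lambda>u. \<exists>is. u = S is"])
      (use der pS in \<open>auto simp: differentiable_on_def differentiable_def\<close>)
  then show "smooth (\<lambda>x. \<Sum>n. G n x)" unfolding S0 .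
qed

subsection \<open>Symmetry of second partial derivatives\<close>

text \<open>The mean value inequality in direction i reduces the second difference to an increment
  of \<open>partial i f\<close> in direction j, which the derivative of \<open>partial i f\<close>
  at x controls to first order.\<close>

lemma second_difference_estimate:
  fixes f :: "real^'n::finite \<Rightarrow> complex"
  assumes f: "smooth f" and e: "e > 0"
  shows "\<exists>d>0. \<forall>s. 0 < s \<and> s < d \<longrightarrow>
    norm (f (x + s *\<^sub>R axis i 1 + s *\<^sub>R axis j 1) - f (x + s *\<^sub>R axis i 1) - f (x + s *\<^sub>R axis j 1) + f x
       - (s * s) *\<^sub>R partial j (partial i f) x) \<le> e * (s * s)"
proof -
  define p where "p = partial i f"
  define p' where "p' = (\<lambda>h. \<Sum>k\<in>UNIV. (h $ k) *\<^sub>R partial k p x)"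
  have dp: "(p has_derivative p') (at x)"
    unfolding p'_def p_def by (intro smooth_has_derivative smooth_partial f)
  then obtain d where d: "d > 0" "\<And>y. norm (y - x) < d \<Longrightarrow> norm (p y - p x - p' (y - x)) \<le> e / 4 * norm (y - x)"
    unfolding has_derivative_at_alt using e by (metis zero_less_divide_iff zero_less_numeral)
  have lin: "linear p'" using dp by (rule has_derivative_linear)
  have p'j: "p' (s *\<^sub>R axis j 1) = s *\<^sub>R partial j p x" for s
    unfolding linear_cmul[OF lin] using partial_eq[OF dp, of j] by simp
  show ?thesis
  proof (intro exI[of _ "d / 2"] conjI allI impI)
    show "d / 2 > 0" using d by simp
    fix s assume s: "0 < s \<and> s < d / 2"
    \<comment> \<open>The linear term is built in so that \<open>H s - H 0\<close> is exactly the
      second difference minus its expected value, while \<open>H'\<close> is a difference of two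
      first order remainders of \<open>partial i f\<close> at x.\<close>
    define H where "H = (\<lambda>u. f (x + u *\<^sub>R axis i 1 + s *\<^sub>R axis j 1) - f (x + u *\<^sub>R axis i 1) - u *\<^sub>R (s *\<^sub>R partial j p x))"
    define H' where "H' = (\<lambda>u. p (x + u *\<^sub>R axis i 1 + s *\<^sub>R axis j 1) - p (x + u *\<^sub>R axis i 1) - s *\<^sub>R partial j p x)"
    have fd: "((\<lambda>u. f (z + u *\<^sub>R axis i 1)) has_derivative (\<lambda>t. t *\<^sub>R p (z + u *\<^sub>R axis i 1))) (at u within A)" for z u A
    proof -
      have a: "((\<lambda>u. z + u *\<^sub>R axis i 1) has_derivative (\<lambda>t. t *\<^sub>R axis i 1)) (at u within A)"
        by (auto intro!: derivative_eq_intros)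
      have b: "(\<Sum>k\<in>UNIV. ((t *\<^sub>R axis i 1) $ k) *\<^sub>R partial k f y) = t *\<^sub>R p y" for t y
        by (simp add: p_def axis_def if_distrib[of "\<lambda>c. _ * c"] if_distrib[of "\<lambda>c. c *\<^sub>R _"] cong: if_cong)
      show ?thesis
        using has_derivative_compose[OF a smooth_has_derivative[OF f]] unfolding b .
    qed
    have Hd: "(H has_derivative (\<lambda>t. t *\<^sub>R H' u)) (at u within {0..s})" for u
    proof -
      have 1: "H = (\<lambda>u. f ((x + s *\<^sub>R axis j 1) + u *\<^sub>R axis i 1) - f (x + u *\<^sub>R axis i 1) - u *\<^sub>R (s *\<^sub>R partial j p x))"
        unfolding H_def by (simp add: add_ac)
      have 2: "(\<lambda>t. t *\<^sub>R H' u) = (\<lambda>t. t *\<^sub>R p ((x + s *\<^sub>R axis j 1) + u *\<^sub>R axis i 1) - t *\<^sub>R p (x + u *\<^sub>R axis i 1) - t *\<^sub>R (s *\<^sub>R partial j p x))"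
        unfolding H'_def by (simp add: add_ac scaleR_diff_right)
      show ?thesis unfolding 1 2
        by (intro has_derivative_diff fd has_derivative_scaleR_left has_derivative_ident)
    qed
    have H'b: "norm (H' u) \<le> e * s" if u: "u \<in> {0..s}" for u
    proof -
      define a where "a = u *\<^sub>R axis i (1::real)"
      define b where "b = s *\<^sub>R axis j (1::real)"
      have na: "norm a \<le> s" "norm b \<le> s" using u s by (auto simp: a_def b_def)
      have nab: "norm (a + b) \<le> 2 * s" using norm_triangle_ineq[of a b] na by simp
      have "H' u = (p (x + a + b) - p x - p' (a + b)) - (p (x + a) - p x - p' a)"
        unfolding H'_def linear_add[OF lin] a_def[symmetric] p'j[symmetric] b_def by (simp add: add_ac)
      also have "norm \<dots> \<le> norm (p (x + a + b) - p x - p' (a + b)) + norm (p (x + a) - p x - p' a)"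
        by (rule norm_triangle_ineq4)
      also have "\<dots> \<le> e / 4 * norm (a + b) + e / 4 * norm a"
        using d(2)[of "x + a + b"] d(2)[of "x + a"] nab na s by (simp add: add.assoc)
      also have "\<dots> \<le> e / 4 * (2 * s) + e / 4 * s"
        using e nab na by (intro add_mono mult_left_mono) auto
      also have "\<dots> \<le> e * s" using e s by simp
      finally show ?thesis .
    qed
    have "norm (H s - H 0) \<le> e * s * norm (s - 0)"
    proof (rule differentiable_bound[of "{0..s}" H "\<lambda>u t. t *\<^sub>R H' u"])
      fix u assume u: "u \<in> {0..s}"
      show "onorm (\<lambda>t. t *\<^sub>R H' u) \<le> e * s"
        using H'b[OF u] by (intro onorm_le) (auto simp: mult.commute intro: mult_left_mono)
    qed (use Hd s in auto)
    moreover have "H s - H 0 = f (x + s *\<^sub>R axis i 1 + s *\<^sub>R axis j 1) - f (x + s *\<^sub>R axis i 1) - f (x + s *\<^sub>R axis j 1) + f x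
       - (s * s) *\<^sub>R partial j p x"
      unfolding H_def by simp
    ultimately show "norm (f (x + s *\<^sub>R axis i 1 + s *\<^sub>R axis j 1) - f (x + s *\<^sub>R axis i 1) - f (x + s *\<^sub>R axis j 1) + f x
       - (s * s) *\<^sub>R partial j (partial i f) x) \<le> e * (s * s)"
      using s by (simp add: p_def)
  qed
qed

text \<open>The second difference is symmetric in i and j, so both mixed derivatives are its leading
  coefficient.\<close>

lemma partial_commute:
  assumes f: "smooth f"
  shows "partial i (partial j f) = partial j (partial i f)"
proof
  fix x
  let ?a = "partial j (partial i f) x" and ?b = "partial i (partial j f) x"
  have "norm (?a - ?b) \<le> 0 + e" if e: "e > 0" for e
  proof -
    define Q where "Q = (\<lambda>s. f (x + s *\<^sub>R axis i 1 + s *\<^sub>R axis j 1) - f (x + s *\<^sub>R axis i 1) - f (x + s *\<^sub>R axis j 1) + f x)"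
    have e2: "e / 2 > 0" using e by simp
    obtain d1 where d1: "d1 > 0" "\<forall>s. 0 < s \<and> s < d1 \<longrightarrow> norm (Q s - (s * s) *\<^sub>R ?a) \<le> e / 2 * (s * s)"
      using second_difference_estimate[OF f e2, of x i j] unfolding Q_def by blast
    have sw: "f (x + s *\<^sub>R axis j 1 + s *\<^sub>R axis i 1) - f (x + s *\<^sub>R axis j 1) - f (x + s *\<^sub>R axis i 1) + f x = Q s" for s
      unfolding Q_def by (simp add: add_ac)
    obtain d2 where d2: "d2 > 0" "\<forall>s. 0 < s \<and> s < d2 \<longrightarrow> norm (Q s - (s * s) *\<^sub>R ?b) \<le> e / 2 * (s * s)"
      using second_difference_estimate[OF f e2, of x j i] unfolding sw by blast
    define s where "s = min d1 d2 / 2"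
    have s: "0 < s" "s < d1" "s < d2" using d1 d2 by (auto simp: s_def)
    have "norm ((s * s) *\<^sub>R (?a - ?b)) = norm ((Q s - (s * s) *\<^sub>R ?b) - (Q s - (s * s) *\<^sub>R ?a))"
      by (simp add: scaleR_diff_right)
    also have "\<dots> \<le> e / 2 * (s * s) + e / 2 * (s * s)"
      using norm_triangle_ineq4[of "Q s - (s * s) *\<^sub>R ?b" "Q s - (s * s) *\<^sub>R ?a"] d1(2) d2(2) s by fastforce
    finally have "(s * s) * norm (?a - ?b) \<le> (s * s) * e"
      using s unfolding norm_scaleR by (simp add: algebra_simps)
    moreover have "s * s > 0" using s by simp
    ultimately have "norm (?a - ?b) \<le> e" using mult_le_cancel_left_pos by blast
    then show ?thesis by simp
  qed
  then have "norm (?a - ?b) \<le> 0" by (rule field_le_epsilon)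
  then show "?b = ?a" by simp
qed

text \<open>Serves to move a derivative in the parameter of a family past derivatives in the test
  variable, in \<open>family_difference_quotient_null\<close>.\<close>

lemma partial_iter_partial_commute:
  "smooth f \<Longrightarrow> partial i (iter_partial is f) = iter_partial is (partial i f)"
  by (induction "is") (simp_all add: iter_partial_Cons partial_commute smooth_iter_partial)

subsection \<open>Test functions and distributions\<close>

lemma test_fun_iff: "test_fun \<phi> \<longleftrightarrow> smooth \<phi> \<and> (\<exists>K. compact K \<and> {x. \<phi> x \<noteq> 0} \<subseteq> K)"
proof
  assume "test_fun \<phi>"
  then show "smooth \<phi> \<and> (\<exists>K. compact K \<and> {x. \<phi> x \<noteq> 0} \<subseteq> K)"
    unfolding test_fun_def using closure_subset[of "{x. \<phi> x \<noteq> 0}"] by blast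
next
  assume "smooth \<phi> \<and> (\<exists>K. compact K \<and> {x. \<phi> x \<noteq> 0} \<subseteq> K)"
  then obtain K where "smooth \<phi>" "compact K" "{x. \<phi> x \<noteq> 0} \<subseteq> K" by blast
  then show "test_fun \<phi>" unfolding test_fun_def
    by (simp add: compact_closure bounded_subset[OF compact_imp_bounded])
qed

lemma test_fun_smooth [intro]: "test_fun \<phi> \<Longrightarrow> smooth \<phi>"
  by (simp add: test_fun_def)

lemma test_fun_linear:
  assumes "test_fun \<phi>" "test_fun \<psi>" shows "test_fun (\<lambda>x. a * \<phi> x + b * \<psi> x)"
proof -
  obtain K L where "compact K" "{x. \<phi> x \<noteq> 0} \<subseteq> K" "compact L" "{x. \<psi> x \<noteq> 0} \<subseteq> L"
    using assms unfolding test_fun_iff by blast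
  then show ?thesis unfolding test_fun_iff using assms
    by (intro conjI exI[of _ "K \<union> L"]) (auto intro!: smooth_add smooth_mult, metis (mono_tags) add_cancel_left_left mem_Collect_eq mult_zero_right subsetD)
qed

lemma test_fun_zero [intro, simp]: "test_fun (\<lambda>x. 0)"
  unfolding test_fun_iff by (auto intro!: exI[of _ "{}"])

lemma test_fun_mult:
  assumes "smooth f" "test_fun \<phi>" shows "test_fun (\<lambda>x. f x * \<phi> x)"
proof -
  obtain K where "compact K" "{x. \<phi> x \<noteq> 0} \<subseteq> K" using assms unfolding test_fun_iff by blast
  then show ?thesis unfolding test_fun_iff using assms by (intro conjI exI[of _ K]) auto
qed

lemma test_fun_cmult: "test_fun \<phi> \<Longrightarrow> test_fun (\<lambda>x. a * \<phi> x)"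
  by (rule test_fun_mult) auto

lemma test_fun_diff: "test_fun \<phi> \<Longrightarrow> test_fun \<psi> \<Longrightarrow> test_fun (\<lambda>x. \<phi> x - \<psi> x)"
  using test_fun_linear[of \<phi> \<psi> 1 "-1"] by simp

lemma test_fun_add: "test_fun \<phi> \<Longrightarrow> test_fun \<psi> \<Longrightarrow> test_fun (\<lambda>x. \<phi> x + \<psi> x)"
  using test_fun_linear[of \<phi> \<psi> 1 "1"] by simp

lemma test_fun_sum: "(\<And>a. a \<in> A \<Longrightarrow> test_fun (f a)) \<Longrightarrow> test_fun (\<lambda>x. \<Sum>a\<in>A. f a x)"
  by (induction A rule: infinite_finite_induct) (auto intro: test_fun_add)

lemma test_fun_bounded:
  assumes "test_fun \<phi>" shows "\<exists>C. \<forall>x. norm (iter_partial is \<phi> x) \<le> C"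
proof -
  obtain K where K: "compact K" "{x. \<phi> x \<noteq> 0} \<subseteq> K" and s: "smooth \<phi>"
    using assms unfolding test_fun_iff by blast
  have "bounded (iter_partial is \<phi> ` K)"
    by (intro compact_imp_bounded compact_continuous_image K smooth_continuous smooth_iter_partial s)
  then obtain C where C: "\<And>x. x \<in> K \<Longrightarrow> norm (iter_partial is \<phi> x) \<le> C" unfolding bounded_iff by blast
  have "iter_partial is \<phi> x = 0" if "x \<notin> K" for x
    by (rule iter_partial_eq_0_outside[of K]) (use K that compact_imp_closed in auto)
  then have "norm (iter_partial is \<phi> x) \<le> max C 0" for x
    using C[of x] by (cases "x \<in> K") auto
  then show ?thesis by blast
qed

lemma distribution_linear:
  "distribution T \<Longrightarrow> test_fun \<phi> \<Longrightarrow> test_fun \<psi> \<Longrightarrow> T (\<lambda>x. a * \<phi> x + b * \<psi> x) = a * T \<phi> + b * T \<psi>"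
  by (auto simp: distribution_def)

lemma distribution_cmult: "distribution T \<Longrightarrow> test_fun \<phi> \<Longrightarrow> T (\<lambda>x. a * \<phi> x) = a * T \<phi>"
  using distribution_linear[of T \<phi> \<phi> a 0] by simp

lemma distribution_zero: "distribution T \<Longrightarrow> T (\<lambda>x. 0) = 0"
  using distribution_cmult[of T "\<lambda>x. 0" 0] by simp

lemma distribution_add:
  "distribution T \<Longrightarrow> test_fun \<phi> \<Longrightarrow> test_fun \<psi> \<Longrightarrow> T (\<lambda>x. \<phi> x + \<psi> x) = T \<phi> + T \<psi>"
  using distribution_linear[of T \<phi> \<psi> 1 1] by simp

lemma distribution_diff:
  "distribution T \<Longrightarrow> test_fun \<phi> \<Longrightarrow> test_fun \<psi> \<Longrightarrow> T (\<lambda>x. \<phi> x - \<psi> x) = T \<phi> - T \<psi>"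
  using distribution_linear[of T \<phi> \<psi> 1 "-1"] by simp

lemma distribution_sum:
  assumes "distribution T"
  shows "finite A \<Longrightarrow> (\<And>a. a \<in> A \<Longrightarrow> test_fun (f a)) \<Longrightarrow> T (\<lambda>x. \<Sum>a\<in>A. f a x) = (\<Sum>a\<in>A. T (f a))"
  by (induction A rule: finite_induct) (auto simp: distribution_zero[OF assms] distribution_add[OF assms] test_fun_sum)

lemma distribution_null: "distribution T \<Longrightarrow> test_null \<phi> \<Longrightarrow> (\<lambda>j. T (\<phi> j)) \<longlonglongrightarrow> 0"
  by (simp add: distribution_def)

lemma distribution_not_test: "distribution T \<Longrightarrow> \<not> test_fun \<phi> \<Longrightarrow> T \<phi> = 0"
  by (simp add: distribution_def)

lemma distributionI:
  assumes "\<And>\<phi>. \<not> test_fun \<phi> \<Longrightarrow> T \<phi> = 0"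
    and "\<And>\<phi> \<psi> a b. test_fun \<phi> \<Longrightarrow> test_fun \<psi> \<Longrightarrow> T (\<lambda>x. a * \<phi> x + b * \<psi> x) = a * T \<phi> + b * T \<psi>"
    and "\<And>\<phi>. test_null \<phi> \<Longrightarrow> (\<lambda>j. T (\<phi> j)) \<longlonglongrightarrow> 0"
  shows "distribution T"
  using assms by (auto simp: distribution_def)

lemma test_nullI:
  assumes "compact K" "\<And>j. test_fun (\<phi> j)" "\<And>j x. x \<notin> K \<Longrightarrow> \<phi> j x = 0"
    and "\<And>is e. e > 0 \<Longrightarrow> \<forall>\<^sub>F j in sequentially. \<forall>x. norm (iter_partial is (\<phi> j) x) < e"
  shows "test_null \<phi>"
  using assms unfolding test_null_def by blast

lemma test_null_test_fun: "test_null \<phi> \<Longrightarrow> test_fun (\<phi> j)"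
  by (auto simp: test_null_def)

text \<open>By the Weierstrass test for every derivative, the partial sums minus the full sum form a
  null sequence; hence a distribution may be applied term by term.\<close>

lemma test_series:
  fixes f :: "nat \<Rightarrow> real^'n::finite \<Rightarrow> complex"
  assumes K: "compact K" and f: "\<And>n. test_fun (f n)" and fK: "\<And>n x. x \<notin> K \<Longrightarrow> f n x = 0"
    and bd: "\<And>is. \<exists>M. summable M \<and> (\<forall>n x. norm (iter_partial is (f n) x) \<le> M n)"
  shows "test_fun (\<lambda>x. \<Sum>n. f n x)"
    and "distribution T \<Longrightarrow> (\<lambda>n. T (f n)) sums T (\<lambda>x. \<Sum>n. f n x)"
proof -
  let ?S = "\<lambda>x. \<Sum>n. f n x"
  have bd': "\<exists>M. summable M \<and> (\<forall>n x. norm x \<le> R \<longrightarrow> norm (iter_partial is (f n) x) \<le> M n)" for "is" R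
    using bd[of "is"] by blast
  note ser = smooth_series[OF test_fun_smooth[OF f] bd']
  show t: "test_fun ?S" unfolding test_fun_iff
    by (intro conjI exI[of _ K] ser K subsetI) (metis (mono_tags, lifting) fK mem_Collect_eq suminf_zero sums_0 suminf_cong)
  assume T: "distribution T"
  let ?p = "\<lambda>N x. \<Sum>n<N. f n x"
  have tp: "test_fun (?p N)" for N by (intro test_fun_sum f)
  have "test_null (\<lambda>N x. ?p N x - ?S x)"
  proof (rule test_nullI[OF K])
    show "test_fun (\<lambda>x. ?p N x - ?S x)" for N by (intro test_fun_diff tp t)
    show "?p N x - ?S x = 0" if "x \<notin> K" for N x using fK[OF that] by simp
    fix "is" :: "'n list" and e :: real assume e: "e > 0"
    obtain M where M: "summable M" "\<And>n x. norm (iter_partial is (f n) x) \<le> M n" using bd by blast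
    have "uniform_limit UNIV (\<lambda>N x. \<Sum>n<N. iter_partial is (f n) x) (\<lambda>x. \<Sum>n. iter_partial is (f n) x) sequentially"
      by (rule Weierstrass_m_test[OF _ M(1)]) (use M in auto)
    from uniform_limitD[OF this e]
    show "\<forall>\<^sub>F N in sequentially. \<forall>x. norm (iter_partial is (\<lambda>x. ?p N x - ?S x) x) < e"
      by (subst iter_partial_diff)
        (auto simp: dist_norm iter_partial_sum ser(2) test_fun_smooth[OF f] intro!: smooth_sum ser(1) test_fun_smooth[OF f])
  qed
  from distribution_null[OF T this] have "(\<lambda>N. T (?p N) - T ?S) \<longlonglongrightarrow> 0"
    by (simp add: distribution_diff[OF T tp t])
  then have "(\<lambda>N. T (?p N)) \<longlonglongrightarrow> T ?S" by (rule LIM_zero_cancel)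
  then show "(\<lambda>n. T (f n)) sums T ?S"
    unfolding sums_def by (subst (asm) distribution_sum[OF T]) (auto intro: f)
qed

subsection \<open>Uniform boundedness for sequences of distributions\<close>

lemma LIMSEQ_zero_not_frequently:
  fixes X :: "nat \<Rightarrow> 'a::real_normed_vector"
  assumes "\<not> X \<longlonglongrightarrow> 0"
  shows "\<exists>e>0. \<exists>\<^sub>F j in sequentially. norm (X j) \<ge> e"
  using assms unfolding tendsto_iff frequently_def by (auto simp: not_le)

text \<open>One term is isolated: the earlier ones are kept as an explicit error, the later ones
  contribute at most 1 by comparison with a geometric series. In the gliding hump this turns a large
  k-th term into a large value on the whole sum.\<close>

lemma norm_term_le_suminf:
  fixes u :: "nat \<Rightarrow> complex"
  assumes u: "u sums s" and small: "\<And>l. l > k \<Longrightarrow> norm (u l) \<le> (1/2) ^ l"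
  shows "norm (u k) \<le> norm s + (\<Sum>l<k. norm (u l)) + 1"
proof -
  let ?t = "\<lambda>l. u (l + Suc k)"
  have g: "(\<lambda>l. (1/2::real) ^ (l + 1)) sums 1"
    using sums_mult[OF geometric_sums[of "1/2::real"], of "1/2"] by simp
  have le: "norm (?t l) \<le> (1/2) ^ (l + 1)" for l
  proof -
    have "norm (?t l) \<le> (1/2::real) ^ (l + Suc k)" by (rule small) simp
    also have "\<dots> \<le> (1/2) ^ (l + 1)" by (rule power_decreasing) auto
    finally show ?thesis .
  qed
  have sn: "summable (\<lambda>l. norm (?t l))"
    by (rule summable_comparison_test'[OF sums_summable[OF g], of 0]) (use le in simp)
  have "s = (\<Sum>l. ?t l) + (\<Sum>l<Suc k. u l)"
    using suminf_split_initial_segment[OF sums_summable[OF u], of "Suc k"] sums_unique[OF u] by simp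
  then have "u k = s - (\<Sum>l. ?t l) - (\<Sum>l<k. u l)" by simp
  also have "norm \<dots> \<le> norm (s - (\<Sum>l. ?t l)) + norm (\<Sum>l<k. u l)" by (rule norm_triangle_ineq4)
  also have "norm (s - (\<Sum>l. ?t l)) \<le> norm s + norm (\<Sum>l. ?t l)" by (rule norm_triangle_ineq4)
  also have "norm (\<Sum>l<k. u l) \<le> (\<Sum>l<k. norm (u l))" by (rule norm_sum)
  also have "norm (\<Sum>l. ?t l) \<le> 1"
    using summable_norm[OF sn] suminf_le[OF le sn sums_summable[OF g]] sums_unique[OF g] by simp
  finally show ?thesis by simp
qed

text \<open>Banach--Steinhaus by a gliding hump: if the conclusion failed, a suitably sparse and
  rescaled subsequence of \<open>\<phi>\<close> would sum to a test function on which the distributions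
  are unbounded.\<close>

theorem distribution_uniform_boundedness:
  fixes L :: "nat \<Rightarrow> (real^'n::finite \<Rightarrow> complex) \<Rightarrow> complex"
  assumes L: "\<And>j. distribution (L j)"
    and bd: "\<And>\<phi>. test_fun \<phi> \<Longrightarrow> \<exists>C. \<forall>j. norm (L j \<phi>) \<le> C"
    and null: "test_null \<phi>"
  shows "(\<lambda>j. L j (\<phi> j)) \<longlonglongrightarrow> 0"
proof (rule ccontr)
  assume "\<not> ?thesis"
  then obtain e where e: "e > 0" and freq: "\<exists>\<^sub>F j in sequentially. norm (L j (\<phi> j)) \<ge> e"
    using LIMSEQ_zero_not_frequently by blast
  have t\<phi>: "test_fun (\<phi> j)" for j using null by (rule test_null_test_fun)
  obtain K where K: "compact K" "\<And>j x. x \<notin> K \<Longrightarrow> \<phi> j x = 0"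
    using null unfolding test_null_def by blast
  have dn: "e > 0 \<Longrightarrow> \<forall>\<^sub>F j in sequentially. \<forall>x. norm (iter_partial is (\<phi> j) x) < e" for "is" e
    using null unfolding test_null_def by blast
  obtain B where B: "\<And>\<phi> j. test_fun \<phi> \<Longrightarrow> norm (L j \<phi>) \<le> B \<phi>" using bd by metis
  define hump :: "real \<times> nat \<Rightarrow> real^'n \<Rightarrow> complex" where "hump = (\<lambda>p x. complex_of_real (fst p) * \<phi> (snd p) x)"
  have th: "test_fun (hump p)" for p unfolding hump_def by (intro test_fun_cmult t\<phi>)
  \<comment> \<open>The pair p is the k-th hump: a factor and an index. The functional with that
    index must be at least k plus all that earlier humps can contribute, the derivatives of the hump
    up to order k must be at most 2^-k, and the functionals of earlier humps must barely see
    it.\<close>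
  define P where "P = (\<lambda>f k p. fst p > 0 \<and> fst p * e \<ge> real k + (\<Sum>l<k. B (hump (f l))) \<and>
      norm (L (snd p) (\<phi> (snd p))) \<ge> e \<and>
      (\<forall>is. length is \<le> k \<longrightarrow> (\<forall>x. fst p * norm (iter_partial is (\<phi> (snd p)) x) \<le> (1/2) ^ k)) \<and>
      (\<forall>l<k. fst p * norm (L (snd (f l)) (\<phi> (snd p))) \<le> (1/2) ^ k))"
  have "\<exists>f. \<forall>k. P f k (f k)"
  \<comment> \<open>\<open>P f k\<close> depends on \<open>f\<close> only below k, so the humps can
    be chosen by recursion.\<close>
  proof (rule dependent_wf_choice[of less_than])
    show "wf less_than" by simp
    show "P f k p = P g k p" if "\<And>z. (z, k) \<in> less_than \<Longrightarrow> f z = g z" for f g k p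
    proof -
      have "f l = g l" if "l < k" for l using \<open>\<And>z. (z, k) \<in> less_than \<Longrightarrow> f z = g z\<close>[of l] that by simp
      then show ?thesis unfolding P_def by simp
    qed
    fix k and f :: "nat \<Rightarrow> real \<times> nat"
    \<comment> \<open>The factor is fixed before the index: infinitely many j satisfy the lower
      bound by e, and among them one lies far enough out for all the upper bounds.\<close>
    define c where "c = max 1 ((real k + (\<Sum>l<k. B (hump (f l)))) / e)"
    have c: "c > 0" "c * e \<ge> real k + (\<Sum>l<k. B (hump (f l)))"
      using e by (auto simp: c_def field_simps max_def)
    define \<delta> where "\<delta> = (1/2) ^ k / c"
    have \<delta>: "\<delta> > 0" using c by (simp add: \<delta>_def)
    have fin: "finite {is :: 'n list. length is \<le> k}"
      using finite_lists_length_le[of "UNIV :: 'n set" k] by simp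
    have "\<forall>\<^sub>F j in sequentially. \<forall>is\<in>{is. length is \<le> k}. \<forall>x. norm (iter_partial is (\<phi> j) x) < \<delta>"
      using fin by (intro eventually_ball_finite) (use dn \<delta> in auto)
    moreover have "\<forall>\<^sub>F j in sequentially. \<forall>l\<in>{..<k}. norm (L (snd (f l)) (\<phi> j)) < \<delta>"
      using distribution_null[OF L null] \<delta>
      by (intro eventually_ball_finite) (auto simp: tendsto_iff)
    ultimately have "\<exists>\<^sub>F j in sequentially. norm (L j (\<phi> j)) \<ge> e \<and>
        (\<forall>is\<in>{is. length is \<le> k}. \<forall>x. norm (iter_partial is (\<phi> j) x) < \<delta>) \<and>
        (\<forall>l\<in>{..<k}. norm (L (snd (f l)) (\<phi> j)) < \<delta>)"
      by (intro frequently_eventually_frequently[OF freq] eventually_conj)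
    then obtain j where j: "norm (L j (\<phi> j)) \<ge> e"
        "\<And>is x. length is \<le> k \<Longrightarrow> norm (iter_partial is (\<phi> j) x) < \<delta>"
        "\<And>l. l < k \<Longrightarrow> norm (L (snd (f l)) (\<phi> j)) < \<delta>"
      using frequently_ex by fastforce
    have "c * a \<le> (1/2) ^ k" if "a < \<delta>" for a
      using that c unfolding \<delta>_def by (simp add: field_simps)
    then show "\<exists>p. P f k p"
      unfolding P_def using c j by (intro exI[of _ "(c, j)"]) auto
  qed
  then obtain f where f: "\<And>k. P f k (f k)" by blast
  define h where "h = (\<lambda>k. hump (f k))"
  have tht: "test_fun (h k)" for k unfolding h_def by (rule th)
  have cpos: "fst (f k) > 0" for k using f[of k] by (simp add: P_def)
  have ih: "norm (iter_partial is (h k) x) = fst (f k) * norm (iter_partial is (\<phi> (snd (f k))) x)" for "is" k x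
    using cpos[of k] unfolding h_def hump_def
    by (simp add: iter_partial_cmult test_fun_smooth[OF t\<phi>] norm_mult)
  have Lh: "norm (L j (h k)) = fst (f k) * norm (L j (\<phi> (snd (f k))))" for j k
    using cpos[of k] unfolding h_def hump_def by (simp add: distribution_cmult[OF L t\<phi>] norm_mult)
  have bdh: "\<exists>M. summable M \<and> (\<forall>n x. norm (iter_partial is (h n) x) \<le> M n)" for "is"
  proof -
    obtain C where C: "\<And>n x. norm (iter_partial is (h n) x) \<le> C n"
      using test_fun_bounded[OF tht] by metis
    \<comment> \<open>The geometric bound on this derivative holds only from the index
      \<open>length is\<close> on; the finitely many earlier terms keep their individual
      bounds.\<close>
    define M where "M = (\<lambda>n. if n < length is then C n else (1/2::real) ^ n)"
    have "summable M \<longleftrightarrow> summable (\<lambda>n. (1/2::real) ^ n)"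
      by (intro summable_cong eventually_sequentiallyI[of "length is"]) (auto simp: M_def)
    moreover have "norm (iter_partial is (h n) x) \<le> M n" for n x
      using C f[of n] unfolding ih by (auto simp: M_def P_def)
    ultimately show ?thesis using summable_geometric[of "1/2::real"] by auto
  qed
  have hK: "\<And>n x. x \<notin> K \<Longrightarrow> h n x = 0" using K(2) by (simp add: h_def hump_def)
  define \<psi> where "\<psi> = (\<lambda>x. \<Sum>n. h n x)"
  have t\<psi>: "test_fun \<psi>" unfolding \<psi>_def by (rule test_series(1)[OF K(1) tht _ bdh]) (rule hK)
  have "real k \<le> B \<psi> + 1" for k
  proof -
    define r where "r = snd (f k)"
    have s: "(\<lambda>n. L r (h n)) sums L r \<psi>"
      unfolding \<psi>_def by (rule test_series(2)[OF K(1) tht _ bdh L]) (rule hK)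
    have small: "norm (L r (h l)) \<le> (1/2) ^ l" if "l > k" for l
      using f[of l] that unfolding Lh r_def by (simp add: P_def)
    have "real k + (\<Sum>l<k. B (h l)) \<le> fst (f k) * e" using f[of k] by (simp add: P_def h_def)
    also have "\<dots> \<le> norm (L r (h k))"
      unfolding Lh r_def using f[of k] cpos[of k] by (intro mult_left_mono) (auto simp: P_def)
    also have "\<dots> \<le> norm (L r \<psi>) + (\<Sum>l<k. norm (L r (h l))) + 1"
      by (rule norm_term_le_suminf[OF s small])
    also have "\<dots> \<le> B \<psi> + (\<Sum>l<k. B (h l)) + 1"
      by (intro add_mono sum_mono B t\<psi> tht order_refl)
    finally show ?thesis by simp
  qed
  then show False using reals_Archimedean2[of "B \<psi> + 1"] by (meson not_le)
qed

section \<open>Bounded sets of test functions and pointwise limits of distributions\<close>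

definition bounded_tests :: "(real^'n::finite \<Rightarrow> complex) set \<Rightarrow> bool" where
  "bounded_tests B \<longleftrightarrow> (\<exists>K. compact K \<and> (\<forall>\<theta>\<in>B. test_fun \<theta> \<and> {x. \<theta> x \<noteq> 0} \<subseteq> K)) \<and>
     (\<forall>is. \<exists>C. \<forall>\<theta>\<in>B. \<forall>x. norm (iter_partial is \<theta> x) \<le> C)"

lemma bounded_tests_scaled_null:
  assumes B: "bounded_tests B" and \<theta>: "\<And>j. \<theta> j \<in> B"
  shows "test_null (\<lambda>j x. complex_of_real (1 / real (Suc j)) * \<theta> j x)"
proof -
  obtain K where K: "compact K" "\<And>j. test_fun (\<theta> j)" "\<And>j. {x. \<theta> j x \<noteq> 0} \<subseteq> K"
    using B \<theta> unfolding bounded_tests_def by blast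
  show ?thesis
  proof (rule test_nullI[OF K(1)])
    show "test_fun (\<lambda>x. complex_of_real (1 / real (Suc j)) * \<theta> j x)" for j
      by (intro test_fun_cmult K)
    show "complex_of_real (1 / real (Suc j)) * \<theta> j x = 0" if "x \<notin> K" for j x
      using K(3)[of j] that by auto
    fix "is" :: "'a list" and e :: real assume e: "e > 0"
    obtain C where "\<And>\<theta> x. \<theta> \<in> B \<Longrightarrow> norm (iter_partial is \<theta> x) \<le> C"
      using B unfolding bounded_tests_def by meson
    then have C: "norm (iter_partial is (\<theta> j) x) \<le> \<bar>C\<bar>" for j x
      by (rule order_trans[OF _ abs_ge_self]) (use \<theta> in blast)
    have "(\<lambda>j. \<bar>C\<bar> * inverse (real (Suc j))) \<longlonglongrightarrow> \<bar>C\<bar> * 0"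
      by (intro tendsto_mult_left LIMSEQ_inverse_real_of_nat)
    then have "\<forall>\<^sub>F j in sequentially. \<bar>C\<bar> * inverse (real (Suc j)) < e"
      using e by (intro order_tendstoD(2)) auto
    then show "\<forall>\<^sub>F j in sequentially. \<forall>x. norm (iter_partial is (\<lambda>x. complex_of_real (1 / real (Suc j)) * \<theta> j x) x) < e"
    proof eventually_elim
      case (elim j)
      have "norm (iter_partial is (\<lambda>x. complex_of_real (1 / real (Suc j)) * \<theta> j x) x) \<le> \<bar>C\<bar> * inverse (real (Suc j))" for x
      proof -
        have "norm (iter_partial is (\<lambda>x. complex_of_real (1 / real (Suc j)) * \<theta> j x) x)
            = norm (iter_partial is (\<theta> j) x) * inverse (real (Suc j))"
          by (subst iter_partial_cmult[OF test_fun_smooth[OF K(2)]])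
            (simp add: norm_mult norm_inverse divide_inverse del: of_nat_Suc)
        also have "\<dots> \<le> \<bar>C\<bar> * inverse (real (Suc j))" using C by (intro mult_right_mono) auto
        finally show ?thesis .
      qed
      with elim show ?case using order.strict_trans1 by blast
    qed
  qed
qed

text \<open>Otherwise functionals and tests exist with values above j + 1 in norm. Dividing the
  tests by j + 1 gives a null sequence on which these functionals stay above 1, against uniform
  boundedness.\<close>

lemma distributions_bounded_on_bounded_tests:
  fixes L :: "'s \<Rightarrow> (real^'n::finite \<Rightarrow> complex) \<Rightarrow> complex"
  assumes L: "\<And>s. s \<in> I \<Longrightarrow> distribution (L s)"
    and bd: "\<And>\<phi>. test_fun \<phi> \<Longrightarrow> \<exists>C. \<forall>s\<in>I. norm (L s \<phi>) \<le> C"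
    and B: "bounded_tests B"
  shows "\<exists>C. \<forall>s\<in>I. \<forall>\<theta>\<in>B. norm (L s \<theta>) \<le> C"
proof (rule ccontr)
  assume "\<not> ?thesis"
  then have "\<forall>j. \<exists>s \<theta>. s \<in> I \<and> \<theta> \<in> B \<and> norm (L s \<theta>) > real (Suc j)" by (meson not_le)
  then obtain s \<theta> where s: "\<And>j. s j \<in> I" and \<theta>: "\<And>j. \<theta> j \<in> B"
    and big: "\<And>j. norm (L (s j) (\<theta> j)) > real (Suc j)" by metis
  have t: "test_fun (\<theta> j)" for j using B \<theta> unfolding bounded_tests_def by blast
  have "(\<lambda>j. L (s j) (\<lambda>x. complex_of_real (1 / real (Suc j)) * \<theta> j x)) \<longlonglongrightarrow> 0"
    using L[OF s] bd s by (intro distribution_uniform_boundedness bounded_tests_scaled_null[OF B \<theta>]) blast+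
  then have "\<forall>\<^sub>F j in sequentially. norm (L (s j) (\<lambda>x. complex_of_real (1 / real (Suc j)) * \<theta> j x)) < 1"
    by (auto simp: tendsto_iff)
  then obtain j where "norm (L (s j) (\<lambda>x. complex_of_real (1 / real (Suc j)) * \<theta> j x)) < 1"
    using eventually_happens trivial_limit_sequentially by blast
  then have "norm (L (s j) (\<theta> j)) < real (Suc j)"
    by (subst (asm) distribution_cmult[OF L[OF s] t]) (simp add: norm_mult norm_divide field_simps del: of_nat_Suc)
  then show False using big[of j] by simp
qed

text \<open>A diagonal choice replaces \<Lambda> on the j-th term of a null sequence by some
  \<open>L (m j)\<close> with error below 1/(j+1). Convergent sequences are bounded, so uniform
  boundedness applies to the \<open>L (m j)\<close>.\<close>

lemma distribution_limit:
  assumes L: "\<And>n. distribution (L n)"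
    and lim: "\<And>\<phi>. test_fun \<phi> \<Longrightarrow> (\<lambda>n. L n \<phi>) \<longlonglongrightarrow> \<Lambda> \<phi>"
    and nt: "\<And>\<phi>. \<not> test_fun \<phi> \<Longrightarrow> \<Lambda> \<phi> = 0"
  shows "distribution \<Lambda>"
proof (rule distributionI)
  fix \<phi> \<psi> :: "(real,'a) vec \<Rightarrow> complex" and a b assume t: "test_fun \<phi>" "test_fun \<psi>"
  have "(\<lambda>n. L n (\<lambda>x. a * \<phi> x + b * \<psi> x)) \<longlonglongrightarrow> a * \<Lambda> \<phi> + b * \<Lambda> \<psi>"
    by (subst distribution_linear[OF L t]) (intro tendsto_intros lim t)
  with lim[OF test_fun_linear[OF t]] show "\<Lambda> (\<lambda>x. a * \<phi> x + b * \<psi> x) = a * \<Lambda> \<phi> + b * \<Lambda> \<psi>"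
    by (rule LIMSEQ_unique)
next
  fix \<phi> :: "nat \<Rightarrow> (real,'a) vec \<Rightarrow> complex" assume n: "test_null \<phi>"
  have "\<exists>n. norm (L n (\<phi> j) - \<Lambda> (\<phi> j)) < inverse (real (Suc j))" for j
  proof -
    have "\<forall>\<^sub>F n in sequentially. dist (L n (\<phi> j)) (\<Lambda> (\<phi> j)) < inverse (real (Suc j))"
      by (rule tendstoD[OF lim[OF test_null_test_fun[OF n]]]) simp
    then show ?thesis unfolding dist_norm
      using eventually_happens trivial_limit_sequentially by blast
  qed
  then obtain m where m: "\<And>j. norm (L (m j) (\<phi> j) - \<Lambda> (\<phi> j)) < inverse (real (Suc j))" by metis
  have "(\<lambda>j. L (m j) (\<phi> j)) \<longlonglongrightarrow> 0"
  proof (rule distribution_uniform_boundedness[OF L _ n])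
    fix \<psi> :: "(real,'a) vec \<Rightarrow> complex" assume "test_fun \<psi>"
    then have "bounded (range (\<lambda>n. L n \<psi>))" using lim convergent_imp_bounded by blast
    then show "\<exists>C. \<forall>j. norm (L (m j) \<psi>) \<le> C" unfolding bounded_iff by blast
  qed
  moreover have "(\<lambda>j. L (m j) (\<phi> j) - \<Lambda> (\<phi> j)) \<longlonglongrightarrow> 0"
    by (rule Lim_null_comparison[OF always_eventually LIMSEQ_inverse_real_of_nat]) (use m less_imp_le in blast)
  ultimately show "(\<lambda>j. \<Lambda> (\<phi> j)) \<longlonglongrightarrow> 0" using tendsto_diff by fastforce
qed (rule nt)

subsection \<open>Dilations\<close>

definition cinv :: "real^'n::finite \<Rightarrow> real^'n" where
  "cinv b = (\<chi> i. 1 / b $ i)"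

lemma cmul_nth [simp]: "cmul x y $ i = x $ i * y $ i"
  by (simp add: cmul_def)

lemma cinv_nth [simp]: "cinv x $ i = 1 / x $ i"
  by (simp add: cinv_def)

lemma cmul_cinv:
  assumes "b \<in> nonzero_coords"
  shows "cmul (cmul x b) (cinv b) = x" "cmul (cmul x (cinv b)) b = x"
  using assms by (auto simp: nonzero_coords_def vec_eq_iff)

lemma cinv_nonzero_coords: "b \<in> nonzero_coords \<Longrightarrow> cinv b \<in> nonzero_coords"
  by (auto simp: nonzero_coords_def)

lemma bounded_linear_cmul: "bounded_linear (\<lambda>x. cmul x b)"
  by (intro linear_conv_bounded_linear[THEN iffD1] linearI) (auto simp: vec_eq_iff algebra_simps)

lemma smooth_cmul: "smooth f \<Longrightarrow> smooth (\<lambda>x. f (cmul x b))"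
  by (rule smooth_compose) (auto simp: mult.commute intro!: smooth_mult)

lemma partial_cmul:
  assumes "smooth f" shows "partial i (\<lambda>x. f (cmul x b)) = (\<lambda>x. complex_of_real (b $ i) * partial i f (cmul x b))"
proof
  fix x
  have "((\<lambda>x. f (cmul x b)) has_derivative (\<lambda>h. \<Sum>j\<in>UNIV. (cmul h b $ j) *\<^sub>R partial j f (cmul x b))) (at x)"
    by (rule has_derivative_compose[of "\<lambda>x. cmul x b" "\<lambda>h. cmul h b" x UNIV f "\<lambda>h. \<Sum>j\<in>UNIV. (h $ j) *\<^sub>R partial j f (cmul x b)"])
      (intro bounded_linear_imp_has_derivative bounded_linear_cmul smooth_has_derivative assms)+
  from partial_eq[OF this, of i] show "partial i (\<lambda>x. f (cmul x b)) x = complex_of_real (b $ i) * partial i f (cmul x b)"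
    by (simp add: axis_def if_distrib[of "\<lambda>c. c * _"] if_distrib[of complex_of_real] scaleR_conv_of_real cong: if_cong)
qed

lemma iter_partial_cmul:
  assumes "smooth f"
  shows "iter_partial is (\<lambda>x. f (cmul x b)) = (\<lambda>x. complex_of_real (\<Prod>i\<leftarrow>is. b $ i) * iter_partial is f (cmul x b))"
proof (induction "is")
  case (Cons i "is")
  have s: "smooth (\<lambda>x. iter_partial is f (cmul x b))" using assms by (intro smooth_cmul smooth_iter_partial)
  have c: "partial i (\<lambda>x. a * iter_partial is f (cmul x b)) = (\<lambda>x. a * partial i (\<lambda>x. iter_partial is f (cmul x b)) x)" for a
    using iter_partial_cmult[OF s, of "[i]" a] by (simp add: iter_partial_Cons)
  show ?case unfolding iter_partial_Cons Cons c partial_cmul[OF smooth_iter_partial[OF assms], of i "is" b]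
    by (simp add: mult_ac)
qed simp

lemma compact_cmul: "compact K \<Longrightarrow> compact ((\<lambda>x. cmul x b) ` K)"
  by (intro compact_continuous_image linear_continuous_on bounded_linear_cmul)

lemma test_fun_cmul:
  assumes "test_fun \<phi>" "b \<in> nonzero_coords" shows "test_fun (\<lambda>x. \<phi> (cmul x b))"
proof -
  obtain K where K: "compact K" "{x. \<phi> x \<noteq> 0} \<subseteq> K" using assms unfolding test_fun_iff by blast
  have "{x. \<phi> (cmul x b) \<noteq> 0} \<subseteq> (\<lambda>x. cmul x (cinv b)) ` K"
    using K(2) cmul_cinv[OF assms(2)] by (force intro!: image_eqI[of _ _ "cmul _ b"])
  then show ?thesis unfolding test_fun_iff
    by (intro conjI exI[of _ "(\<lambda>x. cmul x (cinv b)) ` K"] compact_cmul K smooth_cmul test_fun_smooth assms)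
qed

lemma test_fun_cmul_iff:
  assumes "b \<in> nonzero_coords" shows "test_fun (\<lambda>x. \<phi> (cmul x b)) \<longleftrightarrow> test_fun \<phi>"
  using test_fun_cmul[OF _ assms, of \<phi>] test_fun_cmul[OF _ cinv_nonzero_coords[OF assms], of "\<lambda>x. \<phi> (cmul x b)"]
  by (auto simp: cmul_cinv[OF assms])

lemma test_null_cmul:
  assumes "test_null \<phi>" and b: "b \<in> nonzero_coords" shows "test_null (\<lambda>j x. \<phi> j (cmul x b))"
proof -
  obtain K where K: "compact K" "\<And>j. {x. \<phi> j x \<noteq> 0} \<subseteq> K"
    and dn: "\<And>is e. e > 0 \<Longrightarrow> \<forall>\<^sub>F j in sequentially. \<forall>x. norm (iter_partial is (\<phi> j) x) < e"
    and t: "\<And>j. test_fun (\<phi> j)"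
    using assms(1) unfolding test_null_def by blast
  show ?thesis
  proof (rule test_nullI[OF compact_cmul[OF K(1), of "cinv b"]])
    show "test_fun (\<lambda>x. \<phi> j (cmul x b))" for j by (intro test_fun_cmul t b)
    show "\<phi> j (cmul x b) = 0" if "x \<notin> (\<lambda>x. cmul x (cinv b)) ` K" for j x
    proof (rule ccontr)
      assume "\<phi> j (cmul x b) \<noteq> 0"
      then have "cmul x b \<in> K" using K(2) by blast
      then have "cmul (cmul x b) (cinv b) \<in> (\<lambda>x. cmul x (cinv b)) ` K" by blast
      with that show False by (simp add: cmul_cinv[OF b])
    qed
    fix "is" :: "'a list" and e :: real assume e: "e > 0"
    define c where "c = \<bar>\<Prod>i\<leftarrow>is. b $ i\<bar> + 1"
    have c: "c > 0" by (simp add: c_def)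
    have "\<forall>\<^sub>F j in sequentially. \<forall>x. norm (iter_partial is (\<phi> j) x) < e / c"
      using e c by (intro dn) simp
    then show "\<forall>\<^sub>F j in sequentially. \<forall>x. norm (iter_partial is (\<lambda>x. \<phi> j (cmul x b)) x) < e"
    proof eventually_elim
      case (elim j)
      show ?case
      proof
        fix x
        have "norm (iter_partial is (\<lambda>x. \<phi> j (cmul x b)) x) = \<bar>\<Prod>i\<leftarrow>is. b $ i\<bar> * norm (iter_partial is (\<phi> j) (cmul x b))"
          by (subst iter_partial_cmul[OF test_fun_smooth[OF t]]) (simp add: norm_mult)
        also have "\<dots> \<le> c * norm (iter_partial is (\<phi> j) (cmul x b))"
          by (intro mult_right_mono) (auto simp: c_def)
        also have "\<dots> < c * (e / c)" using elim c by (intro mult_strict_left_mono) auto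
        finally show "norm (iter_partial is (\<lambda>x. \<phi> j (cmul x b)) x) < e" using c by simp
      qed
    qed
  qed
qed

lemma distribution_dilation:
  assumes T: "distribution T" and b: "b \<in> nonzero_coords"
  shows "distribution (\<lambda>\<phi>. T (\<lambda>x. \<phi> (cmul x b)))"
proof (rule distributionI)
  show "T (\<lambda>x. \<phi> (cmul x b)) = 0" if "\<not> test_fun \<phi>" for \<phi>
    using that by (intro distribution_not_test[OF T]) (simp add: test_fun_cmul_iff[OF b])
  show "T (\<lambda>x. a * \<phi> (cmul x b) + c * \<psi> (cmul x b)) = a * T (\<lambda>x. \<phi> (cmul x b)) + c * T (\<lambda>x. \<psi> (cmul x b))"
    if "test_fun \<phi>" "test_fun \<psi>" for \<phi> \<psi> a c
    using that b by (intro distribution_linear[OF T] test_fun_cmul)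
  show "(\<lambda>j. T (\<lambda>x. \<phi> j (cmul x b))) \<longlonglongrightarrow> 0" if "test_null \<phi>" for \<phi>
    using that b by (intro distribution_null[OF T] test_null_cmul)
qed

lemma distribution_lincomb:
  assumes S: "distribution S" and S': "distribution S'"
  shows "distribution (\<lambda>\<phi>. a * S \<phi> + b * S' \<phi>)"
proof (rule distributionI)
  show "a * S \<phi> + b * S' \<phi> = 0" if "\<not> test_fun \<phi>" for \<phi>
    using that S S' by (simp add: distribution_not_test)
  show "a * S (\<lambda>x. c * \<phi> x + d * \<psi> x) + b * S' (\<lambda>x. c * \<phi> x + d * \<psi> x)
      = c * (a * S \<phi> + b * S' \<phi>) + d * (a * S \<psi> + b * S' \<psi>)" if "test_fun \<phi>" "test_fun \<psi>" for \<phi> \<psi> c d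
    using that by (simp add: distribution_linear[OF S] distribution_linear[OF S'] algebra_simps)
  show "(\<lambda>j. a * S (\<phi> j) + b * S' (\<phi> j)) \<longlonglongrightarrow> 0" if "test_null \<phi>" for \<phi>
  proof -
    have "(\<lambda>j. a * S (\<phi> j) + b * S' (\<phi> j)) \<longlonglongrightarrow> a * 0 + b * 0"
      by (intro tendsto_intros distribution_null[OF S that] distribution_null[OF S' that])
    then show ?thesis by simp
  qed
qed

lemma nonzero_coords_approx:
  fixes y :: "real^'n::finite"
  obtains s where "\<And>n. s n \<in> nonzero_coords" "s \<longlonglongrightarrow> y"
proof
  let ?s = "\<lambda>n. (\<chi> i. if y $ i = 0 then inverse (real (Suc n)) else y $ i) :: real^'n"
  show "?s n \<in> nonzero_coords" for n by (simp add: nonzero_coords_def del: of_nat_Suc)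
  have "(\<lambda>n. if y $ i = 0 then inverse (real (Suc n)) else y $ i) \<longlonglongrightarrow> y $ i" for i
    using LIMSEQ_inverse_real_of_nat by (cases "y $ i = 0") auto
  then show "?s \<longlonglongrightarrow> y" by (intro vec_tendstoI) simp
qed

text \<open>The difference quotient is written as a linear combination of two values, the form in
  which \<open>distribution_lincomb\<close> applies to evaluation functionals.\<close>

lemma partial_LIMSEQ:
  assumes "smooth f"
  shows "(\<lambda>n. complex_of_real (real (Suc n)) * f (x + inverse (real (Suc n)) *\<^sub>R axis i 1)
      + (- complex_of_real (real (Suc n))) * f x) \<longlonglongrightarrow> partial i f x"
proof -
  define D where "D = (\<lambda>h. \<Sum>i\<in>UNIV. (h $ i) *\<^sub>R partial i f x)"
  have D: "(f has_derivative D) (at x)" unfolding D_def by (rule smooth_has_derivative[OF assms])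
  have lim: "(\<lambda>h. norm (f (x + h) - f x - D h) / norm h) \<midarrow>0\<rightarrow> 0"
    using D unfolding has_derivative_at by blast
  let ?h = "\<lambda>n. inverse (real (Suc n)) *\<^sub>R (axis i 1 :: (real,'a) vec)"
  have "?h \<longlonglongrightarrow> 0 *\<^sub>R axis i 1" by (intro tendsto_scaleR LIMSEQ_inverse_real_of_nat tendsto_const)
  then have "filterlim ?h (at 0) sequentially"
    unfolding filterlim_at by (auto intro!: always_eventually simp del: of_nat_Suc simp: axis_eq_0_iff)
  from filterlim_compose[OF lim this]
  have l: "(\<lambda>n. norm (f (x + ?h n) - f x - D (?h n)) / norm (?h n)) \<longlonglongrightarrow> 0" .
  have "D (?h n) = inverse (real (Suc n)) *\<^sub>R partial i f x" for n
    using linear_cmul[OF has_derivative_linear[OF D]] partial_eq[OF D, of i] by simp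
  then have e: "norm (complex_of_real (real (Suc n)) * f (x + ?h n) + (- complex_of_real (real (Suc n))) * f x - partial i f x)
      = norm (f (x + ?h n) - f x - D (?h n)) / norm (?h n)" for n
  proof -
    assume *: "\<And>n. D (?h n) = inverse (real (Suc n)) *\<^sub>R partial i f x"
    have "complex_of_real (real (Suc n)) * f (x + ?h n) + (- complex_of_real (real (Suc n))) * f x - partial i f x
      = complex_of_real (real (Suc n)) * (f (x + ?h n) - f x - D (?h n))"
      unfolding * by (simp add: scaleR_conv_of_real field_simps del: of_nat_Suc)
    then show ?thesis by (simp add: norm_mult divide_inverse mult.commute del: of_nat_Suc)
  qed
  have "(\<lambda>n. complex_of_real (real (Suc n)) * f (x + ?h n) + (- complex_of_real (real (Suc n))) * f x - partial i f x) \<longlonglongrightarrow> 0"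
    by (rule tendsto_norm_zero_cancel) (subst e, rule l)
  then show ?thesis by (rule LIM_zero_cancel)
qed

subsection \<open>The operator \<open>M\<^sub>T\<close>\<close>

context
  fixes T :: "(real^'n::finite \<Rightarrow> complex) \<Rightarrow> complex"
  assumes T: "T \<in> DH"
begin

lemma DH_distribution: "distribution T"
  using T by (simp add: DH_def)

lemma M_op_spec:
  assumes "test_fun \<phi>"
  shows "test_fun (M_op T \<phi>) \<and> (\<forall>y\<in>nonzero_coords. T (\<lambda>\<xi>. \<phi> (cmul \<xi> y)) = M_op T \<phi> y)"
  using someI_ex[of "\<lambda>\<psi>. test_fun \<psi> \<and> (\<forall>y\<in>nonzero_coords. T (\<lambda>\<xi>. \<phi> (cmul \<xi> y)) = \<psi> y)"] T assms
  unfolding M_op_def DH_def by blast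

lemma test_fun_M_op: "test_fun \<phi> \<Longrightarrow> test_fun (M_op T \<phi>)"
  and M_op_nonzero_coords: "test_fun \<phi> \<Longrightarrow> y \<in> nonzero_coords \<Longrightarrow> M_op T \<phi> y = T (\<lambda>\<xi>. \<phi> (cmul \<xi> y))"
  using M_op_spec by auto

lemma M_op_LIMSEQ:
  assumes "test_fun \<phi>" "s \<longlonglongrightarrow> y"
  shows "(\<lambda>n. M_op T \<phi> (s n)) \<longlonglongrightarrow> M_op T \<phi> y"
  using smooth_continuous[OF test_fun_smooth[OF test_fun_M_op[OF assms(1)]], of UNIV] assms(2)
  by (auto simp: continuous_on_eq_continuous_at intro: isCont_tendsto_compose)

text \<open>Off the hyperplanes evaluation is a dilate of T, elsewhere a limit of such evaluations,
  and each derivative is a limit of difference quotients. The point y is kept general in the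
  induction because a difference quotient uses neighbouring points.\<close>

lemma distribution_M_op_deriv:
  "distribution (\<lambda>\<phi>. if test_fun \<phi> then iter_partial is (M_op T \<phi>) y else 0)"
proof (induction "is" arbitrary: y)
  case Nil
  obtain s where s: "\<And>n. s n \<in> nonzero_coords" "s \<longlonglongrightarrow> y" using nonzero_coords_approx[of y] by blast
  show ?case
  proof (rule distribution_limit)
    show "distribution (\<lambda>\<phi>. T (\<lambda>x. \<phi> (cmul x (s n))))" for n
      by (intro distribution_dilation DH_distribution s)
    show "(\<lambda>n. T (\<lambda>x. \<phi> (cmul x (s n)))) \<longlonglongrightarrow> (if test_fun \<phi> then iter_partial [] (M_op T \<phi>) y else 0)"
      if t: "test_fun \<phi>" for \<phi>
      using M_op_LIMSEQ[OF t s(2)] unfolding M_op_nonzero_coords[OF t s(1)] by (simp add: t)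
  qed auto
next
  case (Cons i "is")
  let ?h = "\<lambda>n. y + inverse (real (Suc n)) *\<^sub>R axis i 1"
  show ?case
  proof (rule distribution_limit)
    show "distribution (\<lambda>\<phi>. complex_of_real (real (Suc n)) * (if test_fun \<phi> then iter_partial is (M_op T \<phi>) (?h n) else 0)
        + (- complex_of_real (real (Suc n))) * (if test_fun \<phi> then iter_partial is (M_op T \<phi>) y else 0))" for n
      by (intro distribution_lincomb Cons)
    fix \<phi> :: "real^'n \<Rightarrow> complex" assume t: "test_fun \<phi>"
    show "(\<lambda>n. complex_of_real (real (Suc n)) * (if test_fun \<phi> then iter_partial is (M_op T \<phi>) (?h n) else 0)
        + (- complex_of_real (real (Suc n))) * (if test_fun \<phi> then iter_partial is (M_op T \<phi>) y else 0))
      \<longlonglongrightarrow> (if test_fun \<phi> then iter_partial (i # is) (M_op T \<phi>) y else 0)"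
      using t partial_LIMSEQ[OF smooth_iter_partial[OF test_fun_smooth[OF test_fun_M_op[OF t]]], of "is" y i]
      by (simp add: iter_partial_Cons del: of_nat_Suc)
  qed auto
qed

lemma distribution_M_op: "distribution (\<lambda>\<phi>. if test_fun \<phi> then M_op T \<phi> y else 0)"
  using distribution_M_op_deriv[of "[]" y] unfolding iter_partial_Nil .

text \<open>The choice that defines \<open>M_op\<close> says nothing about linearity, and T computes
  it directly only off the hyperplanes. Linearity is inherited from the evaluation distributions,
  which cover all points.\<close>

lemma M_op_linear:
  assumes "test_fun \<phi>" "test_fun \<psi>"
  shows "M_op T (\<lambda>x. a * \<phi> x + b * \<psi> x) = (\<lambda>y. a * M_op T \<phi> y + b * M_op T \<psi> y)"
  using distribution_linear[OF distribution_M_op assms] assms by (auto simp: test_fun_linear)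

text \<open>If no R worked, there would be tests supported in K whose images do not vanish at points
  \<open>y n\<close> going to infinity. Normalised, these tests form a bounded set. Evaluation at
  \<open>y n\<close>, scaled to give n on the n-th test, is eventually 0 on any fixed test function,
  whose image has compact support. This contradicts boundedness on bounded sets.\<close>

lemma M_op_compact_support:
  assumes K: "compact K"
  shows "\<exists>R. \<forall>\<theta> y. test_fun \<theta> \<longrightarrow> {x. \<theta> x \<noteq> 0} \<subseteq> K \<longrightarrow> norm y > R \<longrightarrow> M_op T \<theta> y = 0"
proof (rule ccontr)
  assume "\<not> ?thesis"
  then have "\<forall>n. \<exists>\<theta> y. test_fun \<theta> \<and> {x. \<theta> x \<noteq> 0} \<subseteq> K \<and> norm y > real n \<and> M_op T \<theta> y \<noteq> 0" by blast
  then obtain \<theta> y where \<theta>: "\<And>n. test_fun (\<theta> n)" "\<And>n. {x. \<theta> n x \<noteq> 0} \<subseteq> K"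
    and y: "\<And>n. norm (y n) > real n" "\<And>n. M_op T (\<theta> n) (y n) \<noteq> 0" by metis
  have "\<forall>n. \<exists>C. \<forall>is x. norm (iter_partial is (\<theta> n) x) \<le> C is"
    using test_fun_bounded[OF \<theta>(1)] by (intro allI choice)
  then obtain C where C: "\<And>n is x. norm (iter_partial is (\<theta> n) x) \<le> C n is" by metis
  \<comment> \<open>Scaling by \<open>a n\<close> brings all derivatives of order up to n below 1;
    for a fixed derivative only finitely many n are left over, and these are bounded one by
    one.\<close>
  define a where "a = (\<lambda>n. 1 / (1 + (\<Sum>is\<in>{is. length is \<le> n}. \<bar>C n is\<bar>)))"
  have a: "a n > 0" for n unfolding a_def by (simp add: add_pos_nonneg sum_nonneg)
  have fin: "finite {is :: 'n list. length is \<le> n}" for n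
    using finite_lists_length_le[of "UNIV :: 'n set" n] by simp
  have aC: "a n * norm (iter_partial is (\<theta> n) x) \<le> 1" if "length is \<le> n" for n x and "is" :: "'n list"
  proof -
    have "norm (iter_partial is (\<theta> n) x) \<le> \<bar>C n is\<bar>" using C by (rule order_trans) simp
    also have "\<dots> \<le> (\<Sum>is\<in>{is. length is \<le> n}. \<bar>C n is\<bar>)"
      by (rule member_le_sum) (use that fin in auto)
    finally show ?thesis
      unfolding a_def by (simp add: divide_le_eq_1 add_pos_nonneg sum_nonneg)
  qed
  define \<eta> where "\<eta> = (\<lambda>n x. complex_of_real (a n) * \<theta> n x)"
  have t\<eta>: "test_fun (\<eta> n)" for n unfolding \<eta>_def by (intro test_fun_cmult \<theta>)
  have n\<eta>: "norm (iter_partial is (\<eta> n) x) = a n * norm (iter_partial is (\<theta> n) x)" for "is" n x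
    using a[of n] unfolding \<eta>_def by (simp add: iter_partial_cmult test_fun_smooth \<theta> norm_mult)
  have B: "bounded_tests (range \<eta>)"
    unfolding bounded_tests_def
  proof (intro conjI exI[of _ K] allI K)
    show "\<forall>\<theta>\<in>range \<eta>. test_fun \<theta> \<and> {x. \<theta> x \<noteq> 0} \<subseteq> K"
      using \<theta>(2) t\<eta> by (auto simp: \<eta>_def)
    fix "is" :: "'n list"
    have "norm (iter_partial is (\<eta> n) x) \<le> 1 + (\<Sum>n<length is. a n * \<bar>C n is\<bar>)" for n x
    proof (cases "length is \<le> n")
      case True
      then have "norm (iter_partial is (\<eta> n) x) \<le> 1" using aC n\<eta> by simp
      then show ?thesis using a by (simp add: add_increasing2 sum_nonneg less_imp_le)
    next
      case False
      have "norm (iter_partial is (\<eta> n) x) \<le> a n * \<bar>C n is\<bar>"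
        unfolding n\<eta> using a[of n] C[of "is" n x] by (intro mult_left_mono) auto
      also have "\<dots> \<le> (\<Sum>n<length is. a n * \<bar>C n is\<bar>)"
        by (rule member_le_sum[of n "{..<length is}" "\<lambda>n. a n * \<bar>C n is\<bar>"]) (use False in \<open>auto simp: less_imp_le[OF a]\<close>)
      finally show ?thesis by simp
    qed
    then show "\<exists>C. \<forall>\<theta>\<in>range \<eta>. \<forall>x. norm (iter_partial is \<theta> x) \<le> C" by blast
  qed
  define c where "c = (\<lambda>n. of_nat n / M_op T (\<eta> n) (y n))"
  \<comment> \<open>The summand with coefficient 0 gives the scaled evaluation the shape of
    \<open>distribution_lincomb\<close>.\<close>
  define L where "L = (\<lambda>n \<phi>. c n * (if test_fun \<phi> then M_op T \<phi> (y n) else 0) + 0 * (if test_fun \<phi> then M_op T \<phi> (y n) else 0))"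
  have L: "distribution (L n)" for n unfolding L_def by (intro distribution_lincomb distribution_M_op)
  have "\<exists>C. \<forall>n\<in>UNIV. norm (L n \<phi>) \<le> C" if t: "test_fun \<phi>" for \<phi>
  proof -
    obtain K' where K': "compact K'" "{x. M_op T \<phi> x \<noteq> 0} \<subseteq> K'"
      using test_fun_M_op[OF t] unfolding test_fun_iff by blast
    then obtain r where r: "\<And>x. x \<in> K' \<Longrightarrow> norm x \<le> r" using compact_imp_bounded bounded_iff by metis
    obtain N where N: "real N > r" using reals_Archimedean2 by blast
    have "L n \<phi> = 0" if "n \<ge> N" for n
    proof -
      have "norm (y n) > r" using y(1)[of n] that N by linarith
      then have "M_op T \<phi> (y n) = 0" using r K'(2) by (metis (mono_tags) mem_Collect_eq not_le subsetD)
      then show ?thesis by (simp add: L_def)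
    qed
    then have "(\<lambda>n. L n \<phi>) \<longlonglongrightarrow> 0" by (intro tendsto_eventually eventually_sequentiallyI)
    then have "bounded (range (\<lambda>n. L n \<phi>))" using convergent_imp_bounded by blast
    then show ?thesis unfolding bounded_iff by blast
  qed
  from distributions_bounded_on_bounded_tests[OF L this B]
  obtain D where D: "\<And>n. norm (L n (\<eta> n)) \<le> D" by blast
  have "L n (\<eta> n) = of_nat n" for n
  proof -
    have "M_op T (\<eta> n) (y n) = complex_of_real (a n) * M_op T (\<theta> n) (y n)"
      using fun_cong[OF M_op_linear[OF \<theta>(1)[of n] \<theta>(1)[of n], of "complex_of_real (a n)" 0], of "y n"] by (simp add: \<eta>_def)
    then have "M_op T (\<eta> n) (y n) \<noteq> 0" using a[of n] y(2)[of n] by simp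
    then show ?thesis by (simp add: L_def c_def t\<eta>)
  qed
  then have "real n \<le> D" for n using D[of n] by simp
  then show False using reals_Archimedean2[of D] by (meson not_le)
qed

lemma test_null_M_op:
  assumes n: "test_null \<phi>" shows "test_null (\<lambda>j. M_op T (\<phi> j))"
proof -
  have t: "test_fun (\<phi> j)" for j using n by (rule test_null_test_fun)
  obtain K where "compact K" "\<And>j. {x. \<phi> j x \<noteq> 0} \<subseteq> K" using n unfolding test_null_def by blast
  with t M_op_compact_support obtain R where R: "\<And>j y. norm y > R \<Longrightarrow> M_op T (\<phi> j) y = 0" by metis
  show ?thesis
  proof (rule test_nullI[of "cball 0 R"])
    show "test_fun (M_op T (\<phi> j))" for j by (intro test_fun_M_op t)
    show "M_op T (\<phi> j) x = 0" if "x \<notin> cball 0 R" for j x using that R by simp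
    fix "is" :: "'n list" and e :: real assume e: "e > 0"
    let ?bad = "\<lambda>j y. norm (iter_partial is (M_op T (\<phi> j)) y) \<ge> e"
    \<comment> \<open>Uniformity in the point is reduced to one point per j: \<open>y j\<close>
      violates the bound whenever any point does. If none does, its value is arbitrary, which is
      harmless because uniform boundedness holds along any sequence of points.\<close>
    define y where "y = (\<lambda>j. SOME y. ?bad j y)"
    let ?L = "\<lambda>j \<psi>. if test_fun \<psi> then iter_partial is (M_op T \<psi>) (y j) else 0"
    have "(\<lambda>j. ?L j (\<phi> j)) \<longlonglongrightarrow> 0"
    proof (rule distribution_uniform_boundedness[OF distribution_M_op_deriv _ n])
      fix \<psi> :: "real^'n \<Rightarrow> complex" assume "test_fun \<psi>"
      then show "\<exists>C. \<forall>j. norm (?L j \<psi>) \<le> C" using test_fun_bounded[OF test_fun_M_op, of \<psi> "is"] by auto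
    qed
    then have "\<forall>\<^sub>F j in sequentially. norm (?L j (\<phi> j)) < e" using e by (auto simp: tendsto_iff)
    then show "\<forall>\<^sub>F j in sequentially. \<forall>x. norm (iter_partial is (M_op T (\<phi> j)) x) < e"
    proof eventually_elim
      case (elim j)
      show ?case
      proof (rule ccontr)
        assume "\<not> ?case"
        then have "\<exists>y. ?bad j y" by (simp add: not_less)
        then have "?bad j (y j)" unfolding y_def by (rule someI_ex)
        then show False using elim t by simp
      qed
    qed
  qed simp
qed

lemma distribution_L_op:
  assumes S: "distribution S" shows "distribution (L_op T S)"
proof (rule distributionI)
  fix \<phi> :: "nat \<Rightarrow> real^'n \<Rightarrow> complex" assume n: "test_null \<phi>"
  show "(\<lambda>j. L_op T S (\<phi> j)) \<longlonglongrightarrow> 0"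
    using distribution_null[OF S test_null_M_op[OF n]] by (simp add: L_op_def test_null_test_fun[OF n])
qed (auto simp: L_op_def test_fun_linear M_op_linear distribution_linear[OF S] test_fun_M_op)

text \<open>Every coordinate of \<open>L_op T S\<close> is either 0 or the coordinate of
  \<open>S\<close> at \<open>M_op T \<phi>\<close>, so only continuity of projections in the product
  topology is involved.\<close>

lemma continuous_on_L_op: "continuous_on A (L_op T)"
proof (rule continuous_on_coordinatewise_then_product)
  fix \<phi> :: "real^'n \<Rightarrow> complex"
  show "continuous_on A (\<lambda>S. L_op T S \<phi>)"
    unfolding L_op_def by (cases "test_fun \<phi>") (auto intro: continuous_on_subset[OF continuous_on_product_coordinates])
qed

end

subsection \<open>Cutoff functions\<close>

text \<open>For k = 0 this is the standard flat function exp(-1/t). The extra powers make the linear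
  span of the family closed under differentiation, as coinduction up to sums requires.\<close>

definition flat :: "nat \<Rightarrow> real \<Rightarrow> real" where
  "flat k t = (if t > 0 then (1 / t) ^ k * exp (- (1 / t)) else 0)"

lemma flat_tendsto_0: "((\<lambda>t. (1 / t) ^ k * exp (- (1 / t))) \<longlongrightarrow> 0) (at_right (0::real))"
proof -
  have "((\<lambda>x::real. x ^ k / exp x) \<longlongrightarrow> 0) at_top" by (rule tendsto_power_div_exp_0)
  from filterlim_compose[OF this filterlim_inverse_at_top_right]
  show ?thesis by (simp add: exp_minus divide_inverse)
qed

text \<open>At 0 the one-sided difference quotients decide: for y > 0 the quotient
  \<open>flat k y / y\<close> is \<open>flat (k + 1) y\<close>, which tends to 0, and for y < 0 it
  is 0.\<close>

lemma flat_has_derivative: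
  "(flat k has_real_derivative flat (k + 2) t + (- real k) * flat (k + 1) t) (at t)"
proof -
  consider "t > 0" | "t < 0" | "t = 0" by linarith
  then show ?thesis
  proof cases
    case 1
    have "((\<lambda>t. (1 / t) ^ k * exp (- (1 / t))) has_real_derivative flat (k + 2) t + (- real k) * flat (k + 1) t) (at t)"
    proof -
      have i: "((\<lambda>t. 1 / t) has_real_derivative - ((1 / t) * (1 / t))) (at t)"
        using 1 by (auto intro!: derivative_eq_intros simp: power2_eq_square field_simps)
      have "((\<lambda>t. (1 / t) ^ k * exp (- (1 / t))) has_real_derivative
          (real k * (- ((1 / t) * (1 / t)) * (1 / t) ^ (k - Suc 0))) * exp (- (1 / t))
            + exp (- (1 / t)) * - (- ((1 / t) * (1 / t))) * (1 / t) ^ k) (at t)"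
        by (intro DERIV_mult DERIV_power DERIV_minus DERIV_fun_exp i)
      moreover have "(real k * (- ((1 / t) * (1 / t)) * (1 / t) ^ (k - Suc 0))) * exp (- (1 / t))
            + exp (- (1 / t)) * - (- ((1 / t) * (1 / t))) * (1 / t) ^ k = flat (k + 2) t + (- real k) * flat (k + 1) t"
        using 1 by (cases k) (auto simp: flat_def algebra_simps add_divide_distrib diff_divide_distrib)
      ultimately show ?thesis by simp
    qed
    then show ?thesis
      by (rule has_field_derivative_transform_within_open[of _ _ _ "{0<..}"]) (use 1 in \<open>auto simp: flat_def\<close>)
  next
    case 2
    have "((\<lambda>t. 0) has_real_derivative flat (k + 2) t + (- real k) * flat (k + 1) t) (at t)"
      using 2 by (auto simp: flat_def)
    then show ?thesis
      by (rule has_field_derivative_transform_within_open[of _ _ _ "{..<0}"]) (use 2 in \<open>auto simp: flat_def\<close>)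
  next
    case 3
    have r: "((\<lambda>y. flat k y / y) \<longlongrightarrow> 0) (at_right 0)"
    proof (rule Lim_transform_eventually[OF flat_tendsto_0[of "k + 1"]])
      show "\<forall>\<^sub>F y in at_right 0. (1 / y) ^ (k + 1) * exp (- (1 / y)) = flat k y / y"
        unfolding eventually_at_right_field by (intro exI[of _ 1]) (auto simp: flat_def)
    qed
    have l: "((\<lambda>y. flat k y / y) \<longlongrightarrow> 0) (at_left 0)"
    proof (rule Lim_transform_eventually[OF tendsto_const])
      show "\<forall>\<^sub>F y in at_left 0. 0 = flat k y / y"
        unfolding eventually_at_left_field by (intro exI[of _ "-1"]) (auto simp: flat_def)
    qed
    have "((\<lambda>y. flat k y / y) \<longlongrightarrow> 0) (at 0)" using l r by (rule filterlim_split_at)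
    then show ?thesis unfolding 3 has_field_derivative_iff by (simp add: flat_def)
  qed
qed

lemma smooth_flat: "smooth (\<lambda>x::real^'n::finite. complex_of_real (flat k (x $ i)))"
proof (rule smooth_coinduct_fsum[of "\<lambda>u. \<exists>c k. u = (\<lambda>x::real^'n. complex_of_real c * complex_of_real (flat k (x $ i)))"])
  fix u :: "real^'n \<Rightarrow> complex"
  let ?P = "\<lambda>u. \<exists>c k. u = (\<lambda>x::real^'n. complex_of_real c * complex_of_real (flat k (x $ i)))"
  assume "?P u"
  then obtain c k where u: "u = (\<lambda>x::real^'n. complex_of_real c * complex_of_real (flat k (x $ i)))" by blast
  let ?D = "\<lambda>t. flat (k + 2) t + (- real k) * flat (k + 1) t"
  have d: "(u has_derivative (\<lambda>h. complex_of_real c * complex_of_real (h $ i * ?D (x $ i)))) (at x)" for x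
  proof -
    have "((\<lambda>x::real^'n. flat k (x $ i)) has_derivative (\<lambda>h. h $ i * ?D (x $ i))) (at x)"
    proof (rule has_derivative_compose[of "\<lambda>x::real^'n. x $ i" "\<lambda>h. h $ i" x UNIV "flat k" "\<lambda>h. h * ?D (x $ i)"])
      show "(flat k has_derivative (\<lambda>h. h * ?D (x $ i))) (at (x $ i))"
        unfolding mult_commute_abs has_field_derivative_def[symmetric] by (rule flat_has_derivative)
    qed (intro bounded_linear_imp_has_derivative bounded_linear_vec_nth)
    then show ?thesis unfolding u
      by (intro has_derivative_mult_right has_derivative_of_real)
  qed
  have "partial j u = (\<lambda>x. if j = i then complex_of_real c * complex_of_real (flat (k + 2) (x $ i))
      + complex_of_real (- c * real k) * complex_of_real (flat (k + 1) (x $ i)) else 0)" for j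
    by (rule ext, subst partial_eq[OF d]) (auto simp: axis_def algebra_simps)
  note p = this
  have "fsum ?P (partial j u)" for j
  proof (cases "j = i")
    case True
    then have "partial j u = (\<lambda>x. complex_of_real c * complex_of_real (flat (k + 2) (x $ i))
        + complex_of_real (- c * real k) * complex_of_real (flat (k + 1) (x $ i)))"
      by (simp add: p)
    then show ?thesis by (simp only:) (rule fsum.add; rule fsum.base; blast)
  qed (simp add: p fsum.zero)
  then show "u differentiable_on UNIV \<and> (\<forall>j. fsum ?P (partial j u))"
    using d unfolding differentiable_on_def differentiable_def by auto
next
  show "\<exists>c ka. (\<lambda>x::real^'n. complex_of_real (flat k (x $ i))) = (\<lambda>x. complex_of_real c * complex_of_real (flat ka (x $ i)))"
    by (rule exI[of _ 1], rule exI[of _ k]) simp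
qed

lemma smooth_coord_affine:
  assumes "\<And>i. smooth (\<lambda>x::real^'n::finite. complex_of_real (g (x $ i)))"
  shows "smooth (\<lambda>x::real^'n. complex_of_real (g (a * x $ i + b)))"
proof -
  have *: "smooth (\<lambda>x::real^'n. complex_of_real a * complex_of_real (x $ i) + complex_of_real b)"
    by (intro smooth_add smooth_mult smooth_const smooth_coord)
  show ?thesis
    using smooth_compose[OF assms[of i], of "\<lambda>x. (\<chi> j. a * x $ i + b)"] * by simp
qed

text \<open>For a < b a smooth step: 0 up to a and 1 from b on. The two terms of the denominator
  never vanish together.\<close>

definition ramp :: "real \<Rightarrow> real \<Rightarrow> real \<Rightarrow> real" where
  "ramp a b t = flat 0 (t - a) / (flat 0 (t - a) + flat 0 (b - t))"

lemma flat_0: "flat 0 t \<ge> 0" "flat 0 t > 0 \<longleftrightarrow> t > 0" "t \<le> 0 \<Longrightarrow> flat 0 t = 0"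
  by (auto simp: flat_def)

lemma ramp_denominator_pos: "a < b \<Longrightarrow> flat 0 (t - a) + flat 0 (b - t) > 0"
  using flat_0(1)[of "t - a"] flat_0(1)[of "b - t"] flat_0(2)[of "t - a"] flat_0(2)[of "b - t"]
  by (cases "t > a") (auto intro: add_pos_nonneg add_nonneg_pos)

lemma smooth_ramp:
  assumes "a < b" shows "smooth (\<lambda>x::real^'n::finite. complex_of_real (ramp a b (c * x $ i + d)))"
proof (rule smooth_coord_affine)
  fix i
  let ?d = "\<lambda>x::real^'n. complex_of_real (flat 0 (1 * x $ i + (-a))) + complex_of_real (flat 0 ((-1) * x $ i + b))"
  have s1: "smooth ?d" by (intro smooth_add smooth_coord_affine smooth_flat)
  have nz: "?d x \<noteq> 0" for x
    using ramp_denominator_pos[OF assms, of "x $ i"]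
    by (metis add.commute mult_1 mult_minus1 of_real_add of_real_eq_0_iff less_irrefl uminus_add_conv_diff)
  have "smooth (\<lambda>x. complex_of_real (flat 0 (1 * x $ i + (-a))) * (1 / ?d x))"
    by (intro smooth_mult smooth_inverse s1 nz smooth_coord_affine smooth_flat)
  then show "smooth (\<lambda>x::real^'n. complex_of_real (ramp a b (x $ i)))"
    by (simp add: ramp_def add.commute)
qed

lemma ramp_le_1: "a < b \<Longrightarrow> ramp a b t \<le> 1"
  using ramp_denominator_pos[of a b t] flat_0(1)[of "b - t"] by (simp add: ramp_def)

lemma ramp_eq_0: "t \<le> a \<Longrightarrow> ramp a b t = 0"
  by (simp add: ramp_def flat_0)

lemma ramp_eq_1: "a < b \<Longrightarrow> b \<le> t \<Longrightarrow> ramp a b t = 1"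
  using flat_0(2)[of "t - a"] by (simp add: ramp_def flat_0(3))

definition wcut :: "real \<Rightarrow> real \<Rightarrow> real \<Rightarrow> real" where
  "wcut a b t = ramp a b t + ramp a b (- t)"

text \<open>For 0 < a < b this is smooth on the whole line and agrees with 1/t where b \<le> |t|:
  there the bracket is 0, while near t = 0 it is 1 and keeps the denominator positive.\<close>

definition rinv :: "real \<Rightarrow> real \<Rightarrow> real \<Rightarrow> real" where
  "rinv a b t = t / (t\<^sup>2 + (1 - wcut a b t))"

text \<open>The last factor is a smooth substitute for the sign of t, exact where b \<le> |t|, so
  this extends 1/|t|.\<close>

definition rabs :: "real \<Rightarrow> real \<Rightarrow> real \<Rightarrow> real" where
  "rabs a b t = rinv a b t * (ramp a b t - ramp a b (- t))"

context
  fixes a b :: real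
  assumes ab: "0 < a" "a < b"
begin

lemma wcut_eq_0: "\<bar>t\<bar> \<le> a \<Longrightarrow> wcut a b t = 0"
  by (simp add: wcut_def ramp_eq_0)

lemma wcut_eq_1: "b \<le> \<bar>t\<bar> \<Longrightarrow> wcut a b t = 1"
  using ab by (cases "t \<ge> 0") (auto simp: wcut_def ramp_eq_0 ramp_eq_1)

lemma wcut_le_1: "wcut a b t \<le> 1"
  using ab ramp_le_1[of a b t] ramp_le_1[of a b "-t"] by (cases "t \<ge> 0") (auto simp: wcut_def ramp_eq_0)

lemma smooth_wcut: "smooth (\<lambda>x::real^'n::finite. complex_of_real (wcut a b (c * x $ i)))"
proof -
  have "smooth (\<lambda>x::real^'n. complex_of_real (ramp a b (c * x $ i + 0)) + complex_of_real (ramp a b ((- c) * x $ i + 0)))"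
    using ab by (intro smooth_add smooth_ramp) auto
  then show ?thesis by (simp add: wcut_def)
qed

lemma rinv_denominator_pos: "t\<^sup>2 + (1 - wcut a b t) > 0"
  using ab wcut_eq_0[of 0] wcut_le_1[of t] by (cases "t = 0") (auto intro: add_pos_nonneg)

lemma smooth_rinv: "smooth (\<lambda>x::real^'n::finite. complex_of_real (rinv a b (x $ i)))"
proof -
  let ?d = "\<lambda>x::real^'n. complex_of_real (x $ i) * complex_of_real (x $ i) + (1 - complex_of_real (wcut a b (1 * x $ i)))"
  have d: "?d x = complex_of_real ((x $ i)\<^sup>2 + (1 - wcut a b (x $ i)))" for x
    by (simp add: power2_eq_square)
  have "?d x \<noteq> 0" for x unfolding d of_real_eq_0_iff using rinv_denominator_pos[of "x $ i"] by simp
  then have "smooth (\<lambda>x. complex_of_real (x $ i) * (1 / ?d x))"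
    by (intro smooth_mult smooth_inverse smooth_add smooth_diff smooth_const smooth_coord smooth_wcut)
  then show ?thesis unfolding d by (simp add: rinv_def)
qed

lemma smooth_rabs: "smooth (\<lambda>x::real^'n::finite. complex_of_real (rabs a b (x $ i)))"
proof -
  have "smooth (\<lambda>x::real^'n. complex_of_real (rinv a b (x $ i)) *
      (complex_of_real (ramp a b (1 * x $ i + 0)) - complex_of_real (ramp a b ((- 1) * x $ i + 0))))"
    using ab by (intro smooth_mult smooth_diff smooth_ramp smooth_rinv) auto
  then show ?thesis by (simp add: rabs_def)
qed

lemma rinv_eq: "b \<le> \<bar>t\<bar> \<Longrightarrow> rinv a b t = 1 / t"
  by (simp add: rinv_def wcut_eq_1 power2_eq_square)

lemma rabs_eq: "b \<le> \<bar>t\<bar> \<Longrightarrow> rabs a b t = 1 / \<bar>t\<bar>"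
  using ab by (cases "t \<ge> 0") (auto simp: rabs_def rinv_eq ramp_eq_0 ramp_eq_1)

end

subsection \<open>Smooth families of test functions\<close>

text \<open>A parameter and a test variable are joined into one vector over the sum of the index
  types, so that \<open>smooth\<close> and \<open>iter_partial\<close> handle both groups of
  variables alike.\<close>

definition pair :: "real^'k::finite \<Rightarrow> real^'n::finite \<Rightarrow> real^('k + 'n)" where
  "pair x \<xi> = (\<chi> k. case k of Inl i \<Rightarrow> x $ i | Inr i \<Rightarrow> \<xi> $ i)"

lemma pair_nth [simp]: "pair x \<xi> $ Inl i = x $ i" "pair x \<xi> $ Inr j = \<xi> $ j"
  by (simp_all add: pair_def)

lemma continuous_on_pair: "continuous_on A (\<lambda>p. pair (fst p) (snd p))"
  unfolding pair_def
proof (rule continuous_on_vec_lambda)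
  fix k :: "'a + 'b"
  show "continuous_on A (\<lambda>p. case k of Inl i \<Rightarrow> fst p $ i | Inr i \<Rightarrow> snd p $ i)"
    by (cases k) (auto intro!: continuous_intros)
qed

lemma compact_pair:
  assumes "compact A" "compact B" shows "compact {pair x \<xi> |x \<xi>. x \<in> A \<and> \<xi> \<in> B}"
proof -
  have "{pair x \<xi> |x \<xi>. x \<in> A \<and> \<xi> \<in> B} = (\<lambda>p. pair (fst p) (snd p)) ` (A \<times> B)" by force
  then show ?thesis using assms by (simp add: compact_continuous_image continuous_on_pair compact_Times)
qed

lemma dist_pair: "dist (pair x \<xi>) (pair y \<xi>) \<le> dist x y"
proof -
  have "dist (pair x \<xi>) (pair y \<xi>) = L2_set (\<lambda>k. dist (pair x \<xi> $ k) (pair y \<xi> $ k)) (UNIV :: ('a + 'b) set)"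
    by (simp add: dist_vec_def)
  also have "\<dots> = L2_set (\<lambda>i. dist (x $ i) (y $ i)) UNIV"
    unfolding L2_set_def UNIV_Plus_UNIV[symmetric]
    by (subst sum.Plus) auto
  finally show ?thesis by (simp add: dist_vec_def)
qed

lemma pair_add_axis:
  "pair (x + t *\<^sub>R axis i 1) \<xi> = pair x \<xi> + t *\<^sub>R axis (Inl i) 1"
  "pair x (\<xi> + t *\<^sub>R axis j 1) = pair x \<xi> + t *\<^sub>R axis (Inr j) 1"
  unfolding vec_eq_iff by (auto simp: pair_def axis_def split: sum.split)

lemma smooth_pair:
  assumes "smooth F" shows "smooth (\<lambda>x. F (pair x \<xi>))" "smooth (\<lambda>\<xi>. F (pair x \<xi>))"
proof -
  have "smooth (\<lambda>x. complex_of_real (pair x \<xi> $ k))" for k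
    by (cases k) auto
  then show "smooth (\<lambda>x. F (pair x \<xi>))" by (rule smooth_compose[OF assms])
  have "smooth (\<lambda>\<xi>. complex_of_real (pair x \<xi> $ k))" for k
    by (cases k) auto
  then show "smooth (\<lambda>\<xi>. F (pair x \<xi>))" by (rule smooth_compose[OF assms])
qed

lemma partial_pair:
  "partial i (\<lambda>x. F (pair x \<xi>)) = (\<lambda>x. partial (Inl i) F (pair x \<xi>))"
  "partial j (\<lambda>\<xi>. F (pair x \<xi>)) = (\<lambda>\<xi>. partial (Inr j) F (pair x \<xi>))"
  by (simp_all add: partial_def pair_add_axis)

lemma iter_partial_pair:
  "iter_partial is (\<lambda>x. F (pair x \<xi>)) = (\<lambda>x. iter_partial (map Inl is) F (pair x \<xi>))"
  "iter_partial js (\<lambda>\<xi>. F (pair x \<xi>)) = (\<lambda>\<xi>. iter_partial (map Inr js) F (pair x \<xi>))"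
proof -
  show "iter_partial is (\<lambda>x. F (pair x \<xi>)) = (\<lambda>x. iter_partial (map Inl is) F (pair x \<xi>))"
    by (induction "is") (simp_all add: iter_partial_Cons partial_pair)
  show "iter_partial js (\<lambda>\<xi>. F (pair x \<xi>)) = (\<lambda>\<xi>. iter_partial (map Inr js) F (pair x \<xi>))"
    by (induction js) (simp_all add: iter_partial_Cons partial_pair)
qed

text \<open>Here \<open>F\<close> is regarded as the family of test functions \<open>F (pair x \<cdot>)\<close>, all supported in \<open>K\<close>.\<close>

definition family :: "(real^'n::finite) set \<Rightarrow> (real^('k::finite + 'n) \<Rightarrow> complex) \<Rightarrow> bool" where
  "family K F \<longleftrightarrow> smooth F \<and> compact K \<and> (\<forall>x \<xi>. \<xi> \<notin> K \<longrightarrow> F (pair x \<xi>) = 0)"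

lemma family_smooth: "family K F \<Longrightarrow> smooth F"
  and family_compact: "family K F \<Longrightarrow> compact K"
  and family_eq_0: "family K F \<Longrightarrow> \<xi> \<notin> K \<Longrightarrow> F (pair x \<xi>) = 0"
  by (auto simp: family_def)

lemma test_fun_family: "family K F \<Longrightarrow> test_fun (\<lambda>\<xi>. F (pair x \<xi>))"
  unfolding family_def test_fun_iff by (auto intro!: smooth_pair exI[of _ K])

lemma family_partial_Inl:
  assumes "family K F" shows "family K (partial (Inl i) F)"
proof -
  have "partial (Inl i) F (pair x \<xi>) = 0" if "\<xi> \<notin> K" for x \<xi>
  proof -
    have "(\<lambda>x. F (pair x \<xi>)) = (\<lambda>x. 0)" using family_eq_0[OF assms that] by auto
    then show ?thesis using fun_cong[OF partial_pair(1)[of i F \<xi>], of x] by simp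
  qed
  then show ?thesis using assms by (auto simp: family_def intro: smooth_partial)
qed

lemma family_partial_Inr:
  assumes "family K F" shows "family K (partial (Inr i) F)"
proof -
  have "partial (Inr i) F (pair x \<xi>) = 0" if "\<xi> \<notin> K" for x \<xi>
    using iter_partial_eq_0_outside[of K "\<lambda>\<xi>. F (pair x \<xi>)" \<xi> "[i]"] assms that
    by (auto simp: family_def compact_imp_closed iter_partial_Cons partial_pair)
  then show ?thesis using assms by (auto simp: family_def intro: smooth_partial)
qed

lemma family_iter_partial:
  assumes "family K F" shows "family K (iter_partial is F)"
proof (induction "is")
  case (Cons i "is")
  then show ?case by (cases i) (auto simp: iter_partial_Cons intro: family_partial_Inl family_partial_Inr)
qed (use assms in simp)

text \<open>Uniformity in \<xi> comes from compactness on K, and off K both values are 0.\<close>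

lemma family_uniformly_continuous:
  assumes F: "family K F" and X: "compact X" and e: "e > 0"
  shows "\<exists>d>0. \<forall>x\<in>X. \<forall>y\<in>X. dist x y < d \<longrightarrow> (\<forall>\<xi>. norm (F (pair x \<xi>) - F (pair y \<xi>)) < e)"
proof -
  let ?C = "{pair x \<xi> |x \<xi>. x \<in> X \<and> \<xi> \<in> K}"
  have "uniformly_continuous_on ?C F"
    by (intro compact_uniformly_continuous smooth_continuous family_smooth[OF F] compact_pair X family_compact[OF F])
  then obtain d where d: "d > 0" "\<And>q p. q \<in> ?C \<Longrightarrow> p \<in> ?C \<Longrightarrow> dist p q < d \<Longrightarrow> dist (F p) (F q) < e"
    using e by (rule uniformly_continuous_onE) blast
  have "norm (F (pair x \<xi>) - F (pair y \<xi>)) < e" if "x \<in> X" "y \<in> X" "dist x y < d" for x y \<xi>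
  proof (cases "\<xi> \<in> K")
    case True
    then show ?thesis using d(2)[of "pair y \<xi>" "pair x \<xi>"] that dist_pair[of x \<xi> y] by (auto simp: dist_norm)
  qed (use family_eq_0[OF F] e in simp)
  with d(1) show ?thesis by blast
qed

lemma bounded_tests_family:
  assumes F: "family K F" and X: "compact X"
  shows "bounded_tests ((\<lambda>x \<xi>. F (pair x \<xi>)) ` X)"
  unfolding bounded_tests_def
proof (intro conjI exI[of _ K] family_compact[OF F] allI)
  show "\<forall>\<theta>\<in>(\<lambda>x \<xi>. F (pair x \<xi>)) ` X. test_fun \<theta> \<and> {x. \<theta> x \<noteq> 0} \<subseteq> K"
    using test_fun_family[OF F] family_eq_0[OF F] by blast
  fix "is"
  let ?G = "iter_partial (map Inr is) F"
  let ?C = "{pair x \<xi> |x \<xi>. x \<in> X \<and> \<xi> \<in> K}"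
  have G: "family K ?G" by (rule family_iter_partial[OF F])
  have "bounded (?G ` ?C)"
    by (intro compact_imp_bounded compact_continuous_image smooth_continuous family_smooth[OF G] compact_pair X family_compact[OF F])
  then obtain C where C: "\<And>x \<xi>. x \<in> X \<Longrightarrow> \<xi> \<in> K \<Longrightarrow> norm (?G (pair x \<xi>)) \<le> C" unfolding bounded_iff by blast
  have "norm (?G (pair x \<xi>)) \<le> max C 0" if "x \<in> X" for x \<xi>
    using C[OF that, of \<xi>] family_eq_0[OF G, of \<xi> x] by (cases "\<xi> \<in> K") auto
  then show "\<exists>C. \<forall>\<theta>\<in>(\<lambda>x \<xi>. F (pair x \<xi>)) ` X. \<forall>x. norm (iter_partial is \<theta> x) \<le> C"
    unfolding ball_simps iter_partial_pair by blast
qed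

text \<open>The bound involves only the oscillation of the gradient along the segment, so for a
  family it is uniform in the test variable.\<close>

lemma first_order_remainder_bound:
  fixes f :: "real^'n::finite \<Rightarrow> complex"
  assumes f: "smooth f"
    and b: "\<And>i z. z \<in> closed_segment x (x + h) \<Longrightarrow> norm (partial i f z - partial i f x) \<le> e"
  shows "norm (f (x + h) - f x - (\<Sum>i\<in>UNIV. (h $ i) *\<^sub>R partial i f x)) \<le> norm h * (real CARD('n) * e)"
proof -
  let ?D = "\<lambda>z v. \<Sum>i\<in>UNIV. (v $ i) *\<^sub>R partial i f z"
  have "norm (f (x + h) - f x - ?D x ((x + h) - x)) \<le> norm ((x + h) - x) * (real CARD('n) * e)"
  proof (rule differentiable_bound_linearization[where S = "closed_segment x (x + h)" and f' = ?D])
    show "x + t *\<^sub>R (x + h - x) \<in> closed_segment x (x + h)" if "t \<in> {0..1}" for t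
      using that unfolding closed_segment_def by (auto simp: algebra_simps intro!: exI[of _ t])
    show "(f has_derivative ?D z) (at z within closed_segment x (x + h))" for z
      by (rule has_derivative_at_withinI, rule smooth_has_derivative, rule f)
    show "onorm (?D z - ?D x) \<le> real CARD('n) * e" if z: "z \<in> closed_segment x (x + h)" for z
    proof (rule onorm_le)
      fix v :: "real^'n"
      have "(?D z - ?D x) v = (\<Sum>i\<in>UNIV. (v $ i) *\<^sub>R (partial i f z - partial i f x))"
        by (simp add: scaleR_diff_right sum_subtractf)
      also have "norm \<dots> \<le> (\<Sum>i\<in>(UNIV :: 'n set). norm v * e)"
      proof (rule sum_norm_le)
        fix i show "norm ((v $ i) *\<^sub>R (partial i f z - partial i f x)) \<le> norm v * e"
          unfolding norm_scaleR by (intro mult_mono b z component_le_norm_cart) auto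
      qed
      finally show "norm ((?D z - ?D x) v) \<le> real CARD('n) * e * norm v" by (simp add: mult_ac)
    qed
  qed simp
  then show ?thesis by simp
qed

text \<open>Because mixed derivatives commute, a \<xi>-derivative of the remainder is the remainder
  of the derived family \<open>?G\<close>. The first order bound then applies, with the modulus of
  continuity of the parameter gradient of \<open>?G\<close>.\<close>

lemma family_difference_quotient_null:
  fixes F :: "real^('k::finite + 'n::finite) \<Rightarrow> complex"
  assumes F: "family K F" and h: "h \<longlonglongrightarrow> 0" and nz: "\<And>j. h j \<noteq> 0"
  shows "test_null (\<lambda>j \<xi>. complex_of_real (1 / norm (h j)) *
    (F (pair (x + h j) \<xi>) - F (pair x \<xi>) - (\<Sum>i\<in>UNIV. complex_of_real (h j $ i) * partial (Inl i) F (pair x \<xi>))))"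
    (is "test_null ?q")
proof (rule test_nullI[OF family_compact[OF F]])
  let ?s = "\<lambda>F h \<xi>. \<Sum>i\<in>UNIV. complex_of_real (h $ i) * partial (Inl i) F (pair x \<xi>)"
  have t: "test_fun (?s F h)" for h
    by (intro test_fun_sum test_fun_cmult test_fun_family[OF family_partial_Inl[OF F]])
  show "test_fun (?q j)" for j
    by (intro test_fun_cmult test_fun_diff t test_fun_family[OF F])
  show "?q j \<xi> = 0" if "\<xi> \<notin> K" for j \<xi>
    by (simp add: family_eq_0[OF F that] family_eq_0[OF family_partial_Inl[OF F] that])
  fix "is" :: "'n list" and e :: real assume e: "e > 0"
  let ?G = "iter_partial (map Inr is) F"
  have G: "family K ?G" by (rule family_iter_partial[OF F])
  have q: "iter_partial is (?q j) \<xi> = complex_of_real (1 / norm (h j)) *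
      (?G (pair (x + h j) \<xi>) - ?G (pair x \<xi>) - ?s ?G (h j) \<xi>)" for j \<xi>
  proof -
    have sm: "smooth (\<lambda>\<xi>. F (pair x \<xi>))" "smooth (\<lambda>\<xi>. partial (Inl i) F (pair x \<xi>))" for x i
      using family_smooth[OF F] smooth_pair smooth_partial by blast+
    have "iter_partial is (?s F (h j)) = (\<lambda>\<xi>. \<Sum>i\<in>UNIV. complex_of_real (h j $ i) * iter_partial (map Inr is) (partial (Inl i) F) (pair x \<xi>))"
      by (subst iter_partial_sum) (auto simp: iter_partial_cmult sm iter_partial_pair intro!: smooth_mult sm)
    also have "\<dots> = ?s ?G (h j)"
      by (simp add: partial_iter_partial_commute family_smooth[OF F])
    finally have "iter_partial is (?s F (h j)) = ?s ?G (h j)" .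
    then show ?thesis
      by (simp only: iter_partial_cmult iter_partial_diff smooth_diff sm test_fun_smooth[OF t] iter_partial_pair)
  qed
  \<comment> \<open>With the factor 2 the \<open>CARD('k)\<close> contributions add up to e/2, hence
    strictly below e.\<close>
  define e' where "e' = e / (2 * real CARD('k))"
  have e': "e' > 0" using e by (simp add: e'_def)
  have "\<exists>d>0. \<forall>z. dist z x < d \<longrightarrow> (\<forall>\<xi>. norm (partial (Inl i) ?G (pair z \<xi>) - partial (Inl i) ?G (pair x \<xi>)) < e')" for i
  proof -
    obtain d where d: "d > 0" "\<And>y z \<xi>. y \<in> cball x 1 \<Longrightarrow> z \<in> cball x 1 \<Longrightarrow> dist y z < d \<Longrightarrow>
        norm (partial (Inl i) ?G (pair y \<xi>) - partial (Inl i) ?G (pair z \<xi>)) < e'"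
      using family_uniformly_continuous[OF family_partial_Inl[OF G] compact_cball e'] by metis
    \<comment> \<open>The uniform modulus is taken on the compact ball \<open>cball x 1\<close>,
      hence the radius \<open>min d 1\<close>.\<close>
    then show ?thesis by (intro exI[of _ "min d 1"]) (auto simp: dist_commute)
  qed
  then obtain d where d: "\<And>i. d i > 0" "\<And>i z \<xi>. dist z x < d i \<Longrightarrow>
      norm (partial (Inl i) ?G (pair z \<xi>) - partial (Inl i) ?G (pair x \<xi>)) < e'" by metis
  define d0 where "d0 = Min (range d)"
  have d0: "d0 > 0" "\<And>i. d0 \<le> d i" using d(1) by (auto simp: d0_def)
  have "\<forall>\<^sub>F j in sequentially. norm (h j) < d0" using tendstoD[OF h d0(1)] by simp
  then show "\<forall>\<^sub>F j in sequentially. \<forall>\<xi>. norm (iter_partial is (?q j) \<xi>) < e"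
  proof eventually_elim
    case (elim j)
    show ?case
    proof
      fix \<xi>
      have "norm (?G (pair (x + h j) \<xi>) - ?G (pair x \<xi>) - (\<Sum>i\<in>UNIV. (h j $ i) *\<^sub>R partial i (\<lambda>x. ?G (pair x \<xi>)) x))
        \<le> norm (h j) * (real CARD('k) * e')"
      proof (rule first_order_remainder_bound)
        show "smooth (\<lambda>x. ?G (pair x \<xi>))" by (intro smooth_pair family_smooth[OF G])
        fix i z assume "z \<in> closed_segment x (x + h j)"
        then have "dist z x \<le> norm (h j)" using segment_bound(1)[of z x "x + h j"] by (simp add: dist_norm)
        then have "dist z x < d i" using elim d0(2)[of i] by linarith
        then show "norm (partial i (\<lambda>x. ?G (pair x \<xi>)) z - partial i (\<lambda>x. ?G (pair x \<xi>)) x) \<le> e'"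
          using d(2)[of z i \<xi>] by (simp add: partial_pair less_imp_le)
      qed
      then have "norm (?G (pair (x + h j) \<xi>) - ?G (pair x \<xi>) - ?s ?G (h j) \<xi>) \<le> norm (h j) * (real CARD('k) * e')"
        by (simp add: partial_pair scaleR_conv_of_real)
      moreover have "norm (h j) > 0" using nz by simp
      ultimately have "norm (iter_partial is (?q j) \<xi>) \<le> real CARD('k) * e'"
        unfolding q norm_mult by (simp add: norm_divide field_simps)
      also have "\<dots> < e" using e by (simp add: e'_def)
      finally show "norm (iter_partial is (?q j) \<xi>) < e" .
    qed
  qed
qed

text \<open>Distributions are continuous along null sequences, so differentiability under a
  distribution is tested along sequences of increments.\<close>

lemma has_derivative_sequentiallyI:
  fixes f :: "'a::real_normed_vector \<Rightarrow> 'b::real_normed_vector"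
  assumes "bounded_linear D"
    and "\<And>h. h \<longlonglongrightarrow> 0 \<Longrightarrow> (\<And>j. h j \<noteq> 0) \<Longrightarrow> (\<lambda>j. norm (f (x + h j) - f x - D (h j)) / norm (h j)) \<longlonglongrightarrow> 0"
  shows "(f has_derivative D) (at x)"
  unfolding has_derivative_at tendsto_at_iff_sequentially o_def
  using assms by auto

lemma distribution_family_has_derivative:
  fixes F :: "real^('k::finite + 'n::finite) \<Rightarrow> complex"
  assumes L: "distribution L" and F: "family K F"
  shows "((\<lambda>x. L (\<lambda>\<xi>. F (pair x \<xi>))) has_derivative
     (\<lambda>h. \<Sum>i\<in>UNIV. (h $ i) *\<^sub>R L (\<lambda>\<xi>. partial (Inl i) F (pair x \<xi>)))) (at x)"
proof (rule has_derivative_sequentiallyI)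
  show "bounded_linear (\<lambda>h::real^'k. \<Sum>i\<in>UNIV. (h $ i) *\<^sub>R L (\<lambda>\<xi>. partial (Inl i) F (pair x \<xi>)))"
    by (intro bounded_linear_sum bounded_linear_scaleR_const bounded_linear_vec_nth)
  fix h :: "nat \<Rightarrow> real^'k" assume h: "h \<longlonglongrightarrow> 0" "\<And>j. h j \<noteq> 0"
  let ?s = "\<lambda>h \<xi>. \<Sum>i\<in>UNIV. complex_of_real (h $ i) * partial (Inl i) F (pair x \<xi>)"
  have tp: "test_fun (\<lambda>\<xi>. partial (Inl i) F (pair x \<xi>))" for i
    by (rule test_fun_family[OF family_partial_Inl[OF F]])
  have t: "test_fun (?s h)" for h by (intro test_fun_sum test_fun_cmult tp)
  have tF: "test_fun (\<lambda>\<xi>. F (pair x \<xi>))" for x by (rule test_fun_family[OF F])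
  have "L (\<lambda>\<xi>. complex_of_real (1 / norm (h j)) * (F (pair (x + h j) \<xi>) - F (pair x \<xi>) - ?s (h j) \<xi>))
     = complex_of_real (1 / norm (h j)) * (L (\<lambda>\<xi>. F (pair (x + h j) \<xi>)) - L (\<lambda>\<xi>. F (pair x \<xi>))
        - (\<Sum>i\<in>UNIV. (h j $ i) *\<^sub>R L (\<lambda>\<xi>. partial (Inl i) F (pair x \<xi>))))" for j
    unfolding distribution_cmult[OF L test_fun_diff[OF test_fun_diff[OF tF tF] t]]
    by (simp add: distribution_cmult[OF L] distribution_diff[OF L] distribution_sum[OF L]
        test_fun_diff test_fun_cmult t tF tp scaleR_conv_of_real)
  then show "(\<lambda>j. norm (L (\<lambda>\<xi>. F (pair (x + h j) \<xi>)) - L (\<lambda>\<xi>. F (pair x \<xi>))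
      - (\<Sum>i\<in>UNIV. (h j $ i) *\<^sub>R L (\<lambda>\<xi>. partial (Inl i) F (pair x \<xi>)))) / norm (h j)) \<longlonglongrightarrow> 0"
    using tendsto_norm_zero[OF distribution_null[OF L family_difference_quotient_null[OF F h, of x]]]
    by (simp add: norm_mult norm_divide)
qed

lemma partial_distribution_family:
  assumes "distribution L" "family K F"
  shows "partial i (\<lambda>x. L (\<lambda>\<xi>. F (pair x \<xi>))) = (\<lambda>x. L (\<lambda>\<xi>. partial (Inl i) F (pair x \<xi>)))"
  by (rule ext, subst partial_eq[OF distribution_family_has_derivative[OF assms]])
    (simp add: axis_def if_distrib[of "\<lambda>c. c *\<^sub>R _"] cong: if_cong)

lemma iter_partial_distribution_family:
  assumes L: "distribution L" and F: "family K F"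
  shows "iter_partial is (\<lambda>x. L (\<lambda>\<xi>. F (pair x \<xi>))) = (\<lambda>x. L (\<lambda>\<xi>. iter_partial (map Inl is) F (pair x \<xi>)))"
  by (induction "is")
    (simp_all add: iter_partial_Cons partial_distribution_family[OF L family_iter_partial[OF F]])

lemma smooth_distribution_family:
  assumes L: "distribution L" and F: "family K F"
  shows "smooth (\<lambda>x. L (\<lambda>\<xi>. F (pair x \<xi>)))"
  unfolding smooth_def iter_partial_distribution_family[OF assms] differentiable_on_def differentiable_def
  using distribution_family_has_derivative[OF L family_iter_partial[OF F]] has_derivative_at_withinI by blast

section \<open>Integration of families and its exchange with distributions\<close>

lemma divide_mult_less:
  fixes e m :: real
  assumes "e > 0" "m \<ge> 0" shows "e / (m + 1) * m < e"
proof -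
  have "e / (m + 1) * m < e / (m + 1) * (m + 1)"
    using assms by (intro mult_strict_left_mono) (auto simp: add_nonneg_pos)
  then show ?thesis using assms by simp
qed

text \<open>The error depends on \<open>g\<close> only through a modulus of continuity, so a single
  tagged division serves all members of a family.\<close>

lemma Riemann_sum_bound:
  fixes g :: "'a::euclidean_space \<Rightarrow> complex"
  assumes g: "continuous_on (cbox a b) g" and p: "p tagged_division_of (cbox a b)"
    and fine: "(\<lambda>x. ball x d) fine p"
    and e: "\<And>x y. x \<in> cbox a b \<Longrightarrow> y \<in> cbox a b \<Longrightarrow> dist x y < d \<Longrightarrow> norm (g x - g y) \<le> e"
    and e0: "e \<ge> 0"
  shows "norm ((\<Sum>(x, k)\<in>p. complex_of_real (measure lborel k) * g x) - integral (cbox a b) g) \<le> e * measure lborel (cbox a b)"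
proof -
  have "(\<Sum>(x, k)\<in>p. complex_of_real (measure lborel k) * g x) - integral (cbox a b) g
      = (\<Sum>(x, k)\<in>p. complex_of_real (measure lborel k) * g x - integral k g)"
    unfolding integral_combine_tagged_division_topdown[OF integrable_continuous[OF g] p]
    by (simp add: sum_subtractf case_prod_beta')
  also have "norm \<dots> \<le> (\<Sum>(x, k)\<in>p. e * measure lborel k)"
    unfolding case_prod_beta'
  proof (rule sum_norm_le)
    fix q assume q: "q \<in> p"
    obtain x k where xk: "q = (x, k)" by fastforce
    have k: "x \<in> k" "k \<subseteq> cbox a b" "k \<subseteq> ball x d"
      using tagged_division_ofD(2,3)[OF p] q fine unfolding xk fine_def by auto
    obtain u v where uv: "k = cbox u v" using tagged_division_ofD(4)[OF p] q unfolding xk by blast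
    have "((\<lambda>y. g y - g x) has_integral (integral k g - complex_of_real (measure lborel k) * g x)) (cbox u v)"
      using has_integral_diff[OF integrable_integral[OF integrable_continuous[OF continuous_on_subset[OF g k(2)[unfolded uv]]]]
          has_integral_const[of "g x" u v]]
      unfolding uv by (simp add: scaleR_conv_of_real)
    moreover have "norm (g y - g x) \<le> e" if "y \<in> cbox u v" for y
    proof -
      have "x \<in> cbox a b" "y \<in> cbox a b" "dist y x < d"
        using k that unfolding uv by (auto simp: subset_eq dist_commute)
      then show ?thesis using e[of y x] by blast
    qed
    ultimately have "norm (integral k g - complex_of_real (measure lborel k) * g x) \<le> e * measure lborel k"
      using has_integral_bound[OF e0] unfolding uv by blast
    then show "norm (complex_of_real (measure lborel (snd q)) * g (fst q) - integral (snd q) g) \<le> e * measure lborel (snd q)"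
      unfolding xk by (simp add: norm_minus_commute)
  qed
  also have "\<dots> = e * measure lborel (cbox a b)"
    unfolding additive_content_tagged_division[OF p, symmetric] by (simp add: sum_distrib_left case_prod_beta')
  finally show ?thesis .
qed

lemma integrable_compact_support:
  fixes g :: "'a::euclidean_space \<Rightarrow> complex"
  assumes g: "continuous_on UNIV g" and K: "compact K" and z: "\<And>x. x \<notin> K \<Longrightarrow> g x = 0"
  shows "integrable lborel g" and "K \<subseteq> cbox a b \<Longrightarrow> (LINT x|lborel. g x) = integral (cbox a b) g"
proof -
  have "(\<lambda>x. indicator K x *\<^sub>R g x) = g" using z by (auto simp: indicator_def)
  then show i: "integrable lborel g"
    using borel_integrable_compact[OF K continuous_on_subset[OF g subset_UNIV]] by simp
  assume "K \<subseteq> cbox a b"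
  then have "integral UNIV g = integral (cbox a b) g"
    unfolding integral_restrict_UNIV[of "cbox a b" g, symmetric] using z by (intro integral_cong) auto
  then show "(LINT x|lborel. g x) = integral (cbox a b) g" using integral_lborel[OF i] by simp
qed

lemma test_fun_integrable:
  assumes "test_fun \<phi>" "continuous_on UNIV f" shows "integrable lborel (\<lambda>x. f x * \<phi> x)"
proof -
  obtain K where K: "compact K" "{x. \<phi> x \<noteq> 0} \<subseteq> K" using assms unfolding test_fun_iff by blast
  show ?thesis
    by (rule integrable_compact_support(1)[OF continuous_on_mult[OF assms(2) smooth_continuous[OF test_fun_smooth[OF assms(1)]]] K(1)])
      (use K(2) in auto)
qed

text \<open>Treating the integral as a distribution makes differentiation under the integral sign an
  instance of \<open>iter_partial_distribution_family\<close>.\<close>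

lemma distribution_integral: "distribution (\<lambda>\<phi>. if test_fun \<phi> then LINT x|lborel. \<phi> x else 0)"
proof (rule distributionI)
  have i: "integrable lborel \<phi>" if "test_fun \<phi>" for \<phi> :: "(real,'a) vec \<Rightarrow> complex"
    using test_fun_integrable[OF that, of "\<lambda>x. 1"] by simp
  show "(if test_fun (\<lambda>x. a * \<phi> x + b * \<psi> x) then LINT x|lborel. (a * \<phi> x + b * \<psi> x) else 0)
      = a * (if test_fun \<phi> then LINT x|lborel. \<phi> x else 0) + b * (if test_fun \<psi> then LINT x|lborel. \<psi> x else 0)"
    if "test_fun \<phi>" "test_fun \<psi>" for \<phi> \<psi> :: "(real,'a) vec \<Rightarrow> complex" and a b
    using that i by (simp add: test_fun_linear)
  fix \<phi> :: "nat \<Rightarrow> (real,'a) vec \<Rightarrow> complex" assume n: "test_null \<phi>"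
  have t: "test_fun (\<phi> j)" for j using n by (rule test_null_test_fun)
  obtain K where K: "compact K" "\<And>j. {x. \<phi> j x \<noteq> 0} \<subseteq> K" using n unfolding test_null_def by blast
  obtain a b where ab: "K \<subseteq> cbox a b" using bounded_subset_cbox_symmetric[OF compact_imp_bounded[OF K(1)]] by metis
  have I: "(LINT x|lborel. \<phi> j x) = integral (cbox a b) (\<phi> j)" for j
    by (rule integrable_compact_support(2)[OF smooth_continuous[OF test_fun_smooth[OF t]] K(1) _ ab]) (use K(2) in auto)
  have "(\<lambda>j. integral (cbox a b) (\<phi> j)) \<longlonglongrightarrow> 0"
  proof (rule tendstoI)
    fix e :: real assume e: "e > 0"
    define e' where "e' = e / (measure lborel (cbox a b) + 1)"
    have e': "e' > 0" using e by (simp add: e'_def add_nonneg_pos)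
    have "\<forall>\<^sub>F j in sequentially. \<forall>x. norm (iter_partial [] (\<phi> j) x) < e'"
      using n e' unfolding test_null_def by blast
    then show "\<forall>\<^sub>F j in sequentially. dist (integral (cbox a b) (\<phi> j)) 0 < e"
    proof eventually_elim
      case (elim j)
      have "norm (integral (cbox a b) (\<phi> j)) \<le> e' * measure lborel (cbox a b)"
        using elim e' by (intro has_integral_bound[OF _ integrable_integral[OF integrable_continuous]])
          (auto intro: less_imp_le smooth_continuous[OF test_fun_smooth[OF t]])
      also have "\<dots> < e" using divide_mult_less[OF e measure_nonneg] by (simp add: e'_def)
      finally show ?case by simp
    qed
  qed
  then show "(\<lambda>j. if test_fun (\<phi> j) then LINT x|lborel. \<phi> j x else 0) \<longlonglongrightarrow> 0"
    by (simp add: t I)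
qed simp

text \<open>In \<open>smooth_integral_family\<close> the integration variable has to take the place
  of the test variable, so the two groups of variables are exchanged.\<close>

definition swap :: "real^('n::finite + 'k::finite) \<Rightarrow> real^('k + 'n)" where
  "swap p = (\<chi> k. case k of Inl i \<Rightarrow> p $ Inr i | Inr i \<Rightarrow> p $ Inl i)"

lemma swap_pair: "swap (pair \<xi> x) = pair x \<xi>"
  by (auto simp: swap_def pair_def vec_eq_iff split: sum.split)

lemma smooth_swap:
  fixes F :: "real^('k::finite + 'n::finite) \<Rightarrow> complex"
  assumes "smooth F" shows "smooth (\<lambda>p. F (swap p))"
proof (rule smooth_compose[OF assms])
  show "smooth (\<lambda>p. complex_of_real (swap p $ k))" for k :: "'k + 'n"
    by (cases k) (auto simp: swap_def)
qed

lemma smooth_integral_family: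
  fixes F :: "real^('k::finite + 'n::finite) \<Rightarrow> complex"
  assumes F: "smooth F" and X: "compact X" and FX: "\<And>x \<xi>. x \<notin> X \<Longrightarrow> F (pair x \<xi>) = 0"
  shows "smooth (\<lambda>\<xi>. LINT x|lborel. F (pair x \<xi>))"
    and "iter_partial is (\<lambda>\<xi>. LINT x|lborel. F (pair x \<xi>)) = (\<lambda>\<xi>. LINT x|lborel. iter_partial (map Inr is) F (pair x \<xi>))"
proof -
  let ?F = "\<lambda>p. F (swap p)"
  let ?I = "\<lambda>\<phi>::real^'k \<Rightarrow> complex. if test_fun \<phi> then LINT x|lborel. \<phi> x else 0"
  have fam: "family X ?F" using F X FX smooth_swap unfolding family_def by (auto simp: swap_pair)
  have e: "(\<lambda>\<xi>. LINT x|lborel. F (pair x \<xi>)) = (\<lambda>\<xi>. ?I (\<lambda>x. ?F (pair \<xi> x)))"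
    using test_fun_family[OF fam] by (simp add: swap_pair)
  show "smooth (\<lambda>\<xi>. LINT x|lborel. F (pair x \<xi>))"
    unfolding e by (rule smooth_distribution_family[OF distribution_integral fam])
  have sw: "iter_partial (map Inl is) ?F (pair \<xi> x) = iter_partial (map Inr is) F (pair x \<xi>)" for \<xi> x
    using fun_cong[OF iter_partial_pair(1)[of "is" ?F x], of \<xi>] fun_cong[OF iter_partial_pair(2)[of "is" F x], of \<xi>]
    by (simp add: swap_pair)
  have tt: "test_fun (\<lambda>x. iter_partial (map Inr is) F (pair x \<xi>))" for \<xi>
    using test_fun_family[OF family_iter_partial[OF fam], of "map Inl is" \<xi>] unfolding sw .
  show "iter_partial is (\<lambda>\<xi>. LINT x|lborel. F (pair x \<xi>)) = (\<lambda>\<xi>. LINT x|lborel. iter_partial (map Inr is) F (pair x \<xi>))"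
    unfolding e iter_partial_distribution_family[OF distribution_integral fam]
    unfolding sw if_P[OF tt] ..
qed

text \<open>Riemann sums in x converge uniformly in \<xi> together with all \<xi>-derivatives, hence
  as test functions. Applying \<open>L\<close> turns them into Riemann sums of the continuous
  function x \<mapsto> L(F(x, .)).\<close>

lemma distribution_integral_commute:
  fixes F :: "real^('k::finite + 'n::finite) \<Rightarrow> complex"
  assumes L: "distribution L" and F: "family K F"
    and X: "compact X" and FX: "\<And>x \<xi>. x \<notin> X \<Longrightarrow> F (pair x \<xi>) = 0"
  shows "L (\<lambda>\<xi>. LINT x|lborel. F (pair x \<xi>)) = (LINT x|lborel. L (\<lambda>\<xi>. F (pair x \<xi>)))"
proof -
  obtain a b where ab: "X \<subseteq> cbox a b" using bounded_subset_cbox_symmetric[OF compact_imp_bounded[OF X]] by metis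
  have "\<exists>p. p tagged_division_of (cbox a b) \<and> (\<lambda>x. ball x (inverse (real (Suc n)))) fine p" for n
    using fine_division_exists[of "\<lambda>x. ball x (inverse (real (Suc n)))" a b] gauge_ball[of "inverse (real (Suc n))"]
    by (metis inverse_positive_iff_positive of_nat_0_less_iff zero_less_Suc)
  then obtain p where p: "\<And>n. p n tagged_division_of (cbox a b)" "\<And>n. (\<lambda>x. ball x (inverse (real (Suc n)))) fine p n"
    by metis
  have fin: "finite (p n)" for n using p(1) by blast
  have small: "\<forall>\<^sub>F n in sequentially. inverse (real (Suc n)) < d" if "d > 0" for d
    using order_tendstoD(2)[OF LIMSEQ_inverse_real_of_nat that] .
  have GX: "iter_partial (map Inr is) F (pair x \<xi>) = 0" if "x \<notin> X" for "is" x \<xi>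
  proof -
    have "(\<lambda>\<xi>. F (pair x \<xi>)) = (\<lambda>\<xi>. 0)" using FX[OF that] by auto
    then show ?thesis using fun_cong[OF iter_partial_pair(2)[of "is" F x], of \<xi>] by simp
  qed
  have I: "(LINT x|lborel. iter_partial (map Inr is) F (pair x \<xi>)) = integral (cbox a b) (\<lambda>x. iter_partial (map Inr is) F (pair x \<xi>))" for "is" \<xi>
    by (rule integrable_compact_support(2)[OF _ X _ ab])
      (use GX in \<open>auto intro!: smooth_continuous smooth_pair smooth_iter_partial family_smooth[OF F]\<close>)
  let ?\<Phi> = "\<lambda>\<xi>. LINT x|lborel. F (pair x \<xi>)"
  let ?R = "\<lambda>n \<xi>. \<Sum>q\<in>p n. complex_of_real (measure lborel (snd q)) * F (pair (fst q) \<xi>)"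
  have "?\<Phi> \<xi> = 0" if "\<xi> \<notin> K" for \<xi> by (simp add: family_eq_0[OF F that])
  then have "{\<xi>. ?\<Phi> \<xi> \<noteq> 0} \<subseteq> K" by blast
  then have t\<Phi>: "test_fun ?\<Phi>"
    using family_compact[OF F] smooth_integral_family(1)[OF family_smooth[OF F] X, OF FX]
    unfolding test_fun_iff by blast
  have tR: "test_fun (?R n)" for n
    by (intro test_fun_sum test_fun_cmult test_fun_family[OF F])
  have "test_null (\<lambda>n \<xi>. ?R n \<xi> - ?\<Phi> \<xi>)"
  proof (rule test_nullI[OF family_compact[OF F]])
    show "test_fun (\<lambda>\<xi>. ?R n \<xi> - ?\<Phi> \<xi>)" for n by (intro test_fun_diff tR t\<Phi>)
    show "?R n \<xi> - ?\<Phi> \<xi> = 0" if "\<xi> \<notin> K" for n \<xi> by (simp add: family_eq_0[OF F that])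
    fix "is" :: "'n list" and e :: real assume e: "e > 0"
    let ?G = "iter_partial (map Inr is) F"
    have G: "family K ?G" by (rule family_iter_partial[OF F])
    define e' where "e' = e / (measure lborel (cbox a b) + 1)"
    have e': "e' > 0" using e by (simp add: e'_def add_nonneg_pos)
    obtain d where d: "d > 0" "\<And>x y \<xi>. x \<in> cbox a b \<Longrightarrow> y \<in> cbox a b \<Longrightarrow> dist x y < d \<Longrightarrow> norm (?G (pair x \<xi>) - ?G (pair y \<xi>)) < e'"
      using family_uniformly_continuous[OF G compact_cbox e'] by metis
    from small[OF d(1)]
    show "\<forall>\<^sub>F n in sequentially. \<forall>\<xi>. norm (iter_partial is (\<lambda>\<xi>. ?R n \<xi> - ?\<Phi> \<xi>) \<xi>) < e"
    proof eventually_elim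
      case (elim n)
      have sm: "smooth (\<lambda>\<xi>. F (pair x \<xi>))" for x by (intro smooth_pair family_smooth[OF F])
      have "iter_partial is (?R n) = (\<lambda>\<xi>. \<Sum>(x, k)\<in>p n. complex_of_real (measure lborel k) * ?G (pair x \<xi>))"
        by (subst iter_partial_sum[OF fin])
          (auto simp: iter_partial_cmult[OF sm] iter_partial_pair case_prod_beta' intro!: smooth_mult sm)
      then have *: "iter_partial is (\<lambda>\<xi>. ?R n \<xi> - ?\<Phi> \<xi>) \<xi> = (\<Sum>(x, k)\<in>p n. complex_of_real (measure lborel k) * ?G (pair x \<xi>))
          - integral (cbox a b) (\<lambda>x. ?G (pair x \<xi>))" for \<xi>
        by (subst iter_partial_diff[OF test_fun_smooth[OF tR] test_fun_smooth[OF t\<Phi>]])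
          (simp add: smooth_integral_family(2)[OF family_smooth[OF F] X, OF FX] I)
      have "norm (iter_partial is (\<lambda>\<xi>. ?R n \<xi> - ?\<Phi> \<xi>) \<xi>) \<le> e' * measure lborel (cbox a b)" for \<xi>
        unfolding *
        by (rule Riemann_sum_bound[OF smooth_continuous[OF smooth_pair(1)[OF family_smooth[OF G]]] p(1) p(2)])
          (use e' d(2) elim in \<open>auto intro!: less_imp_le\<close>)
      also have "e' * measure lborel (cbox a b) < e" using divide_mult_less[OF e measure_nonneg] by (simp add: e'_def)
      finally show ?case by blast
    qed
  qed
  from distribution_null[OF L this]
  have "(\<lambda>n. L (?R n) - L ?\<Phi>) \<longlonglongrightarrow> 0" by (simp add: distribution_diff[OF L tR t\<Phi>])
  then have 1: "(\<lambda>n. L (?R n)) \<longlonglongrightarrow> L ?\<Phi>" by (rule LIM_zero_cancel)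
  let ?g = "\<lambda>x. L (\<lambda>\<xi>. F (pair x \<xi>))"
  have cg: "continuous_on S ?g" for S by (intro smooth_continuous smooth_distribution_family[OF L F])
  have gI: "(LINT x|lborel. ?g x) = integral (cbox a b) ?g"
    by (rule integrable_compact_support(2)[OF cg X _ ab]) (simp add: FX distribution_zero[OF L])
  have LR: "L (?R n) = (\<Sum>(x, k)\<in>p n. complex_of_real (measure lborel k) * ?g x)" for n
    by (simp add: distribution_sum[OF L fin] distribution_cmult[OF L] test_fun_cmult test_fun_family[OF F] case_prod_beta')
  have "(\<lambda>n. L (?R n)) \<longlonglongrightarrow> integral (cbox a b) ?g"
  proof (rule tendstoI)
    fix e :: real assume e: "e > 0"
    define e' where "e' = e / (measure lborel (cbox a b) + 1)"
    have e': "e' > 0" using e by (simp add: e'_def add_nonneg_pos)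
    have "uniformly_continuous_on (cbox a b) ?g" by (intro compact_uniformly_continuous cg compact_cbox)
    then obtain d where d: "d > 0" "\<And>y x. y \<in> cbox a b \<Longrightarrow> x \<in> cbox a b \<Longrightarrow> dist x y < d \<Longrightarrow> dist (?g x) (?g y) < e'"
      using e' by (rule uniformly_continuous_onE) blast
    from small[OF d(1)]
    show "\<forall>\<^sub>F n in sequentially. dist (L (?R n)) (integral (cbox a b) ?g) < e"
    proof eventually_elim
      case (elim n)
      have "norm (L (?R n) - integral (cbox a b) ?g) \<le> e' * measure lborel (cbox a b)"
        unfolding LR by (rule Riemann_sum_bound[OF cg p(1) p(2)])
          (use e' d(2) elim in \<open>auto simp: dist_norm intro!: less_imp_le\<close>)
      also have "\<dots> < e" using divide_mult_less[OF e measure_nonneg] by (simp add: e'_def)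
      finally show ?case by (simp add: dist_norm)
    qed
  qed
  from LIMSEQ_unique[OF 1 this] gI show ?thesis by simp
qed

subsection \<open>Change of variables and the coordinate hyperplanes\<close>

lemma prod_Basis_vec: "(\<Prod>j\<in>(Basis :: (real^'n::finite) set). g j) = (\<Prod>i\<in>UNIV. g (axis i 1))"
proof -
  have 1: "(Basis :: (real^'n) set) = (\<lambda>i. axis i 1) ` UNIV" by (auto simp: Basis_vec_def)
  have 2: "inj (\<lambda>i::'n. axis i (1::real))" by (auto simp: inj_def axis_eq_axis)
  show ?thesis unfolding 1 by (subst prod.reindex[OF 2]) (simp add: o_def)
qed

lemma integral_cmul:
  fixes h :: "real^'n::finite \<Rightarrow> complex"
  assumes c: "c \<in> nonzero_coords" and h: "h \<in> borel_measurable borel"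
  shows "(LINT y|lborel. h y) = complex_of_real (\<Prod>i\<in>UNIV. \<bar>c $ i\<bar>) * (LINT x|lborel. h (cmul x c))"
proof -
  have T: "(0 + (\<Sum>j\<in>Basis. ((c \<bullet> j) * (x \<bullet> j)) *\<^sub>R j)) = cmul x c" for x
  proof (rule euclidean_eqI)
    fix b :: "real^'n" assume b: "b \<in> Basis"
    then have "(0 + (\<Sum>j\<in>Basis. ((c \<bullet> j) * (x \<bullet> j)) *\<^sub>R j)) \<bullet> b = (c \<bullet> b) * (x \<bullet> b)"
      by (simp add: inner_sum_left_Basis)
    also have "\<dots> = cmul x c \<bullet> b" using b by (auto simp: Basis_vec_def inner_axis)
    finally show "(0 + (\<Sum>j\<in>Basis. ((c \<bullet> j) * (x \<bullet> j)) *\<^sub>R j)) \<bullet> b = cmul x c \<bullet> b" .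
  qed
  have nz: "c \<bullet> j \<noteq> 0" if "j \<in> Basis" for j
    using that c by (auto simp: Basis_vec_def inner_axis nonzero_coords_def)
  have l: "lborel = density (distr lborel borel (\<lambda>x. cmul x c)) (\<lambda>_. ennreal (\<Prod>i\<in>UNIV. \<bar>c $ i\<bar>))"
    using lborel_affine_euclidean[of "\<lambda>j. c \<bullet> j" 0, OF nz]
    unfolding T prod_Basis_vec by (simp add: inner_axis)
  have m: "(\<lambda>x. cmul x c) \<in> borel_measurable borel"
    by (intro borel_measurable_continuous_onI linear_continuous_on bounded_linear_cmul)
  have "(LINT y|lborel. h y) = (LINT x|distr lborel borel (\<lambda>x. cmul x c). (\<Prod>i\<in>UNIV. \<bar>c $ i\<bar>) *\<^sub>R h x)"
    by (subst l, rule integral_density) (use h in \<open>auto intro!: AE_I2 prod_nonneg\<close>)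
  also have "\<dots> = (LINT x|lborel. (\<Prod>i\<in>UNIV. \<bar>c $ i\<bar>) *\<^sub>R h (cmul x c))"
    by (rule integral_distr) (use h m in auto)
  finally show ?thesis by (simp add: scaleR_conv_of_real)
qed

text \<open>The expansion of \<open>M_op T \<phi>\<close> into pieces is available off the
  hyperplanes; under the integral this is enough.\<close>

lemma AE_nonzero_coords: "AE y in lborel. y \<in> (nonzero_coords :: (real^'n::finite) set)"
proof -
  have "{y :: real^'n. y $ i = 0} \<in> null_sets lborel" for i
  proof -
    have "axis i 1 \<in> (Basis :: (real^'n) set)" by (auto simp: Basis_vec_def)
    then have "negligible {y :: real^'n. y \<bullet> axis i 1 = 0}" by (rule negligible_standard_hyperplane)
    moreover have "closed {y :: real^'n. y $ i = 0}"
      by (intro closed_Collect_eq continuous_intros)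
    ultimately show ?thesis
      by (simp add: inner_axis negligible_iff_null_sets null_sets_completion_iff borel_closed)
  qed
  then have "AE y :: real^'n in lborel. y $ i \<noteq> 0" for i
    using AE_not_in by fastforce
  then have "AE y :: real^'n in lborel. \<forall>i::'n. y $ i \<noteq> 0" by (simp add: AE_all_countable)
  then show ?thesis by (simp add: nonzero_coords_def)
qed

subsection \<open>Distributions in \<open>DH\<close> vanish near the coordinate hyperplanes\<close>

text \<open>A test function living in a thin slab around a hyperplane can be dilated into the unit
  cube by a vector y with a large i-th coordinate. The image of the dilated function vanishes at y
  by \<open>M_op_compact_support\<close>, and its value there is T of the original function.\<close>

lemma DH_vanishing:
  fixes T :: "(real^'n::finite \<Rightarrow> complex) \<Rightarrow> complex"
  assumes T: "T \<in> DH"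
  shows "\<exists>\<epsilon>>0. \<forall>i \<psi>. test_fun \<psi> \<longrightarrow> (\<forall>\<xi>. \<psi> \<xi> \<noteq> 0 \<longrightarrow> \<bar>\<xi> $ i\<bar> < \<epsilon>) \<longrightarrow> T \<psi> = 0"
proof -
  let ?Q = "cbox (\<chi> i. -1) (\<chi> i. 1) :: (real^'n) set"
  obtain R where R: "\<And>\<theta> y. test_fun \<theta> \<Longrightarrow> {x. \<theta> x \<noteq> 0} \<subseteq> ?Q \<Longrightarrow> norm y > R \<Longrightarrow> M_op T \<theta> y = 0"
    using M_op_compact_support[OF T compact_cbox] by metis
  define \<epsilon> where "\<epsilon> = 1 / (\<bar>R\<bar> + 1)"
  have \<epsilon>: "\<epsilon> > 0" by (simp add: \<epsilon>_def)
  have "T \<psi> = 0" if t: "test_fun \<psi>" and s: "\<And>\<xi>. \<psi> \<xi> \<noteq> 0 \<Longrightarrow> \<bar>\<xi> $ i\<bar> < \<epsilon>" for i \<psi>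
  proof -
    obtain K where K: "compact K" "{x. \<psi> x \<noteq> 0} \<subseteq> K" using t unfolding test_fun_iff by blast
    obtain N where N: "N > 0" "\<And>x. x \<in> K \<Longrightarrow> norm x \<le> N"
      using compact_imp_bounded[OF K(1)] unfolding bounded_pos by blast
    \<comment> \<open>The i-th entry stretches the half-width \<epsilon> of the slab exactly to 1
      and exceeds R, so \<open>norm y > R\<close>; the other entries shrink the support, of radius
      N, into the cube.\<close>
    define y where "y = (\<chi> j. if j = i then \<bar>R\<bar> + 1 else 1 / N)"
    have y: "y \<in> nonzero_coords" "\<And>j. y $ j > 0" using N by (auto simp: y_def nonzero_coords_def)
    define \<theta> where "\<theta> = (\<lambda>u. \<psi> (cmul u (cinv y)))"
    have t\<theta>: "test_fun \<theta>" unfolding \<theta>_def by (intro test_fun_cmul t cinv_nonzero_coords y)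
    have "u \<in> ?Q" if "\<theta> u \<noteq> 0" for u
    proof -
      let ?\<xi> = "cmul u (cinv y)"
      have z: "\<psi> ?\<xi> \<noteq> 0" using that by (simp add: \<theta>_def)
      have "\<bar>u $ j\<bar> \<le> 1" for j
      proof (cases "j = i")
        case True
        have "\<bar>u $ i\<bar> / (\<bar>R\<bar> + 1) < 1 / (\<bar>R\<bar> + 1)" using s[OF z] by (simp add: y_def \<epsilon>_def)
        moreover have "\<bar>R\<bar> + 1 > 0" by linarith
        ultimately show ?thesis using True by (simp add: divide_less_cancel)
      next
        case False
        have "\<bar>?\<xi> $ j\<bar> \<le> N" using component_le_norm_cart[of ?\<xi> j] N(2)[of ?\<xi>] z K(2) by fastforce
        then show ?thesis using False N(1) by (simp add: y_def abs_mult)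
      qed
      then show ?thesis by (auto simp: mem_box_cart abs_le_iff minus_le_iff)
    qed
    moreover have "norm y > R" using component_le_norm_cart[of y i] by (simp add: y_def)
    ultimately have "M_op T \<theta> y = 0" using R t\<theta> by blast
    then show ?thesis unfolding M_op_nonzero_coords[OF T t\<theta> y(1)] by (simp add: \<theta>_def cmul_cinv[OF y(1)])
  qed
  with \<epsilon> show ?thesis by blast
qed

text \<open>The dilates of \<open>shell\<close> by \<open>dyad k\<close>, \<open>k \<in> \<nat>\<^sup>d\<close>, form a partition of unity away from the
  coordinate hyperplanes.\<close>

definition eta :: "real \<Rightarrow> real \<Rightarrow> real" where
  "eta \<epsilon> t = wcut (\<epsilon>/2) \<epsilon> t - wcut (\<epsilon>/2) \<epsilon> (t/2)"

definition shell :: "real \<Rightarrow> real^'n::finite \<Rightarrow> complex" where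
  "shell \<epsilon> u = (\<Prod>i\<in>UNIV. complex_of_real (eta \<epsilon> (u $ i)))"

definition dyad :: "('n::finite \<Rightarrow> nat) \<Rightarrow> real^'n" where
  "dyad k = (\<chi> i. (1/2) ^ k i)"

lemma dyad_nth [simp]: "dyad k $ i = (1/2) ^ k i"
  by (simp add: dyad_def)

lemma dyad_nonzero_coords: "dyad k \<in> nonzero_coords"
  by (simp add: nonzero_coords_def)

text \<open>\<open>eta\<close> is a difference of cutoffs at consecutive dyadic scales, so the sum
  telescopes. For \<epsilon> > 0 the last term is 0 as soon as |t| (1/2)^N \<le>
  \<epsilon>/2.\<close>

lemma sum_eta: "(\<Sum>j<N. eta \<epsilon> (t * (1/2) ^ j)) = wcut (\<epsilon>/2) \<epsilon> t - wcut (\<epsilon>/2) \<epsilon> (t * (1/2) ^ N)"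
  by (induction N) (auto simp: eta_def)

text \<open>A finite set of multi-indices fits into a box, over which the sum factors into geometric
  sums, each at most 2.\<close>

lemma summable_dyad: "(\<lambda>k::'n::finite \<Rightarrow> nat. \<Prod>i\<in>UNIV. (1/2::real) ^ k i) summable_on UNIV"
proof (rule nonneg_bdd_above_summable_on)
  show "bdd_above (sum (\<lambda>k::'n \<Rightarrow> nat. \<Prod>i\<in>UNIV. (1/2::real) ^ k i) ` {F. F \<subseteq> UNIV \<and> finite F})"
  proof (rule bdd_aboveI2)
    fix F :: "('n \<Rightarrow> nat) set" assume "F \<in> {F. F \<subseteq> UNIV \<and> finite F}"
    then have fin: "finite F" by simp
    \<comment> \<open>\<open>insert 0\<close> covers the empty set, and \<open>Suc\<close> makes all
      entries strictly smaller than N.\<close>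
    define N where "N = Suc (Max (insert 0 ((\<lambda>(k, i). k i) ` (F \<times> UNIV))))"
    have "k i < N" if "k \<in> F" for k i
      unfolding N_def less_Suc_eq_le by (rule Max_ge) (use fin that in force)+
    then have FN: "F \<subseteq> PiE UNIV (\<lambda>i. {..<N})" by auto
    have "(\<Sum>k\<in>F. \<Prod>i\<in>UNIV. (1/2::real) ^ k i) \<le> (\<Sum>k\<in>PiE (UNIV :: 'n set) (\<lambda>i. {..<N}). \<Prod>i\<in>UNIV. (1/2) ^ k i)"
      by (rule sum_mono2[OF _ FN]) (auto intro: finite_PiE prod_nonneg)
    also have "\<dots> = (\<Prod>i\<in>(UNIV::'n set). \<Sum>j<N. (1/2) ^ j)"
      by (rule prod_sum_PiE[symmetric]) auto
    also have "\<dots> \<le> (\<Prod>i\<in>(UNIV::'n set). 2)"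
    proof (rule prod_mono)
      have "(\<Sum>j<N. (1/2::real) ^ j) \<le> 2"
        using sum_gp_strict[of "1/2::real" N] by simp
      then show "0 \<le> (\<Sum>j<N. (1/2::real) ^ j) \<and> (\<Sum>j<N. (1/2::real) ^ j) \<le> 2" by (simp add: sum_nonneg)
    qed
    finally show "(\<Sum>k\<in>F. \<Prod>i\<in>UNIV. (1/2::real) ^ k i) \<le> (\<Prod>i\<in>(UNIV::'n set). 2)" .
  qed
qed (auto intro: prod_nonneg)

text \<open>The series theorems applied later concern sequences; as the sums over multi-indices are
  unconditional, the order does not matter.\<close>

lemma multi_index_enumeration:
  obtains e :: "nat \<Rightarrow> ('n::finite \<Rightarrow> nat)" where "bij e"
proof -
  have "inj (\<lambda>n::nat. (\<lambda>i::'n. n))" by (auto simp: inj_def fun_eq_iff)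
  then have "infinite (UNIV :: ('n \<Rightarrow> nat) set)"
    by (meson finite_subset infinite_UNIV_nat finite_imageD subset_UNIV)
  then have "bij_betw (from_nat_into (UNIV :: ('n \<Rightarrow> nat) set)) UNIV UNIV"
    by (intro bij_betw_from_nat_into) auto
  then show ?thesis using that by blast
qed

section \<open>Dyadic pieces of a distribution vanishing near the hyperplanes\<close>

context
  fixes T :: "(real^'n::finite \<Rightarrow> complex) \<Rightarrow> complex" and \<epsilon> :: real
  assumes T: "T \<in> DH" and \<epsilon>: "\<epsilon> > 0"
    and vanish: "\<forall>i \<psi>. test_fun \<psi> \<longrightarrow> (\<forall>\<xi>. \<psi> \<xi> \<noteq> 0 \<longrightarrow> \<bar>\<xi> $ i\<bar> < \<epsilon>) \<longrightarrow> T \<psi> = 0"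
begin

text \<open>The levels \<epsilon>/2 and \<epsilon> belong to the partition of unity, \<epsilon>/4
  and \<epsilon>/2 to \<open>rinv\<close> and \<open>rabs\<close>, which are then exact on the shell
  because all coordinates there are at least \<epsilon>/2 in absolute value.\<close>

lemma cutoff_levels: "0 < \<epsilon>/2" "\<epsilon>/2 < \<epsilon>" "0 < \<epsilon>/4" "\<epsilon>/4 < \<epsilon>/2"
  using \<epsilon> by auto

lemmas T_dist = DH_distribution[OF T]

lemma smooth_cutoff: "smooth (\<lambda>\<xi>::real^'n. \<Prod>i\<in>A. complex_of_real (wcut (\<epsilon>/2) \<epsilon> (\<xi> $ i)))"
  using smooth_wcut[OF cutoff_levels(1,2), of 1] by (intro smooth_prod) simp

text \<open>Cutoffs are inserted one coordinate at a time: the difference of two consecutive stages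
  lives where the i-th coordinate is below \<epsilon> in absolute value, so \<open>vanish\<close>
  applies.\<close>

lemma T_cutoff:
  assumes t: "test_fun \<psi>"
  shows "T (\<lambda>\<xi>. (\<Prod>i\<in>A. complex_of_real (wcut (\<epsilon>/2) \<epsilon> (\<xi> $ i))) * \<psi> \<xi>) = T \<psi>"
proof -
  let ?c = "\<lambda>A \<xi>. \<Prod>i\<in>A. complex_of_real (wcut (\<epsilon>/2) \<epsilon> (\<xi> $ i))"
  have tc: "test_fun (\<lambda>\<xi>. ?c A \<xi> * \<psi> \<xi>)" for A by (intro test_fun_mult smooth_cutoff t)
  have "finite A" by simp
  then show ?thesis
  proof (induction A rule: finite_induct)
    case (insert i A)
    have "T (\<lambda>\<xi>. ?c A \<xi> * \<psi> \<xi> - ?c (insert i A) \<xi> * \<psi> \<xi>) = 0"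
    proof (rule vanish[rule_format])
      show "test_fun (\<lambda>\<xi>. ?c A \<xi> * \<psi> \<xi> - ?c (insert i A) \<xi> * \<psi> \<xi>)" by (intro test_fun_diff tc)
      fix \<xi> assume "?c A \<xi> * \<psi> \<xi> - ?c (insert i A) \<xi> * \<psi> \<xi> \<noteq> 0"
      then have "wcut (\<epsilon>/2) \<epsilon> (\<xi> $ i) \<noteq> 1" using insert by auto
      then show "\<bar>\<xi> $ i\<bar> < \<epsilon>" using wcut_eq_1[OF cutoff_levels(1,2), of "\<xi> $ i"] by linarith
    qed
    then show ?case using insert.IH unfolding distribution_diff[OF T_dist tc tc] by (metis right_minus_eq)
  qed simp
qed

lemma eta_nonzeroD:
  assumes "eta \<epsilon> t \<noteq> 0" shows "\<epsilon>/2 \<le> \<bar>t\<bar>" "\<bar>t\<bar> \<le> 2 * \<epsilon>"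
proof -
  show "\<epsilon>/2 \<le> \<bar>t\<bar>"
    using assms wcut_eq_0[OF cutoff_levels(1,2), of t] wcut_eq_0[OF cutoff_levels(1,2), of "t/2"] \<epsilon>
    by (cases "\<epsilon>/2 \<le> \<bar>t\<bar>") (auto simp: eta_def)
  show "\<bar>t\<bar> \<le> 2 * \<epsilon>"
    using assms wcut_eq_1[OF cutoff_levels(1,2), of t] wcut_eq_1[OF cutoff_levels(1,2), of "t/2"] \<epsilon>
    by (cases "\<bar>t\<bar> \<le> 2 * \<epsilon>") (auto simp: eta_def)
qed

lemma shell_nonzeroD: "shell \<epsilon> u \<noteq> 0 \<Longrightarrow> \<epsilon>/2 \<le> \<bar>u $ i\<bar>" "shell \<epsilon> u \<noteq> 0 \<Longrightarrow> \<bar>u $ i\<bar> \<le> 2 * \<epsilon>"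
  using eta_nonzeroD[of "u $ i"] by (auto simp: shell_def)

text \<open>The map \<sigma> selects coordinates, so that both the shell on R^d and the shell in the
  second half of a pair are covered.\<close>

lemma smooth_shell: "smooth (\<lambda>p::real^'m::finite. shell \<epsilon> (\<chi> i. p $ \<sigma> i) :: complex)"
proof -
  have "smooth (\<lambda>p::real^'m. complex_of_real (eta \<epsilon> (p $ \<sigma> i)))" for i
    using smooth_diff[OF smooth_wcut[OF cutoff_levels(1,2), of 1 "\<sigma> i"] smooth_wcut[OF cutoff_levels(1,2), of "1/2" "\<sigma> i"]]
    by (simp add: eta_def)
  then show ?thesis unfolding shell_def by (simp add: smooth_prod)
qed

abbreviation (input) "Q \<equiv> cbox (\<chi> i. - (2 * \<epsilon>)) (\<chi> i. 2 * \<epsilon>) :: (real^'n) set"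

lemma shell_support: "u \<notin> Q \<Longrightarrow> shell \<epsilon> (u :: real^'n) = 0"
proof (rule ccontr)
  assume u: "u \<notin> Q" "shell \<epsilon> u \<noteq> 0"
  have "- (2 * \<epsilon>) \<le> u $ i \<and> u $ i \<le> 2 * \<epsilon>" for i
    using shell_nonzeroD(2)[OF u(2), of i] by linarith
  with u(1) show False by (simp add: mem_box_cart)
qed

abbreviation (input) "lam k \<equiv> (\<lambda>\<theta>. T (\<lambda>\<xi>. \<theta> (cmul \<xi> (dyad k))))"

lemma distribution_lam: "distribution (lam k)"
  by (intro distribution_dilation T_dist dyad_nonzero_coords)

text \<open>The value \<open>lam k \<phi>\<close> is \<open>M_op T \<phi>\<close> at the point
  \<open>dyad k\<close>, and a test function is bounded. All bounds uniform in k rest on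
  this.\<close>

lemma lam_pointwise_bounded: "test_fun \<phi> \<Longrightarrow> \<exists>C. \<forall>k\<in>UNIV. norm (lam k \<phi>) \<le> C"
  using test_fun_bounded[OF test_fun_M_op[OF T], of \<phi> "[]"]
  by (auto simp: M_op_nonzero_coords[OF T _ dyad_nonzero_coords, symmetric])

lemma lam_bounded_family:
  assumes "family K F" "compact X"
  shows "\<exists>C. \<forall>k. \<forall>z\<in>X. norm (lam k (\<lambda>u. F (pair z u))) \<le> C"
  using distributions_bounded_on_bounded_tests[OF distribution_lam lam_pointwise_bounded bounded_tests_family[OF assms]]
  by auto

definition shell_family :: "(real^'n \<Rightarrow> complex) \<Rightarrow> real^('n + 'n) \<Rightarrow> complex" where
  "shell_family \<phi> p = shell \<epsilon> (\<chi> i. p $ Inr i) * \<phi> (\<chi> i. p $ Inl i * p $ Inr i)"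

lemma shell_family_pair: "shell_family \<phi> (pair z u) = shell \<epsilon> u * \<phi> (cmul u z)"
  by (simp add: shell_family_def cmul_def mult.commute)

lemma family_shell_family:
  assumes "smooth \<phi>" shows "family Q (shell_family \<phi>)"
proof -
  have "smooth (\<lambda>p::real^('n+'n). \<phi> (\<chi> i. p $ Inl i * p $ Inr i))"
    by (rule smooth_compose[OF assms]) (auto intro!: smooth_mult)
  then have "smooth (shell_family \<phi>)"
    unfolding shell_family_def by (intro smooth_mult smooth_shell)
  then show ?thesis
    by (auto simp: family_def shell_family_pair shell_support)
qed

text \<open>The contribution of the k-th dyadic part of T to \<open>M_op T \<phi> y\<close>, written
  with the rescaled parameter y / \<open>dyad k\<close>: the family is then independent of k and
  \<open>lam_bounded_family\<close> applies. \<open>piece_eq\<close> is the direct form.\<close>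

definition piece :: "(real^'n \<Rightarrow> complex) \<Rightarrow> ('n \<Rightarrow> nat) \<Rightarrow> real^'n \<Rightarrow> complex" where
  "piece \<phi> k y = lam k (\<lambda>u. shell_family \<phi> (pair (cmul y (cinv (dyad k))) u))"

lemma piece_eq: "piece \<phi> k y = T (\<lambda>\<xi>. shell \<epsilon> (cmul \<xi> (dyad k)) * \<phi> (cmul \<xi> y))"
proof -
  have "cmul (cmul \<xi> (dyad k)) (cmul y (cinv (dyad k))) = cmul \<xi> y" for \<xi> :: "real^'n"
    by (simp add: vec_eq_iff)
  then show ?thesis by (simp add: piece_def shell_family_pair)
qed

text \<open>For y off the hyperplanes the sum is finite: the compact support of \<phi> bounds all
  coordinates of \<xi> by c, whereas the k-th shell needs the i-th one to be at least 2^(k_i)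
  \<epsilon>/2 in absolute value. Over the remaining box the shells add up to the cutoff, which
  \<open>T_cutoff\<close> removes.\<close>

lemma piece_has_sum:
  assumes t: "test_fun \<phi>" and y: "y \<in> nonzero_coords"
  shows "((\<lambda>k. piece \<phi> k y) has_sum M_op T \<phi> y) UNIV"
proof -
  obtain K where K: "compact K" "{x. \<phi> x \<noteq> 0} \<subseteq> K" using t unfolding test_fun_iff by blast
  obtain \<rho> where \<rho>: "\<rho> > 0" "\<And>x. x \<in> K \<Longrightarrow> norm x \<le> \<rho>"
    using compact_imp_bounded[OF K(1)] unfolding bounded_pos by blast
  define c where "c = (\<Sum>i\<in>UNIV. \<rho> / \<bar>y $ i\<bar>)"
  have yi: "\<bar>y $ i\<bar> > 0" for i using y by (simp add: nonzero_coords_def)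
  have c: "\<bar>\<xi> $ i\<bar> \<le> c" if "\<phi> (cmul \<xi> y) \<noteq> 0" for \<xi> i
  proof -
    have "\<bar>cmul \<xi> y $ i\<bar> \<le> \<rho>"
      using component_le_norm_cart[of "cmul \<xi> y" i] \<rho>(2)[of "cmul \<xi> y"] K(2) that by fastforce
    then have "\<bar>\<xi> $ i\<bar> \<le> \<rho> / \<bar>y $ i\<bar>" using yi[of i] by (simp add: abs_mult field_simps)
    also have "\<dots> \<le> c" unfolding c_def
      using \<rho>(1) by (intro member_le_sum) (auto intro: divide_nonneg_nonneg)
    finally show ?thesis .
  qed
  have c0: "c \<ge> 0" unfolding c_def using \<rho>(1) by (intro sum_nonneg divide_nonneg_nonneg) auto
  have "(\<lambda>N. c * (1/2::real) ^ N) \<longlonglongrightarrow> c * 0" by (intro tendsto_mult_left LIMSEQ_power_zero) simp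
  then have "\<forall>\<^sub>F N in sequentially. c * (1/2::real) ^ N < \<epsilon>/2" using \<epsilon> by (intro order_tendstoD(2)) auto
  then obtain N where N: "c * (1/2::real) ^ N < \<epsilon>/2" using eventually_happens trivial_limit_sequentially by blast
  have small: "\<bar>\<xi> $ i * (1/2) ^ n\<bar> < \<epsilon>/2" if "\<phi> (cmul \<xi> y) \<noteq> 0" "n \<ge> N" for \<xi> i n
  proof -
    have "\<bar>\<xi> $ i * (1/2) ^ n\<bar> = \<bar>\<xi> $ i\<bar> * (1/2) ^ n" by (simp add: abs_mult)
    also have "\<dots> \<le> c * (1/2) ^ N" using c[OF that(1)] c0 that(2) by (intro mult_mono power_decreasing) auto
    finally show ?thesis using N by simp
  qed
  let ?B = "PiE UNIV (\<lambda>i::'n. {..<N})"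
  let ?f = "\<lambda>k \<xi>. shell \<epsilon> (cmul \<xi> (dyad k)) * \<phi> (cmul \<xi> y)"
  have tf: "test_fun (?f k)" for k
    using smooth_cmul[OF smooth_shell[of "\<lambda>i::'n. i"], of "dyad k"] t y
    by (intro test_fun_mult test_fun_cmul) (simp_all add: cmul_def)
  show ?thesis
  proof (rule has_sum_finite_neutralI[of ?B])
    show "finite ?B" by (intro finite_PiE) auto
    show "piece \<phi> k y = 0" if k: "k \<in> UNIV - ?B" for k
    proof -
      obtain i where i: "k i \<ge> N" using k by (auto simp: PiE_iff not_less)
      have "?f k \<xi> = 0" for \<xi>
        using shell_nonzeroD(1)[of "cmul \<xi> (dyad k)" i] small[of \<xi> "k i" i] i by fastforce
      then have "?f k = (\<lambda>\<xi>. 0)" by blast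
      then show ?thesis by (simp only: piece_eq distribution_zero[OF T_dist])
    qed
    have w: "(\<Sum>k\<in>?B. ?f k \<xi>) = (\<Prod>i\<in>UNIV. complex_of_real (wcut (\<epsilon>/2) \<epsilon> (\<xi> $ i))) * \<phi> (cmul \<xi> y)" for \<xi>
    proof (cases "\<phi> (cmul \<xi> y) = 0")
      case False
      have "(\<Sum>k\<in>?B. shell \<epsilon> (cmul \<xi> (dyad k))) = (\<Prod>i\<in>UNIV. \<Sum>j<N. complex_of_real (eta \<epsilon> (\<xi> $ i * (1/2) ^ j)))"
        unfolding shell_def by (subst prod_sum_PiE) auto
      also have "\<dots> = (\<Prod>i\<in>UNIV. complex_of_real (wcut (\<epsilon>/2) \<epsilon> (\<xi> $ i)))"
        unfolding of_real_sum[symmetric] sum_eta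
        using wcut_eq_0[OF cutoff_levels(1,2)] small[OF False order_refl] by (simp add: less_imp_le)
      finally show ?thesis by (simp add: sum_distrib_right[symmetric])
    qed simp
    have "M_op T \<phi> y = T (\<lambda>\<xi>. \<phi> (cmul \<xi> y))" by (rule M_op_nonzero_coords[OF T t y])
    also have "\<dots> = T (\<lambda>\<xi>. \<Sum>k\<in>?B. ?f k \<xi>)"
      unfolding w using T_cutoff[OF test_fun_cmul[OF t y], of UNIV] by simp
    also have "\<dots> = (\<Sum>k\<in>?B. piece \<phi> k y)"
      unfolding piece_eq by (rule distribution_sum[OF T_dist]) (auto intro: tf finite_PiE)
    finally show "M_op T \<phi> y = (\<Sum>k\<in>?B. piece \<phi> k y)" .
  qed auto
qed

text \<open>\<open>kernel f (pair z u)\<close> stands for \<open>shell \<epsilon> u \<cdot> f(z / u) / |u\<^sub>1 \<cdots> u\<^sub>d|\<close>; the functions \<open>rinv\<close>, \<open>rabs\<close> only serve to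
  make it smooth in \<open>u\<close> off the shell as well.\<close>

definition kernel :: "(real^'n \<Rightarrow> complex) \<Rightarrow> real^('n + 'n) \<Rightarrow> complex" where
  "kernel f p = shell \<epsilon> (\<chi> i. p $ Inr i) * (\<Prod>i\<in>UNIV. complex_of_real (rabs (\<epsilon>/4) (\<epsilon>/2) (p $ Inr i)))
     * f (\<chi> i. p $ Inl i * rinv (\<epsilon>/4) (\<epsilon>/2) (p $ Inr i))"

lemma kernel_pair:
  "kernel f (pair z u) = shell \<epsilon> u * (\<Prod>i\<in>UNIV. complex_of_real (rabs (\<epsilon>/4) (\<epsilon>/2) (u $ i)))
     * f (\<chi> i. z $ i * rinv (\<epsilon>/4) (\<epsilon>/2) (u $ i))"
  by (simp add: kernel_def)

lemma smooth_kernel_scaled: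
  assumes "smooth f"
  shows "smooth (\<lambda>p::real^('n + 'n). f (\<chi> i. p $ Inl i * b i * rinv (\<epsilon>/4) (\<epsilon>/2) (p $ Inr i)))"
proof (rule smooth_compose[OF assms])
  fix i
  have "smooth (\<lambda>p::real^('n + 'n). complex_of_real (p $ Inl i) * complex_of_real (b i) * complex_of_real (rinv (\<epsilon>/4) (\<epsilon>/2) (p $ Inr i)))"
    by (intro smooth_mult smooth_coord smooth_const smooth_rinv[OF cutoff_levels(3,4)])
  then show "smooth (\<lambda>p::real^('n + 'n). complex_of_real ((\<chi> i. p $ Inl i * b i * rinv (\<epsilon>/4) (\<epsilon>/2) (p $ Inr i)) $ i))"
    by simp
qed

lemma family_kernel:
  assumes "smooth f" shows "family Q (kernel f)"
proof -
  have "smooth (kernel f)"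
    unfolding kernel_def using smooth_kernel_scaled[OF assms, of "\<lambda>i. 1"]
    by (intro smooth_mult smooth_shell smooth_prod smooth_rabs[OF cutoff_levels(3,4)]) simp
  then show ?thesis by (auto simp: family_def kernel_pair shell_support)
qed

abbreviation (input) "vol k \<equiv> \<Prod>i\<in>UNIV. (1/2::real) ^ (k :: 'n \<Rightarrow> nat) i"

text \<open>The transpose of \<open>piece\<close>: in the coordinate u =
  \<open>cmul \<xi> (dyad k)\<close> the Jacobian factor 1/|\<xi>_1 ... \<xi>_d| splits into
  \<open>vol k\<close> and the part inside \<open>kernel\<close>.\<close>

definition dual_piece :: "(real^'n \<Rightarrow> complex) \<Rightarrow> ('n \<Rightarrow> nat) \<Rightarrow> real^'n \<Rightarrow> complex" where
  "dual_piece f k x = complex_of_real (vol k) * lam k (\<lambda>u. kernel f (pair (cmul x (dyad k)) u))"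

lemma smooth_piece: "smooth \<phi> \<Longrightarrow> smooth (piece \<phi> k)"
  unfolding piece_def
  by (rule smooth_cmul[OF smooth_distribution_family[OF distribution_lam family_shell_family]])

lemma smooth_dual_piece: "smooth f \<Longrightarrow> smooth (dual_piece f k)"
  unfolding dual_piece_def
  by (intro smooth_mult smooth_const smooth_cmul[OF smooth_distribution_family[OF distribution_lam family_kernel]])

lemma shell_product_support:
  assumes "shell \<epsilon> u \<noteq> 0" "norm (cmul u z) \<le> \<rho>"
  shows "\<bar>z $ i\<bar> \<le> 2 * \<rho> / \<epsilon>"
proof -
  have "\<epsilon>/2 * \<bar>z $ i\<bar> \<le> \<bar>u $ i\<bar> * \<bar>z $ i\<bar>"
    by (intro mult_right_mono shell_nonzeroD(1) assms) simp
  also have "\<dots> \<le> \<rho>" using component_le_norm_cart[of "cmul u z" i] assms(2) by (simp add: abs_mult)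
  finally show ?thesis using \<epsilon> by (simp add: field_simps)
qed

lemma shell_dyad_support:
  assumes "shell \<epsilon> u \<noteq> 0" "norm (cmul u (cmul y (cinv (dyad k)))) \<le> \<rho>"
  shows "\<bar>y $ i\<bar> \<le> 2 * \<rho> / \<epsilon> * (1/2) ^ k i"
proof -
  have "\<bar>y $ i\<bar> / (1/2) ^ k i \<le> 2 * \<rho> / \<epsilon>"
    using shell_product_support[OF assms, of i] unfolding cmul_nth cinv_nth dyad_nth
    by (simp add: abs_mult)
  then show ?thesis by (subst (asm) pos_divide_le_eq) simp_all
qed

text \<open>This is the substitution x = u y / \<open>dyad k\<close> for fixed u. The reciprocals it
  creates are written with \<open>rinv\<close> and \<open>rabs\<close>, exact on the shell, so that
  the new integrand is smooth in u everywhere.\<close>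

lemma kernel_substitution:
  fixes f \<phi> :: "real^'n \<Rightarrow> complex"
  assumes f: "smooth f" and \<phi>: "smooth \<phi>" and u: "shell \<epsilon> u \<noteq> 0"
  shows "(LINT y|lborel. f y * \<phi> (cmul u (cmul y (cinv (dyad k)))))
    = (LINT x|lborel. complex_of_real (vol k) * ((\<Prod>i\<in>UNIV. complex_of_real (rabs (\<epsilon>/4) (\<epsilon>/2) (u $ i)))
         * (\<phi> x * f (\<chi> i. x $ i * (1/2) ^ k i * rinv (\<epsilon>/4) (\<epsilon>/2) (u $ i)))))"
proof -
  let ?h = "\<lambda>y. f y * \<phi> (cmul u (cmul y (cinv (dyad k))))"
  define c where "c = cmul u (cinv (dyad k))"
  have ui: "\<bar>u $ i\<bar> \<ge> \<epsilon>/2" for i by (rule shell_nonzeroD(1)[OF u])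
  have "u $ i \<noteq> 0" for i using ui[of i] \<epsilon> by auto
  then have c: "c \<in> nonzero_coords" by (simp add: c_def nonzero_coords_def)
  have uc: "cmul u (cmul y (cinv (dyad k))) = cmul y c" for y
    by (simp add: vec_eq_iff c_def)
  have m: "?h \<in> borel_measurable borel"
    unfolding uc by (intro borel_measurable_continuous_onI smooth_continuous smooth_mult smooth_cmul f \<phi>)
  have ci: "cinv c $ i = (1/2) ^ k i * rinv (\<epsilon>/4) (\<epsilon>/2) (u $ i)" "\<bar>cinv c $ i\<bar> = (1/2) ^ k i * rabs (\<epsilon>/4) (\<epsilon>/2) (u $ i)" for i
    using ui[of i] by (auto simp: c_def rinv_eq[OF cutoff_levels(3,4)] rabs_eq[OF cutoff_levels(3,4)] power_one_over abs_mult)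
  have xc: "cmul x (cinv c) = (\<chi> i. x $ i * (1/2) ^ k i * rinv (\<epsilon>/4) (\<epsilon>/2) (u $ i))" for x
    unfolding vec_eq_iff cmul_nth ci by simp
  have "(LINT y|lborel. ?h y) = complex_of_real (\<Prod>i\<in>UNIV. \<bar>cinv c $ i\<bar>) * (LINT x|lborel. ?h (cmul x (cinv c)))"
    by (rule integral_cmul[OF cinv_nonzero_coords[OF c] m])
  also have "\<dots> = (LINT x|lborel. complex_of_real (vol k * (\<Prod>i\<in>UNIV. rabs (\<epsilon>/4) (\<epsilon>/2) (u $ i))) * (f (cmul x (cinv c)) * \<phi> x))"
    unfolding uc cmul_cinv(2)[OF c] ci(2) prod.distrib by simp
  also have "\<dots> = (LINT x|lborel. complex_of_real (vol k) * ((\<Prod>i\<in>UNIV. complex_of_real (rabs (\<epsilon>/4) (\<epsilon>/2) (u $ i)))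
         * (\<phi> x * f (\<chi> i. x $ i * (1/2) ^ k i * rinv (\<epsilon>/4) (\<epsilon>/2) (u $ i)))))"
    unfolding xc by (intro Bochner_Integration.integral_cong) (auto simp: mult_ac)
  finally show ?thesis .
qed

text \<open>The integral moves inside \<open>lam k\<close>, the substitution is made for each u, and
  the integral moves out again. \<open>F1\<close> and \<open>F2\<close> are the integrands before
  and after; the shell and \<phi> together confine y for the first, \<phi> alone confines x for the
  second.\<close>

lemma integral_piece:
  fixes f \<phi> :: "real^'n \<Rightarrow> complex"
  assumes f: "smooth f" and t: "test_fun \<phi>"
  shows "(LINT y|lborel. f y * piece \<phi> k y) = (LINT x|lborel. \<phi> x * dual_piece f k x)"
proof -
  have \<phi>: "smooth \<phi>" using t by auto
  obtain K where K: "compact K" "{x. \<phi> x \<noteq> 0} \<subseteq> K" using t unfolding test_fun_iff by blast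
  obtain \<rho> where \<rho>: "\<rho> > 0" "\<And>x. x \<in> K \<Longrightarrow> norm x \<le> \<rho>"
    using compact_imp_bounded[OF K(1)] unfolding bounded_pos by blast
  define F1 :: "real^('n + 'n) \<Rightarrow> complex" where
    "F1 = (\<lambda>p. f (\<chi> i. p $ Inl i) * (shell \<epsilon> (\<chi> i. p $ Inr i) * \<phi> (\<chi> i. p $ Inr i * (p $ Inl i * cinv (dyad k) $ i))))"
  have F1p: "F1 (pair y u) = f y * (shell \<epsilon> u * \<phi> (cmul u (cmul y (cinv (dyad k)))))" for y u
    by (simp add: F1_def cmul_def)
  have s1: "smooth F1" unfolding F1_def
  proof (intro smooth_mult smooth_shell)
    show "smooth (\<lambda>p::real^('n+'n). f (\<chi> i. p $ Inl i))" by (rule smooth_compose[OF f]) auto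
    show "smooth (\<lambda>p::real^('n+'n). \<phi> (\<chi> i. p $ Inr i * (p $ Inl i * cinv (dyad k) $ i)))"
      by (rule smooth_compose[OF \<phi>]) (simp only: vec_lambda_beta of_real_mult, intro smooth_mult smooth_coord smooth_const)
  qed
  have fam1: "family Q F1" using s1 by (auto simp: family_def F1p shell_support)
  let ?X = "cbox (\<chi> i. - (2 * \<rho> / \<epsilon> * (1/2) ^ k i)) (\<chi> i. 2 * \<rho> / \<epsilon> * (1/2) ^ k i) :: (real^'n) set"
  have F1X: "F1 (pair y u) = 0" if "y \<notin> ?X" for y u
  proof (rule ccontr)
    assume "F1 (pair y u) \<noteq> 0"
    then have *: "shell \<epsilon> u \<noteq> 0" "\<phi> (cmul u (cmul y (cinv (dyad k)))) \<noteq> 0" by (auto simp: F1p)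
    then have "norm (cmul u (cmul y (cinv (dyad k)))) \<le> \<rho>" using K(2) \<rho>(2) by blast
    from shell_dyad_support[OF *(1) this] have "\<bar>y $ i\<bar> \<le> 2 * \<rho> / \<epsilon> * (1/2) ^ k i" for i .
    then have "y \<in> ?X" unfolding mem_box_cart vec_lambda_beta abs_le_iff by (simp add: minus_le_iff)
    with that show False by simp
  qed
  define F2 :: "real^('n + 'n) \<Rightarrow> complex" where
    "F2 = (\<lambda>p. shell \<epsilon> (\<chi> i. p $ Inr i) * (complex_of_real (vol k) * ((\<Prod>i\<in>UNIV. complex_of_real (rabs (\<epsilon>/4) (\<epsilon>/2) (p $ Inr i)))
         * (\<phi> (\<chi> i. p $ Inl i) * f (\<chi> i. p $ Inl i * (1/2) ^ k i * rinv (\<epsilon>/4) (\<epsilon>/2) (p $ Inr i))))))"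
  have F2p: "F2 (pair x u) = shell \<epsilon> u * (complex_of_real (vol k) * ((\<Prod>i\<in>UNIV. complex_of_real (rabs (\<epsilon>/4) (\<epsilon>/2) (u $ i)))
         * (\<phi> x * f (\<chi> i. x $ i * (1/2) ^ k i * rinv (\<epsilon>/4) (\<epsilon>/2) (u $ i)))))" for x u
    by (simp add: F2_def)
  have s2: "smooth F2" unfolding F2_def
  proof (intro smooth_mult smooth_shell smooth_const smooth_prod smooth_rabs[OF cutoff_levels(3,4)] smooth_kernel_scaled f)
    show "smooth (\<lambda>p::real^('n+'n). \<phi> (\<chi> i. p $ Inl i))" by (rule smooth_compose[OF \<phi>]) auto
  qed
  have fam2: "family Q F2" using s2 by (auto simp: family_def F2p shell_support)
  have F2K: "F2 (pair x u) = 0" if "x \<notin> K" for x u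
    using K(2) that by (auto simp: F2p)
  have "f y * piece \<phi> k y = lam k (\<lambda>u. F1 (pair y u))" for y
  proof -
    have "test_fun (\<lambda>u. shell_family \<phi> (pair (cmul y (cinv (dyad k))) u))"
      by (rule test_fun_family[OF family_shell_family[OF \<phi>]])
    from distribution_cmult[OF distribution_lam[of k] this, of "f y"]
    show ?thesis by (simp add: piece_def F1p shell_family_pair)
  qed
  then have "(LINT y|lborel. f y * piece \<phi> k y) = (LINT y|lborel. lam k (\<lambda>u. F1 (pair y u)))" by simp
  also have "\<dots> = lam k (\<lambda>u. LINT y|lborel. F1 (pair y u))"
    by (rule distribution_integral_commute[OF distribution_lam fam1 compact_cbox F1X, symmetric])
  also have "(\<lambda>u. LINT y|lborel. F1 (pair y u)) = (\<lambda>u. LINT x|lborel. F2 (pair x u))"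
  proof
    fix u
    show "(LINT y|lborel. F1 (pair y u)) = (LINT x|lborel. F2 (pair x u))"
    proof (cases "shell \<epsilon> u = 0")
      case False
      have "(LINT y|lborel. F1 (pair y u)) = shell \<epsilon> u * (LINT y|lborel. f y * \<phi> (cmul u (cmul y (cinv (dyad k)))))"
        unfolding F1p by (subst integral_mult_right_zero[symmetric]) (simp add: mult_ac)
      also have "\<dots> = (LINT x|lborel. F2 (pair x u))"
        unfolding kernel_substitution[OF f \<phi> False] F2p by (subst integral_mult_right_zero) simp
      finally show ?thesis .
    qed (simp add: F1p F2p)
  qed
  also have "lam k (\<lambda>u. LINT x|lborel. F2 (pair x u)) = (LINT x|lborel. lam k (\<lambda>u. F2 (pair x u)))"
    by (rule distribution_integral_commute[OF distribution_lam fam2 K(1) F2K])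
  also have "\<dots> = (LINT x|lborel. \<phi> x * dual_piece f k x)"
  proof (rule Bochner_Integration.integral_cong[OF refl])
    fix x
    have "test_fun (\<lambda>u. kernel f (pair (cmul x (dyad k)) u))"
      by (rule test_fun_family[OF family_kernel[OF f]])
    from distribution_cmult[OF distribution_lam[of k] this, of "\<phi> x * complex_of_real (vol k)"]
    show "lam k (\<lambda>u. F2 (pair x u)) = \<phi> x * dual_piece f k x"
      by (simp add: dual_piece_def F2p kernel_pair mult_ac)
  qed
  finally show ?thesis .
qed

text \<open>The shell stays away from the hyperplanes, so the support of \<phi> confines y to a box
  with sides proportional to (1/2)^(k_i). The volume of this box makes the integrals of the pieces
  summable.\<close>

lemma piece_support:
  assumes \<rho>: "\<And>x. \<phi> x \<noteq> 0 \<Longrightarrow> norm x \<le> \<rho>" and nz: "piece \<phi> k y \<noteq> 0"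
  shows "\<bar>y $ i\<bar> \<le> 2 * \<rho> / \<epsilon> * (1/2) ^ k i"
proof -
  have "\<exists>u. shell_family \<phi> (pair (cmul y (cinv (dyad k))) u) \<noteq> 0"
  proof (rule ccontr)
    assume "\<not> ?thesis"
    then have "piece \<phi> k y = 0" by (simp add: piece_def distribution_zero[OF T_dist])
    with nz show False by simp
  qed
  then obtain u where u: "shell \<epsilon> u \<noteq> 0" "\<phi> (cmul u (cmul y (cinv (dyad k)))) \<noteq> 0"
    by (auto simp: shell_family_pair)
  show ?thesis by (rule shell_dyad_support[OF u(1) \<rho>[OF u(2)]])
qed

text \<open>The support estimate keeps the rescaled parameter in a box independent of k, on which
  \<open>lam_bounded_family\<close> gives one bound for all k.\<close>

lemma piece_bounded:
  assumes t: "test_fun \<phi>"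
  shows "\<exists>C. \<forall>k y. norm (piece \<phi> k y) \<le> C"
proof -
  obtain K where K: "compact K" "{x. \<phi> x \<noteq> 0} \<subseteq> K" using t unfolding test_fun_iff by blast
  obtain \<rho> where \<rho>: "\<rho> > 0" "\<And>x. x \<in> K \<Longrightarrow> norm x \<le> \<rho>"
    using compact_imp_bounded[OF K(1)] unfolding bounded_pos by blast
  let ?X = "cbox (\<chi> i. - (2 * \<rho> / \<epsilon>)) (\<chi> i. 2 * \<rho> / \<epsilon>) :: (real^'n) set"
  have "\<exists>C. \<forall>k. \<forall>z\<in>?X. norm (lam k (\<lambda>u. shell_family \<phi> (pair z u))) \<le> C"
    by (rule lam_bounded_family[OF family_shell_family[OF test_fun_smooth[OF t]] compact_cbox])
  then obtain C where C: "\<And>k z. z \<in> ?X \<Longrightarrow> norm (lam k (\<lambda>u. shell_family \<phi> (pair z u))) \<le> C" by blast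
  have "norm (piece \<phi> k y) \<le> max C 0" for k y
  proof (cases "piece \<phi> k y = 0")
    case False
    have "\<bar>cmul y (cinv (dyad k)) $ i\<bar> \<le> 2 * \<rho> / \<epsilon>" for i
    proof -
      have "\<bar>y $ i\<bar> \<le> 2 * \<rho> / \<epsilon> * (1/2) ^ k i"
        by (rule piece_support[OF _ False]) (use \<rho>(2) K(2) in blast)
      then have "\<bar>y $ i\<bar> / (1/2) ^ k i \<le> 2 * \<rho> / \<epsilon>" by (subst pos_divide_le_eq) simp_all
      then show ?thesis unfolding cmul_nth cinv_nth dyad_nth by (simp add: abs_mult)
    qed
    then have "cmul y (cinv (dyad k)) \<in> ?X" unfolding mem_box_cart vec_lambda_beta abs_le_iff by (simp add: minus_le_iff)
    from C[OF this, of k] show ?thesis by (simp add: piece_def)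
  qed simp
  then show ?thesis by blast
qed

section \<open>Summation over the pieces and the smooth dual function\<close>

context
  fixes e :: "nat \<Rightarrow> ('n \<Rightarrow> nat)"
  assumes e: "bij e"
begin

lemma summable_vol: "summable (\<lambda>n. vol (e n))"
  using summable_on_imp_summable[OF summable_on_reindex_bij_betw[OF e, THEN iffD2, OF summable_dyad]] .

lemma piece_sums:
  assumes "test_fun \<phi>" "y \<in> nonzero_coords"
  shows "(\<lambda>n. piece \<phi> (e n) y) sums M_op T \<phi> y" "summable (\<lambda>n. norm (piece \<phi> (e n) y))"
proof -
  have h: "((\<lambda>n. piece \<phi> (e n) y) has_sum M_op T \<phi> y) UNIV"
    using piece_has_sum[OF assms] has_sum_reindex_bij_betw[OF e, of "\<lambda>k. piece \<phi> k y"] by simp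
  then show "(\<lambda>n. piece \<phi> (e n) y) sums M_op T \<phi> y" by (rule has_sum_imp_sums)
  show "summable (\<lambda>n. norm (piece \<phi> (e n) y))"
    using has_sum_imp_summable[OF h] summable_on_iff_abs_summable_on_complex summable_on_imp_summable by blast
qed

text \<open>The k-th integrand is bounded by a constant and lives on a box of volume proportional to
  \<open>vol k\<close>, so the integrals of the absolute values are summable. The pieces add up to
  \<open>M_op T \<phi>\<close> almost everywhere.\<close>

lemma integral_M_op_sums:
  assumes f: "smooth f" and t: "test_fun \<phi>"
  shows "(\<lambda>n. LINT y|lborel. f y * piece \<phi> (e n) y) sums (LINT y|lborel. f y * M_op T \<phi> y)"
proof -
  obtain K where K: "compact K" "{x. \<phi> x \<noteq> 0} \<subseteq> K" using t unfolding test_fun_iff by blast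
  obtain \<rho> where \<rho>: "\<rho> > 0" "\<And>x. x \<in> K \<Longrightarrow> norm x \<le> \<rho>"
    using compact_imp_bounded[OF K(1)] unfolding bounded_pos by blast
  have \<rho>': "\<phi> x \<noteq> 0 \<Longrightarrow> norm x \<le> \<rho>" for x using K(2) \<rho>(2) by blast
  obtain C where C: "\<And>k y. norm (piece \<phi> k y) \<le> C" using piece_bounded[OF t] by blast
  have C0: "C \<ge> 0" using order_trans[OF norm_ge_zero C] .
  define c where "c = 2 * \<rho> / \<epsilon>"
  have c: "c > 0" using \<rho>(1) \<epsilon> by (simp add: c_def)
  let ?B = "\<lambda>k. cbox (\<chi> i. - (c * (1/2) ^ k i)) (\<chi> i. c * (1/2) ^ k i) :: (real^'n) set"
  have inB: "y \<in> ?B k" if "piece \<phi> k y \<noteq> 0" for k y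
    using piece_support[OF \<rho>' that] unfolding mem_box_cart vec_lambda_beta c_def abs_le_iff by (simp add: minus_le_iff)
  have B0: "?B k \<subseteq> ?B (\<lambda>i. 0)" for k
  proof
    fix y assume "y \<in> ?B k"
    moreover have "c * (1/2) ^ k i \<le> c" for i using c by (simp add: power_le_one)
    ultimately show "y \<in> ?B (\<lambda>i. 0)"
      unfolding mem_box_cart vec_lambda_beta power_0 mult_1_right by (meson le_minus_iff minus_le_iff order_trans)
  qed
  have "bounded (f ` ?B (\<lambda>i. 0))"
    by (intro compact_imp_bounded compact_continuous_image smooth_continuous f compact_cbox)
  then obtain D where D: "\<And>y. y \<in> ?B (\<lambda>i. 0) \<Longrightarrow> norm (f y) \<le> D" unfolding bounded_iff by blast
  have D0: "D \<ge> 0"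
  proof -
    have "0 \<in> ?B (\<lambda>i. 0)" using c by (simp add: mem_box_cart)
    from D[OF this] show ?thesis using norm_ge_zero order_trans by blast
  qed
  have le: "norm (f y * piece \<phi> k y) \<le> indicator (?B k) y * (D * C)" for k y
  proof (cases "piece \<phi> k y = 0")
    case False
    have "y \<in> ?B k" by (rule inB[OF False])
    then show ?thesis using D[of y] B0[of k] C[of k y] D0 by (auto simp: norm_mult intro!: mult_mono)
  qed (use C0 D0 in \<open>simp add: indicator_def\<close>)
  have int: "integrable lborel (\<lambda>y. f y * piece \<phi> k y)" for k
  proof (rule integrable_compact_support(1)[OF _ compact_cbox])
    show "continuous_on UNIV (\<lambda>y. f y * piece \<phi> k y)"
      by (intro smooth_continuous smooth_mult f smooth_piece test_fun_smooth t)
    show "f y * piece \<phi> k y = 0" if "y \<notin> ?B k" for y using inB that by auto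
  qed
  have mB: "measure lborel (?B k) = (2 * c) ^ CARD('n) * vol k" for k
  proof -
    have "?B k \<noteq> {}" using c unfolding interval_ne_empty_cart by (simp add: less_imp_le)
    then have "measure lborel (?B k) = (\<Prod>i\<in>UNIV. (2 * c) * (1/2) ^ k i)"
      by (subst content_cbox_cart) (simp_all add: mult_ac)
    then show ?thesis by (simp add: prod.distrib)
  qed
  have "(LINT y|lborel. norm (f y * piece \<phi> k y)) \<le> (LINT y|lborel. indicator (?B k) y * (D * C))" for k
    by (rule integral_mono[OF integrable_norm[OF int] _ le])
      (intro integrable_mult_left integrable_real_indicator emeasure_compact_finite compact_cbox, simp)
  then have bd: "(LINT y|lborel. norm (f y * piece \<phi> k y)) \<le> vol k * ((2 * c) ^ CARD('n) * (D * C))" for k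
    by (simp add: mB mult_ac)
  have "(\<lambda>n. LINT y|lborel. f y * piece \<phi> (e n) y) sums (LINT y|lborel. (\<Sum>n. f y * piece \<phi> (e n) y))"
  proof (rule sums_integral)
    show "integrable lborel (\<lambda>y. f y * piece \<phi> (e n) y)" for n by (rule int)
    show "AE y in lborel. summable (\<lambda>n. norm (f y * piece \<phi> (e n) y))"
      using AE_nonzero_coords
    proof eventually_elim
      case (elim y)
      show ?case unfolding norm_mult by (intro summable_mult piece_sums(2)[OF t elim])
    qed
    show "summable (\<lambda>n. LINT y|lborel. norm (f y * piece \<phi> (e n) y))"
      by (rule summable_comparison_test'[OF summable_mult2[OF summable_vol, of "(2 * c) ^ CARD('n) * (D * C)"], of 0])
        (use bd in simp)
  qed
  also have "(LINT y|lborel. (\<Sum>n. f y * piece \<phi> (e n) y)) = (LINT y|lborel. f y * M_op T \<phi> y)"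
  proof (rule integral_cong_AE)
    show "(\<lambda>y. \<Sum>n. f y * piece \<phi> (e n) y) \<in> borel_measurable lborel"
      by (intro borel_measurable_suminf borel_measurable_integrable int)
    show "(\<lambda>y. f y * M_op T \<phi> y) \<in> borel_measurable lborel"
      by (intro borel_measurable_integrable test_fun_integrable test_fun_M_op[OF T] t smooth_continuous f)
    show "AE y in lborel. (\<Sum>n. f y * piece \<phi> (e n) y) = f y * M_op T \<phi> y"
      using AE_nonzero_coords
      by eventually_elim (use sums_mult[OF piece_sums(1)[OF t]] in \<open>simp add: sums_iff\<close>)
  qed
  finally show ?thesis .
qed

definition dual :: "(real^'n \<Rightarrow> complex) \<Rightarrow> real^'n \<Rightarrow> complex" where
  "dual f x = (\<Sum>n. dual_piece f (e n) x)"

lemma iter_partial_dual_piece: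
  assumes f: "smooth f"
  shows "iter_partial is (dual_piece f k) x = complex_of_real (vol k) * (complex_of_real (\<Prod>i\<leftarrow>is. dyad k $ i)
      * lam k (\<lambda>u. iter_partial (map Inl is) (kernel f) (pair (cmul x (dyad k)) u)))"
proof -
  have s: "smooth (\<lambda>z. lam k (\<lambda>u. kernel f (pair z u)))"
    by (rule smooth_distribution_family[OF distribution_lam family_kernel[OF f]])
  show ?thesis
    unfolding dual_piece_def
    by (simp add: iter_partial_cmult[OF smooth_cmul[OF s]] iter_partial_cmul[OF s]
        iter_partial_distribution_family[OF distribution_lam family_kernel[OF f]])
qed

text \<open>Each derivative contributes a factor (1/2)^(k_i) \<le> 1 and
  \<open>cmul x (dyad k)\<close> does not leave the ball, so one constant works for all k and the
  summable factor \<open>vol k\<close> remains.\<close>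

lemma dual_piece_bounded:
  assumes f: "smooth f"
  shows "\<exists>M. summable M \<and> (\<forall>n x. norm x \<le> R \<longrightarrow> norm (iter_partial is (dual_piece f (e n)) x) \<le> M n)"
proof -
  let ?G = "iter_partial (map Inl is) (kernel f)"
  have "\<exists>C. \<forall>k. \<forall>z\<in>cball 0 R. norm (lam k (\<lambda>u. ?G (pair z u))) \<le> C"
    by (rule lam_bounded_family[OF family_iter_partial[OF family_kernel[OF f]] compact_cball])
  then obtain C where C: "\<And>k z. z \<in> cball 0 R \<Longrightarrow> norm (lam k (\<lambda>u. ?G (pair z u))) \<le> C" by blast
  have p: "\<bar>\<Prod>i\<leftarrow>is. dyad k $ i\<bar> \<le> 1" for k :: "'n \<Rightarrow> nat"
  proof (induction "is")
    case (Cons i "is")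
    have "(1/2::real) ^ k i * \<bar>\<Prod>i\<leftarrow>is. dyad k $ i\<bar> \<le> 1 * 1"
      using Cons by (intro mult_mono power_le_one) auto
    then show ?case by (simp add: abs_mult)
  qed simp
  have "norm (iter_partial is (dual_piece f k) x) \<le> vol k * C" if x: "norm x \<le> R" for k x
  proof -
    have "norm (cmul x (dyad k)) \<le> norm x"
    proof (rule norm_le_componentwise_cart)
      fix i
      have "\<bar>x $ i\<bar> * (1/2) ^ k i \<le> \<bar>x $ i\<bar> * 1" by (intro mult_left_mono power_le_one) auto
      then show "norm (cmul x (dyad k) $ i) \<le> norm (x $ i)" by (simp add: abs_mult)
    qed
    then have "norm (lam k (\<lambda>u. ?G (pair (cmul x (dyad k)) u))) \<le> C" using x by (intro C) simp
    then have "\<bar>\<Prod>i\<leftarrow>is. dyad k $ i\<bar> * norm (lam k (\<lambda>u. ?G (pair (cmul x (dyad k)) u))) \<le> 1 * C"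
      by (intro mult_mono p) auto
    moreover have v: "vol k \<ge> 0" by (intro prod_nonneg) simp
    ultimately show ?thesis
      unfolding iter_partial_dual_piece[OF f] norm_mult norm_of_real abs_of_nonneg[OF v] mult_1
      by (rule mult_left_mono)
  qed
  then show ?thesis using summable_mult2[OF summable_vol, of C] by blast
qed

lemma smooth_dual: "smooth f \<Longrightarrow> smooth (dual f)"
  unfolding dual_def by (rule smooth_series(1)[OF smooth_dual_piece dual_piece_bounded])

lemma summable_dual: "smooth f \<Longrightarrow> summable (\<lambda>n. norm (dual_piece f (e n) x))"
  using dual_piece_bounded[of f "norm x" "[]"] by (auto intro: summable_comparison_test'[where N = 0])

lemma integral_dual_sums:
  assumes f: "smooth f" and t: "test_fun \<phi>"
  shows "(\<lambda>n. LINT x|lborel. \<phi> x * dual_piece f (e n) x) sums (LINT x|lborel. \<phi> x * dual f x)"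
proof -
  obtain K where K: "compact K" "{x. \<phi> x \<noteq> 0} \<subseteq> K" using t unfolding test_fun_iff by blast
  obtain R where R: "\<And>x. x \<in> K \<Longrightarrow> norm x \<le> R"
    using compact_imp_bounded[OF K(1)] unfolding bounded_iff by blast
  obtain M where M: "summable M" "\<And>n x. norm x \<le> R \<Longrightarrow> norm (dual_piece f (e n) x) \<le> M n"
    using dual_piece_bounded[OF f, of R "[]"] by auto
  have i\<phi>: "integrable lborel (\<lambda>x. norm (\<phi> x))"
    using integrable_norm[OF test_fun_integrable[OF t, of "\<lambda>x. 1"]] by simp
  have int: "integrable lborel (\<lambda>x. \<phi> x * dual_piece f (e n) x)" for n
    using test_fun_integrable[OF t smooth_continuous[OF smooth_dual_piece[OF f]]] by (simp add: mult.commute)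
  have le: "norm (\<phi> x * dual_piece f (e n) x) \<le> norm (\<phi> x) * M n" for n x
  proof (cases "\<phi> x = 0")
    case False
    then have "norm x \<le> R" using K(2) R by blast
    then show ?thesis unfolding norm_mult by (intro mult_left_mono M) auto
  qed simp
  have "(LINT x|lborel. norm (\<phi> x * dual_piece f (e n) x)) \<le> (LINT x|lborel. norm (\<phi> x) * M n)" for n
    by (rule integral_mono) (use int i\<phi> le in \<open>auto intro!: integrable_norm\<close>)
  then have bd: "(LINT x|lborel. norm (\<phi> x * dual_piece f (e n) x)) \<le> (LINT x|lborel. norm (\<phi> x)) * M n" for n
    by simp
  show ?thesis
    unfolding dual_def suminf_mult[OF summable_norm_cancel[OF summable_dual[OF f]], symmetric]
  proof (rule sums_integral)
    show "integrable lborel (\<lambda>x. \<phi> x * dual_piece f (e n) x)" for n by (rule int)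
    show "AE x in lborel. summable (\<lambda>n. norm (\<phi> x * dual_piece f (e n) x))"
      unfolding norm_mult by (intro always_eventually allI summable_mult summable_dual f)
    show "summable (\<lambda>n. LINT x|lborel. norm (\<phi> x * dual_piece f (e n) x))"
      by (rule summable_comparison_test'[OF summable_mult[OF M(1), of "LINT x|lborel. norm (\<phi> x)"], of 0])
        (use bd in simp)
  qed
qed

text \<open>Both integrals are sums of the same series, whose terms \<open>integral_piece\<close>
  identifies.\<close>

lemma L_op_reg:
  assumes f: "smooth f" shows "L_op T (reg f) = reg (dual f)"
proof
  fix \<phi> :: "real^'n \<Rightarrow> complex"
  show "L_op T (reg f) \<phi> = reg (dual f) \<phi>"
  proof (cases "test_fun \<phi>")
    case t: True
    have "(LINT y|lborel. f y * M_op T \<phi> y) = (LINT x|lborel. \<phi> x * dual f x)"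
      using sums_unique2[OF integral_M_op_sums[OF f t]] integral_dual_sums[OF f t]
      unfolding integral_piece[OF f t] by blast
    then show ?thesis using t by (simp add: L_op_def reg_def test_fun_M_op[OF T] mult.commute)
  qed (simp add: L_op_def reg_def)
qed

text \<open>Monomials are multiplicative for the coordinatewise product, so \<open>m x\<close>
  factors out of the kernel and of every dual piece. The eigenvalue is \<open>dual m\<close> at the
  all-ones vector.\<close>

lemma dual_monomial:
  fixes \<alpha> :: "'n \<Rightarrow> nat"
  defines "m \<equiv> \<lambda>x::real^'n. complex_of_real (\<Prod>i\<in>UNIV. (x $ i) ^ \<alpha> i)"
  shows "smooth m" "dual m x = m x * dual m (\<chi> i. 1)"
proof -
  show s: "smooth m" unfolding m_def of_real_prod of_real_power by (intro smooth_prod smooth_power smooth_coord)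
  have "kernel m (pair (cmul x (dyad k)) u) = m x * kernel m (pair (cmul (\<chi> i. 1) (dyad k)) u)" for k u
    by (simp add: kernel_pair m_def power_mult_distrib prod.distrib mult_ac)
  then have "dual_piece m k x = m x * dual_piece m k (\<chi> i. 1)" for k
    using distribution_cmult[OF distribution_lam[of k] test_fun_family[OF family_kernel[OF s]], of "m x" "cmul (\<chi> i. 1) (dyad k)"]
    by (simp add: dual_piece_def)
  then show "dual m x = m x * dual m (\<chi> i. 1)"
    unfolding dual_def using suminf_mult[OF summable_norm_cancel[OF summable_dual[OF s]], of "m x" "\<chi> i. 1"] by simp
qed

lemma L_op_monomial: "\<exists>c. L_op T (monomial \<alpha>) = (\<lambda>\<phi>. c * monomial \<alpha> \<phi>)"
proof -
  define m where "m = (\<lambda>x::real^'n. complex_of_real (\<Prod>i\<in>UNIV. (x $ i) ^ \<alpha> i))"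
  note dm = dual_monomial[of \<alpha>, folded m_def]
  define c where "c = dual m (\<chi> i. 1)"
  have "dual m = (\<lambda>x. c * m x)"
    by (rule ext, subst dm(2)) (simp add: c_def m_def mult.commute)
  then have "L_op T (reg m) = reg (\<lambda>x. c * m x)" using L_op_reg[OF dm(1)] by simp
  also have "\<dots> = (\<lambda>\<phi>. c * reg m \<phi>)"
    by (rule ext) (simp add: reg_def mult.assoc)
  finally show ?thesis unfolding monomial_def m_def[symmetric] by (rule exI)
qed

end

end

theorem theorem8:
  fixes T :: "(real^'n::finite \<Rightarrow> complex) \<Rightarrow> complex"
  assumes "T \<in> DH"
  shows "L_op T \<in> MM \<and>
         (\<forall>f. smooth f \<longrightarrow> (\<exists>g. smooth g \<and> L_op T (reg f) = reg g))"
proof -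
  obtain \<epsilon> where \<epsilon>: "\<epsilon> > 0" and vanish: "\<forall>i \<psi>. test_fun \<psi> \<longrightarrow> (\<forall>\<xi>. \<psi> \<xi> \<noteq> 0 \<longrightarrow> \<bar>\<xi> $ i\<bar> < \<epsilon>) \<longrightarrow> T \<psi> = 0"
    using DH_vanishing[OF assms] by blast
  obtain e :: "nat \<Rightarrow> ('n \<Rightarrow> nat)" where e: "bij e" by (rule multi_index_enumeration)
  have "L_op T ` distributions \<subseteq> distributions"
    using distribution_L_op[OF assms] by (auto simp: distributions_def)
  moreover have "L_op T (\<lambda>\<phi>. a * S \<phi> + b * S' \<phi>) = (\<lambda>\<phi>. a * L_op T S \<phi> + b * L_op T S' \<phi>)" for S S' a b
    by (auto simp: L_op_def)
  moreover have "\<exists>c. L_op T (monomial \<alpha>) = (\<lambda>\<phi>. c * monomial \<alpha> \<phi>)" for \<alpha>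
    by (rule L_op_monomial[OF assms \<epsilon> vanish e])
  ultimately have "L_op T \<in> MM" unfolding MM_def by (simp add: continuous_on_L_op[OF assms])
  moreover have "\<exists>g. smooth g \<and> L_op T (reg f) = reg g" if "smooth f" for f
    by (intro exI conjI) (rule smooth_dual[OF assms \<epsilon> vanish e that], rule L_op_reg[OF assms \<epsilon> vanish e that])
  ultimately show ?thesis by blast
qed

end
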